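(* There is an algorithm that, given any $n$-player $k$-strategy anonymous game, computes an $\tilde{O}(n^{-1/3}k^{11/3})$-approximate Nash equilibrium of the game in time $\tilde{O}((n+k)\,k\,n^k)$.
   Context: Anonymous game: a tuple $(n,k,\{u^i_a\}_{i\in[n],a\in[k]})$ with players $[n]=\{1,\dots,n\}$ and a common strategy set $[k]=\{1,\dots,k\}$. When player $i$ plays strategy $a$, her payoff is $u^i_a(x)$, where $u^i_a:\Pi^k_{n-1}\to[0,1]$ and $\Pi^k_{n-1}=\{(x_1,\dots,x_k): x_j\in\mathbb{Z}_{\ge 0},\ \sum_{j=1}^k x_j=n-1\}$; here $x_j$ is the number of the other $n-1$ players who play strategy $j$. The input to an algorithm is the list of all values $u^i_a(x)$. No relationship between $n$ and $k$ is assumed. A mixed strategy is a probability distribution on $[k]$; a mixed strategy profile is $s=(s_1,\dots,s_n)$ with each $s_i$ a mixed strategy, and $s_{-i}$ denotes the strategies of the players other than $i$. Writing $x\sim s_{-i}$ for the random partition in $\Pi^k_{n-1}$ obtained by independently drawing each player $j\ne i$'s strategy from $s_j$, the profile $s$ is an $\epsilon$-approximate Nash equilibrium iff for all $i\in[n]$ and all $a'\in[k]$, $$\mathbb{E}_{x\sim s_{-i}}[u^i_{a'}(x)]\le \mathbb{E}_{x\sim s_{-i},\,a\sim s_i}[u^i_a(x)]+\epsilon .$$ The notation $\tilde{O}(\cdot)$ hides factors polylogarithmic in the quantities involved. Standing assumption: given a mixed strategy profile, players' expected payoffs can be computed exactly. *)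

theory Defs
  imports "HOL-Probability.Probability"
begin

section \<open>Anonymous games\<close>

text \<open>Players are \<open>0, \<dots>, n - 1\<close> and strategies are \<open>0, \<dots>, k - 1\<close>. An element
  \<open>(x\<^sub>1, \<dots>, x\<^sub>k)\<close> of \<open>\<Pi>\<^sup>k\<^sub>m\<close> is a list of length \<open>k\<close>; the payoff
  \<open>u\<^sup>i\<^sub>a(x)\<close> is \<open>u i a x\<close>.\<close>

definition partitions :: "nat \<Rightarrow> nat \<Rightarrow> nat list set" where
  "partitions k m = {x. length x = k \<and> sum_list x = m}"

definition anonymous_game :: "nat \<Rightarrow> nat \<Rightarrow> (nat \<Rightarrow> nat \<Rightarrow> nat list \<Rightarrow> real) \<Rightarrow> bool" where
  "anonymous_game n k u \<longleftrightarrow>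
     (\<forall>i<n. \<forall>a<k. \<forall>x\<in>partitions k (n - 1). 0 \<le> u i a x \<and> u i a x \<le> 1)"

definition mixed_profile :: "nat \<Rightarrow> nat \<Rightarrow> (nat \<Rightarrow> nat pmf) \<Rightarrow> bool" where
  "mixed_profile n k s \<longleftrightarrow> (\<forall>i<n. set_pmf (s i) \<subseteq> {..<k})"

text \<open>The law of the random partition \<open>x \<sim> s\<^sub>-\<^sub>i\<close>. The second argument of \<open>Pi_pmf\<close>
  is the irrelevant value of the drawn function outside its index set.\<close>

definition others :: "nat \<Rightarrow> nat \<Rightarrow> (nat \<Rightarrow> nat pmf) \<Rightarrow> nat \<Rightarrow> nat list pmf" where
  "others n k s i =
     map_pmf (\<lambda>f. map (\<lambda>a. card {j \<in> {..<n} - {i}. f j = a}) [0..<k])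
             (Pi_pmf ({..<n} - {i}) 0 s)"

definition approx_nash ::
    "nat \<Rightarrow> nat \<Rightarrow> (nat \<Rightarrow> nat \<Rightarrow> nat list \<Rightarrow> real) \<Rightarrow> real \<Rightarrow> (nat \<Rightarrow> nat pmf) \<Rightarrow> bool" where
  "approx_nash n k u \<epsilon> s \<longleftrightarrow> mixed_profile n k s \<and>
     (\<forall>i<n. \<forall>a'<k.
        measure_pmf.expectation (others n k s i) (\<lambda>x. u i a' x)
        \<le> measure_pmf.expectation (pair_pmf (others n k s i) (s i)) (\<lambda>(x, a). u i a x) + \<epsilon>)"


section \<open>Algorithms\<close>

text \<open>Algorithms are programs for a real RAM with unit costs. The memory consists of arrays of
  natural numbers and arrays of reals, all of unbounded length. Arrays are named by numerals that
  occur literally in the program, so that a program has only finitely many of them; cells are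
  addressed by computed indices. Arithmetic on reals is exact, so expected payoffs can be computed
  exactly. To keep unit costs reasonable, natural numbers have only addition and truncated
  subtraction, the only real constants are (converted) natural numbers, and there is no rounding
  operation from reals to natural numbers.\<close>

record memory =
  nats :: "nat \<Rightarrow> nat \<Rightarrow> nat"
  reals :: "nat \<Rightarrow> nat \<Rightarrow> real"

datatype nexp = NConst nat | NLoad nat nexp | NAdd nexp nexp | NSub nexp nexp

datatype rexp = ROfNat nexp | RLoad nat nexp
  | RAdd rexp rexp | RSub rexp rexp | RMul rexp rexp | RDiv rexp rexp

datatype bexp = NLess nexp nexp | RLess rexp rexp | Not bexp | And bexp bexp

datatype com = Skip
  | NStore nat nexp nexp
  | RStore nat nexp rexp
  | Seq com com
  | Cond bexp com com
  | While bexp com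

primrec nval :: "nexp \<Rightarrow> memory \<Rightarrow> nat" where
  "nval (NConst c) m = c"
| "nval (NLoad A e) m = nats m A (nval e m)"
| "nval (NAdd e f) m = nval e m + nval f m"
| "nval (NSub e f) m = nval e m - nval f m"

primrec rval :: "rexp \<Rightarrow> memory \<Rightarrow> real" where
  "rval (ROfNat e) m = real (nval e m)"
| "rval (RLoad A e) m = reals m A (nval e m)"
| "rval (RAdd e f) m = rval e m + rval f m"
| "rval (RSub e f) m = rval e m - rval f m"
| "rval (RMul e f) m = rval e m * rval f m"
| "rval (RDiv e f) m = rval e m / rval f m"

primrec bval :: "bexp \<Rightarrow> memory \<Rightarrow> bool" where
  "bval (NLess e f) m \<longleftrightarrow> nval e m < nval f m"
| "bval (RLess e f) m \<longleftrightarrow> rval e m < rval f m"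
| "bval (Not b) m \<longleftrightarrow> \<not> bval b m"
| "bval (And b c) m \<longleftrightarrow> bval b m \<and> bval c m"

definition nstore :: "nat \<Rightarrow> nat \<Rightarrow> nat \<Rightarrow> memory \<Rightarrow> memory" where
  "nstore A j v m = m\<lparr>nats := (nats m)(A := (nats m A)(j := v))\<rparr>"

definition rstore :: "nat \<Rightarrow> nat \<Rightarrow> real \<Rightarrow> memory \<Rightarrow> memory" where
  "rstore A j v m = m\<lparr>reals := (reals m)(A := (reals m A)(j := v))\<rparr>"

text \<open>\<open>exec c m t m'\<close>: run from memory \<open>m\<close>, the program \<open>c\<close> halts after \<open>t\<close> steps with memory
  \<open>m'\<close>. An assignment or a test counts as one step: the expressions of a fixed program have
  bounded size, so this changes the number of operations by a constant factor only.\<close>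

inductive exec :: "com \<Rightarrow> memory \<Rightarrow> nat \<Rightarrow> memory \<Rightarrow> bool" where
  Skip: "exec Skip m 1 m"
| NStore: "exec (NStore A e f) m 1 (nstore A (nval e m) (nval f m) m)"
| RStore: "exec (RStore A e f) m 1 (rstore A (nval e m) (rval f m) m)"
| Seq: "exec c m t m' \<Longrightarrow> exec d m' t' m'' \<Longrightarrow> exec (Seq c d) m (t + t') m''"
| CondTrue: "bval b m \<Longrightarrow> exec c m t m' \<Longrightarrow> exec (Cond b c d) m (1 + t) m'"
| CondFalse: "\<not> bval b m \<Longrightarrow> exec d m t m' \<Longrightarrow> exec (Cond b c d) m (1 + t) m'"
| WhileFalse: "\<not> bval b m \<Longrightarrow> exec (While b c) m 1 m"
| WhileTrue: "bval b m \<Longrightarrow> exec c m t m' \<Longrightarrow> exec (While b c) m' t' m'' \<Longrightarrow>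
    exec (While b c) m (1 + t + t') m''"

lemma exec_deterministic:
  "exec c m t m' \<Longrightarrow> exec c m t2 m2 \<Longrightarrow> t2 = t \<and> m2 = m'"
proof (induction arbitrary: t2 m2 rule: exec.induct)
  case (Seq c m t m' d t' m'')
  from Seq.prems show ?case by (cases rule: exec.cases) (use Seq.IH in blast)+
next
  case (WhileTrue b m c t m' t' m'')
  from WhileTrue.prems show ?case
    by (cases rule: exec.cases) (use WhileTrue.IH WhileTrue.hyps in blast)+
qed (erule exec.cases; fastforce)+


section \<open>Input and output\<close>

text \<open>The elements of \<open>\<Pi>\<^sup>k\<^sub>m\<close> in lexicographic order.\<close>

fun partition_list :: "nat \<Rightarrow> nat \<Rightarrow> nat list list" where
  "partition_list 0 m = (if m = 0 then [[]] else [])"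
| "partition_list (Suc k) m =
     concat (map (\<lambda>j. map ((#) j) (partition_list k (m - j))) [0..<Suc m])"

lemma set_partition_list: "set (partition_list k m) = partitions k m"
proof (induction k arbitrary: m)
  case 0
  show ?case by (auto simp: partitions_def)
next
  case (Suc k)
  have "x \<in> partitions (Suc k) m \<longleftrightarrow> x \<in> set (partition_list (Suc k) m)" for x
    by (cases x) (auto simp: partitions_def Suc.IH image_iff simp del: upt_Suc)
  then show ?case by blast
qed

lemma sorted_partition_list:
  "sorted_wrt (\<lambda>x y. (x, y) \<in> lexord {(i, j). i < j}) (partition_list k m)"
proof (induction k arbitrary: m)
  case (Suc k)
  have "sorted_wrt (\<lambda>x y. (x, y) \<in> lexord {(i, j). i < j})
          (concat (map (\<lambda>j. map ((#) j) (partition_list k (m - j))) [0..<l]))" for l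
    using Suc.IH by (induction l) (auto simp: sorted_wrt_append sorted_wrt_map)
  then show ?case by (simp only: partition_list.simps)
qed simp

definition payoff_list :: "nat \<Rightarrow> nat \<Rightarrow> (nat \<Rightarrow> nat \<Rightarrow> nat list \<Rightarrow> real) \<Rightarrow> real list" where
  "payoff_list n k u =
     [u i a x. i \<leftarrow> [0..<n], a \<leftarrow> [0..<k], x \<leftarrow> partition_list k (n - 1)]"

definition input_memory :: "nat \<Rightarrow> nat \<Rightarrow> (nat \<Rightarrow> nat \<Rightarrow> nat list \<Rightarrow> real) \<Rightarrow> memory" where
  "input_memory n k u =
     \<lparr>nats = (\<lambda>A j. if A = 0 \<and> j = 0 then n else if A = 0 \<and> j = 1 then k else 0),
      reals = (\<lambda>A j. if A = 0 \<and> j < length (payoff_list n k u) then payoff_list n k u ! j else 0)\<rparr>"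

text \<open>A halted program outputs the probabilities \<open>s\<^sub>i(a)\<close> in the real array \<open>1\<close>, row by row.\<close>

definition outputs_profile :: "nat \<Rightarrow> nat \<Rightarrow> memory \<Rightarrow> (nat \<Rightarrow> nat pmf) \<Rightarrow> bool" where
  "outputs_profile n k m s \<longleftrightarrow> mixed_profile n k s \<and>
     (\<forall>i<n. \<forall>a<k. reals m 1 (i * k + a) = pmf (s i) a)"


section \<open>The soft-O notation\<close>

text \<open>Bounds in the two parameters \<open>n\<close> and \<open>k\<close>: the hidden factors are polylogarithmic in
  \<open>n\<close> and \<open>k\<close> (not in \<open>n ^ k\<close>), and the bound is uniform over all positive \<open>n\<close> and \<open>k\<close>.\<close>

definition soft_O :: "(nat \<Rightarrow> nat \<Rightarrow> real) \<Rightarrow> (nat \<Rightarrow> nat \<Rightarrow> real) set" where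
  "soft_O g = {f. \<exists>C::real. \<exists>c::nat. \<forall>n\<ge>1. \<forall>k\<ge>1.
     \<bar>f n k\<bar> \<le> C * ln (real (n + k + 1)) ^ c * \<bar>g n k\<bar>}"

end

theory Submission
  imports Defs
begin

text \<open>If \<open>n \<le> 64 k\<^sup>1\<^sup>1\<close>, the admissible error exceeds \<open>1\<close>. Otherwise let \<open>r\<close> be the least integer with
  \<open>n \<le> r\<^sup>3\<close> and let every player tremble: strategy \<open>a\<close> is replaced by a distribution with mass at least
  \<open>1 - k / r\<close> at \<open>a\<close> and at least \<open>1 / (2 r)\<close> everywhere. The expected payoffs then become
  \<open>O(1 / r)\<close>-Lipschitz in the counts of the opponents, because conditionally on the rest a large random
  number of opponents toss a fair coin between any two given strategies.

  By Kuhn's combinatorial lemma there are a count vector \<open>x\<close> and, for every player, a mixture of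
  approximate best responses to \<open>x\<close> such that the mixtures sum up to \<open>x\<close> within an error of \<open>2\<close>. Given
  \<open>x\<close>, a local search assigns the players to approximate best responses so that no count exceeds
  that of \<open>x\<close> by more than \<open>k + 2\<close>; the trembles of this assignment are an \<open>O(k\<^sup>2 / r)\<close>-approximate
  equilibrium. The program tries all \<open>x\<close>, in time \<open>O(n\<^sup>2 k\<^sup>2)\<close> each, after smoothing the payoffs. The number
  \<open>N\<close> of count vectors satisfies \<open>k\<^sup>2 N \<le> 15 n\<^bsup>k-1\<^esup>\<close>, which absorbs the powers of \<open>k\<close>.\<close>

section \<open>Approximate equilibria of Lipschitz games\<close>

text \<open>The exponent 1/3 comes from a balance. Trembling with probability \<open>t\<close> costs
  a player at most \<open>k * t\<close>. About \<open>n * t\<close> opponents then toss a given fair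
  coin, so moving one opponent changes an expected payoff by about
  \<open>s + 1 / (s * n * t)\<close> for any \<open>s > 0\<close>, at best 1 / sqrt (n t). This is
  of order \<open>t\<close> as well when \<open>t\<close> is about n^(-1/3), whence
  \<open>t = 1 / r\<close>.

  Without smoothing, a payoff can jump by 1 when one opponent moves, and a best response to
  \<open>x\<close> says nothing about nearby counts. The Lipschitz bound is what lets a single
  \<open>x\<close> serve all players, although each of them faces slightly different opponents and
  the rounding is off by O(k) per strategy.

  The time bound leaves about n^2 k^3 operations per count vector. Smoothing \<open>n * k\<close>
  payoff tables by k^2 elementary trembles at cost O(n) each uses just that much. Naturals have no
  multiplication, division or rounding, so powers, digits, codes and the cube root come from
  incremental tables and comparisons of reals.\<close>

lemma approx_fixed_point_cube:
  fixes f :: "(nat \<Rightarrow> real) \<Rightarrow> nat \<Rightarrow> real"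
  assumes range: "\<And>y i. (\<And>j. j < k \<Longrightarrow> 0 \<le> y j \<and> y j \<le> 1) \<Longrightarrow> i < k \<Longrightarrow> 0 \<le> f y i \<and> f y i \<le> 1"
    and lip: "\<And>y z h i. (\<And>j. j < k \<Longrightarrow> \<bar>y j - z j\<bar> \<le> h) \<Longrightarrow> i < k \<Longrightarrow> \<bar>f y i - f z i\<bar> \<le> L * h"
    and "0 < d"
  obtains y where "\<And>j. j < k \<Longrightarrow> 0 \<le> y j \<and> y j \<le> 1" "\<And>i. i < k \<Longrightarrow> \<bar>f y i - y i\<bar> \<le> d"
proof -
  obtain p :: nat where p: "(\<bar>L\<bar> + 1) / d < real p" using reals_Archimedean2 by blast
  have "0 < (\<bar>L\<bar> + 1) / d" using \<open>0 < d\<close> by simp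
  then have p0: "0 < p" using p by (cases p) auto
  have pd: "(L + 1) / real p \<le> d"
  proof -
    have "\<bar>L\<bar> + 1 < d * real p" using p \<open>0 < d\<close> by (simp add: field_simps)
    then show ?thesis using p0 by (simp add: field_simps)
  qed
  define g where "g x j = real (x j) / real p" for x :: "nat \<Rightarrow> nat" and j
  \<comment> \<open>Label 0 says that \<open>f\<close> does not decrease coordinate
    \<open>i\<close>; on the upper face the label is forced to 1, on the lower face it is 0 because
    \<open>f\<close> is nonnegative. A cell in which both labels of \<open>i\<close> occur bounds
    \<open>f y i - y i\<close> from both sides, up to the Lipschitz change plus one mesh width,
    which is \<open>(L + 1) / p\<close>.\<close>
  define label :: "(nat \<Rightarrow> nat) \<Rightarrow> nat \<Rightarrow> nat"
    where "label x i = (if g x i \<le> f (g x) i \<and> x i \<noteq> p then 0 else 1)" for x i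
  have g01: "\<forall>j<k. 0 \<le> g x j \<and> g x j \<le> 1" if "\<forall>i<k. x i \<le> p" for x
    using that p0 by (auto simp: g_def)
  have lab0: "\<forall>x. (\<forall>i<k. x i \<le> p) \<longrightarrow> (\<forall>i<k. x i = 0 \<longrightarrow> label x i = 0)"
  proof (intro allI impI)
    fix x :: "nat \<Rightarrow> nat" and i assume x: "\<forall>i<k. x i \<le> p" and "i < k" "x i = 0"
    have "0 \<le> f (g x) i" using range[of "g x" i] g01[OF x] \<open>i < k\<close> by blast
    then show "label x i = 0" using \<open>x i = 0\<close> p0 by (simp add: label_def g_def)
  qed
  have lab1: "\<forall>x. (\<forall>i<k. x i \<le> p) \<longrightarrow> (\<forall>i<k. x i = p \<longrightarrow> label x i = 1)"
    by (simp add: label_def)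
  have lab01: "\<forall>x. (\<forall>i<k. x i \<le> p) \<longrightarrow> (\<forall>i<k. label x i = 0 \<or> label x i = 1)"
    by (simp add: label_def)
  obtain q where q: "\<forall>i<k. q i < p"
    and rs: "\<forall>i<k. \<exists>r s. (\<forall>j<k. q j \<le> r j \<and> r j \<le> q j + 1) \<and>
      (\<forall>j<k. q j \<le> s j \<and> s j \<le> q j + 1) \<and> label r i \<noteq> label s i"
    using kuhn_lemma[OF p0 lab01 lab0 lab1] by blast
  have near: "\<bar>f (g q) i - f (g r) i\<bar> \<le> L / real p"
    if "\<forall>j<k. q j \<le> r j \<and> r j \<le> q j + 1" "i < k" for r i
  proof -
    have "\<bar>g q j - g r j\<bar> \<le> 1 / real p" if "j < k" for j
    proof -
      have "q j \<le> r j" "r j \<le> q j + 1" using that \<open>\<forall>j<k. q j \<le> r j \<and> r j \<le> q j + 1\<close> by auto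
      then have "\<bar>real (q j) - real (r j)\<bar> \<le> 1" by linarith
      then show ?thesis using p0 unfolding g_def by (simp add: divide_right_mono abs_divide flip: diff_divide_distrib)
    qed
    then show ?thesis using lip[of "g q" "g r" "1 / real p" i] \<open>i < k\<close> by simp
  qed
  show ?thesis
  proof (rule that[of "g q"])
    show "0 \<le> g q j \<and> g q j \<le> 1" if "j < k" for j using g01[of q] q that by (simp add: less_imp_le)
  next
    fix i assume i: "i < k"
    have main: "\<bar>f (g q) i - g q i\<bar> \<le> d"
      if r: "\<forall>j<k. q j \<le> r j \<and> r j \<le> q j + 1" "label r i = 0"
        and s: "\<forall>j<k. q j \<le> s j \<and> s j \<le> q j + 1" "label s i \<noteq> 0" for r s
    proof -
      have "g q i \<le> g r i" using r i p0 by (auto simp: g_def divide_right_mono)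
      moreover have "g r i \<le> f (g r) i" using r(2) by (simp add: label_def split: if_splits)
      ultimately have lo: "g q i - L / real p \<le> f (g q) i" using near[OF r(1) i] by linarith
      have s01: "\<forall>i<k. s i \<le> p" using s(1) q by (metis Suc_eq_plus1 Suc_leI le_trans)
      have "f (g s) i \<le> g s i"
      proof (cases "s i = p")
        case True
        then have "g s i = 1" using p0 by (simp add: g_def)
        then show ?thesis using range[of "g s" i] g01[OF s01] i by simp
      next
        case False
        then show ?thesis using s(2) by (simp add: label_def split: if_splits)
      qed
      moreover have "g s i \<le> g q i + 1 / real p"
      proof -
        have "real (s i) \<le> real (q i) + 1" using s(1) i by fastforce
        then show ?thesis using p0 by (simp add: g_def divide_right_mono flip: add_divide_distrib)
      qed
      ultimately have "f (g q) i \<le> g q i + (L + 1) / real p"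
        using near[OF s(1) i] by (simp add: add_divide_distrib)
      moreover have "L / real p \<le> (L + 1) / real p" by (simp add: divide_right_mono)
      ultimately show ?thesis using lo pd by linarith
    qed
    from rs i obtain r s where "\<forall>j<k. q j \<le> r j \<and> r j \<le> q j + 1"
      "\<forall>j<k. q j \<le> s j \<and> s j \<le> q j + 1" "label r i \<noteq> label s i" by blast
    moreover have "label x i = 0 \<or> label x i = 1" for x by (simp add: label_def)
    ultimately show "\<bar>f (g q) i - g q i\<bar> \<le> d" using main[of r s] main[of s r] by metis
  qed
qed

lemma finite_partitions [simp]: "finite (partitions k m)"
  by (simp flip: set_partition_list)

lemma partitions_nonempty: "0 < k \<Longrightarrow> partitions k m \<noteq> {}"
proof -
  assume "0 < k"
  then have "m # replicate (k - 1) 0 \<in> partitions k m" by (simp add: partitions_def sum_list_replicate)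
  then show ?thesis by blast
qed

text \<open>McShane's extension of a Lipschitz function from the count vectors to real vectors.\<close>

definition extension :: "nat \<Rightarrow> nat \<Rightarrow> real \<Rightarrow> (nat list \<Rightarrow> real) \<Rightarrow> (nat \<Rightarrow> real) \<Rightarrow> real" where
  "extension k m l v y = Min ((\<lambda>x. v x + l * (\<Sum>c<k. \<bar>real (x ! c) - y c\<bar>)) ` partitions k m)"

lemma extension_le:
  "x \<in> partitions k m \<Longrightarrow> extension k m l v y \<le> v x + l * (\<Sum>c<k. \<bar>real (x ! c) - y c\<bar>)"
  unfolding extension_def by (rule Min_le) auto

lemma extension_attained:
  assumes "0 < k"
  obtains x where "x \<in> partitions k m" "extension k m l v y = v x + l * (\<Sum>c<k. \<bar>real (x ! c) - y c\<bar>)"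
proof -
  have "extension k m l v y \<in> (\<lambda>x. v x + l * (\<Sum>c<k. \<bar>real (x ! c) - y c\<bar>)) ` partitions k m"
    unfolding extension_def using partitions_nonempty[OF assms] by (intro Min_in) auto
  then show ?thesis using that by blast
qed

lemma dist_triangle_sum:
  fixes f g h :: "nat \<Rightarrow> real"
  shows "(\<Sum>c<k. \<bar>f c - h c\<bar>) \<le> (\<Sum>c<k. \<bar>f c - g c\<bar>) + (\<Sum>c<k. \<bar>g c - h c\<bar>)"
  unfolding sum.distrib[symmetric] by (rule sum_mono) linarith

lemma extension_lipschitz:
  assumes "0 < k" "0 \<le> l"
  shows "\<bar>extension k m l v y - extension k m l v z\<bar> \<le> l * (\<Sum>c<k. \<bar>y c - z c\<bar>)"
proof -
  have *: "extension k m l v y \<le> extension k m l v z + l * (\<Sum>c<k. \<bar>y c - z c\<bar>)" for y z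
  proof -
    obtain x where x: "x \<in> partitions k m"
      "extension k m l v z = v x + l * (\<Sum>c<k. \<bar>real (x ! c) - z c\<bar>)"
      using extension_attained[OF \<open>0 < k\<close>] .
    have "(\<Sum>c<k. \<bar>real (x ! c) - y c\<bar>) \<le> (\<Sum>c<k. \<bar>real (x ! c) - z c\<bar>) + (\<Sum>c<k. \<bar>y c - z c\<bar>)"
      using dist_triangle_sum[of "\<lambda>c. real (x ! c)" y k z] by (simp add: abs_minus_commute)
    from mult_left_mono[OF this \<open>0 \<le> l\<close>] show ?thesis
      using extension_le[OF x(1), of l v y] x(2) by (simp add: distrib_left)
  qed
  show ?thesis using *[of y z] *[of z y] by (simp add: abs_minus_commute abs_le_iff)
qed

text \<open>The triangle inequality through the minimiser \<open>x'\<close>. At a count vector the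
  extension therefore agrees with \<open>v\<close>; elsewhere this pays for passing from a real
  fixed point to a count vector near it.\<close>

lemma extension_near:
  assumes "0 < k" "0 \<le> l" "x \<in> partitions k m"
    and lip: "\<And>x x'. x \<in> partitions k m \<Longrightarrow> x' \<in> partitions k m \<Longrightarrow>
      \<bar>v x - v x'\<bar> \<le> l * (\<Sum>c<k. \<bar>real (x ! c) - real (x' ! c)\<bar>)"
  shows "\<bar>extension k m l v y - v x\<bar> \<le> l * (\<Sum>c<k. \<bar>real (x ! c) - y c\<bar>)"
proof -
  obtain x' where x': "x' \<in> partitions k m"
    "extension k m l v y = v x' + l * (\<Sum>c<k. \<bar>real (x' ! c) - y c\<bar>)"
    using extension_attained[OF \<open>0 < k\<close>] .
  have "(\<Sum>c<k. \<bar>real (x ! c) - real (x' ! c)\<bar>) \<le>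
      (\<Sum>c<k. \<bar>real (x ! c) - y c\<bar>) + (\<Sum>c<k. \<bar>real (x' ! c) - y c\<bar>)"
    using dist_triangle_sum[of "\<lambda>c. real (x ! c)" "\<lambda>c. real (x' ! c)" k y]
    by (simp add: abs_minus_commute)
  from mult_left_mono[OF this \<open>0 \<le> l\<close>] lip[OF assms(3) x'(1)]
  have "v x \<le> v x' + l * (\<Sum>c<k. \<bar>real (x ! c) - y c\<bar>) + l * (\<Sum>c<k. \<bar>real (x' ! c) - y c\<bar>)"
    by (simp add: distrib_left abs_le_iff)
  then show ?thesis using extension_le[OF assms(3), of l v y] x'(2) by (simp add: abs_le_iff)
qed

text \<open>A continuous selection of approximate best responses: a strategy is weighted by how much its
  payoff exceeds the maximal payoff minus \<open>l\<close>.\<close>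

definition weight :: "nat \<Rightarrow> real \<Rightarrow> (nat \<Rightarrow> real) \<Rightarrow> nat \<Rightarrow> real" where
  "weight k l V a = max 0 (V a - Max (V ` {..<k}) + l)"

definition response :: "nat \<Rightarrow> real \<Rightarrow> (nat \<Rightarrow> real) \<Rightarrow> nat \<Rightarrow> real" where
  "response k l V a = weight k l V a / (\<Sum>b<k. weight k l V b)"

lemma weight_nonneg: "0 \<le> weight k l V a"
  by (simp add: weight_def)

lemma weight_sum_ge:
  assumes "0 < k" "0 < l"
  shows "l \<le> (\<Sum>b<k. weight k l V b)"
proof -
  have "Max (V ` {..<k}) \<in> V ` {..<k}" using assms by (intro Max_in) auto
  then obtain a where a: "a < k" "V a = Max (V ` {..<k})" by auto
  have "weight k l V a \<le> (\<Sum>b<k. weight k l V b)"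
    using a by (intro member_le_sum) (auto simp: weight_nonneg)
  then show ?thesis using a \<open>0 < l\<close> by (simp add: weight_def)
qed

lemma Max_lipschitz:
  fixes V U :: "nat \<Rightarrow> real"
  assumes "0 < k" "\<And>a. a < k \<Longrightarrow> \<bar>V a - U a\<bar> \<le> t"
  shows "\<bar>Max (V ` {..<k}) - Max (U ` {..<k})\<bar> \<le> t"
proof -
  have *: "Max (V ` {..<k}) \<le> Max (U ` {..<k}) + t" if "\<And>a. a < k \<Longrightarrow> \<bar>V a - U a\<bar> \<le> t" for V U :: "nat \<Rightarrow> real"
  proof -
    have "V a \<le> Max (U ` {..<k}) + t" if "a < k" for a
    proof -
      have "U a \<le> Max (U ` {..<k})" using that by (intro Max_ge) auto
      then show ?thesis using \<open>\<And>a. a < k \<Longrightarrow> \<bar>V a - U a\<bar> \<le> t\<close>[OF that] by linarith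
    qed
    then show ?thesis using \<open>0 < k\<close> by (subst Max_le_iff) auto
  qed
  show ?thesis using *[of V U] *[of U V] assms(2) by (simp add: abs_minus_commute abs_le_iff)
qed

lemma response_props:
  assumes "0 < k" "0 < l" "a < k"
  shows "0 \<le> response k l V a" "response k l V a \<le> 1" "(\<Sum>b<k. response k l V b) = 1"
    "0 < response k l V a \<Longrightarrow> b < k \<Longrightarrow> V b - l \<le> V a"
proof -
  have W: "0 < (\<Sum>b<k. weight k l V b)" using weight_sum_ge[OF assms(1,2), of V] \<open>0 < l\<close> by linarith
  show n: "0 \<le> response k l V a" for a using W weight_nonneg by (simp add: response_def)
  show s: "(\<Sum>b<k. response k l V b) = 1" using W by (simp add: response_def flip: sum_divide_distrib)
  show "response k l V a \<le> 1"
    unfolding s[symmetric] using n \<open>a < k\<close> by (intro member_le_sum) auto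
  assume "0 < response k l V a" "b < k"
  then have "0 < weight k l V a" using W by (simp add: response_def zero_less_divide_iff)
  moreover have "V b \<le> Max (V ` {..<k})" using \<open>b < k\<close> by (intro Max_ge) auto
  ultimately show "V b - l \<le> V a" by (simp add: weight_def)
qed

text \<open>A payoff and the maximum both move by at most \<open>t\<close>, so a weight moves by
  \<open>2 * t\<close> and the sum of the weights by \<open>2 * k * t\<close>. The denominators are
  at least \<open>l\<close>, because a best strategy has weight exactly \<open>l\<close>.\<close>

lemma response_lipschitz:
  assumes "0 < k" "0 < l" "a < k" and t: "\<And>a. a < k \<Longrightarrow> \<bar>V a - U a\<bar> \<le> t"
  shows "\<bar>response k l V a - response k l U a\<bar> \<le> 2 * (real k + 1) / l * t"
proof -
  let ?w = "weight k l V" and ?u = "weight k l U"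
  let ?W = "\<Sum>b<k. ?w b" and ?U = "\<Sum>b<k. ?u b"
  have W: "l \<le> ?W" "l \<le> ?U" using weight_sum_ge[OF assms(1,2)] by auto
  have w: "\<bar>?w b - ?u b\<bar> \<le> 2 * t" if "b < k" for b
    using t[OF that] Max_lipschitz[of k V U t] \<open>0 < k\<close> t unfolding weight_def by fastforce
  have "\<bar>?W - ?U\<bar> \<le> (\<Sum>b<k. \<bar>?w b - ?u b\<bar>)" unfolding sum_subtractf[symmetric] by (rule sum_abs)
  also have "\<dots> \<le> (\<Sum>b<k. 2 * t)" using w by (intro sum_mono) auto
  finally have WU: "\<bar>?W - ?U\<bar> \<le> real k * (2 * t)" by simp
  have u1: "0 \<le> response k l U a" "response k l U a \<le> 1" using response_props[OF assms(1-3)] by auto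
  have "response k l V a - response k l U a = ((?w a - ?u a) + response k l U a * (?U - ?W)) / ?W"
    using W \<open>0 < l\<close> by (simp add: response_def field_simps)
  also have "\<bar>\<dots>\<bar> \<le> (2 * t + real k * (2 * t)) / ?W"
  proof -
    have "\<bar>response k l U a * (?U - ?W)\<bar> \<le> 1 * (real k * (2 * t))"
      unfolding abs_mult using u1 WU by (intro mult_mono) (auto simp: abs_minus_commute)
    then have "\<bar>(?w a - ?u a) + response k l U a * (?U - ?W)\<bar> \<le> 2 * t + real k * (2 * t)"
      using w[OF \<open>a < k\<close>] by linarith
    then show ?thesis using W \<open>0 < l\<close> by (simp add: abs_divide divide_right_mono)
  qed
  also have "\<dots> \<le> (2 * t + real k * (2 * t)) / l"
  proof -
    have "0 \<le> t" using t[OF \<open>a < k\<close>] by linarith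
    then show ?thesis using W \<open>0 < l\<close> by (intro divide_left_mono) auto
  qed
  finally show ?thesis by (simp add: algebra_simps)
qed

lemma sum_list_map_telescope:
  fixes F :: "nat \<Rightarrow> int"
  assumes "\<And>a. F a \<le> F (Suc a)"
  shows "int (sum_list (map (\<lambda>a. nat (F (Suc a) - F a)) [0..<k])) = F k - F 0"
  using assms by (induction k) auto

text \<open>There are \<open>m + 1\<close> players, but the counts that a payoff depends on add up
  to \<open>m\<close>. Capping the prefix sums at \<open>m\<close> takes at most 1 from an entry,
  taking differences of floors changes it by less than 1, and these differences telescope to exactly
  \<open>m\<close>.\<close>

lemma round_to_partition:
  fixes g :: "nat \<Rightarrow> real"
  assumes nonneg: "\<And>a. a < k \<Longrightarrow> 0 \<le> g a" and sum: "(\<Sum>a<k. g a) = real m + 1"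
  obtains x where "x \<in> partitions k m" "\<And>a. a < k \<Longrightarrow> \<bar>real (x ! a) - g a\<bar> \<le> 2"
proof -
  define s where "s a = (\<Sum>c<min a k. g c)" for a
  define F where "F a = min (s a) (real m)" for a
  define x where "x = map (\<lambda>a. nat (\<lfloor>F (Suc a)\<rfloor> - \<lfloor>F a\<rfloor>)) [0..<k]"
  have smono: "s a \<le> s b" if "a \<le> b" for a b
    unfolding s_def using nonneg that by (intro sum_mono2) auto
  have sm: "s a \<le> real m + 1" for a
    unfolding s_def sum[symmetric] using nonneg by (intro sum_mono2) auto
  have mono: "\<lfloor>F a\<rfloor> \<le> \<lfloor>F (Suc a)\<rfloor>" for a
    using smono[of a "Suc a"] unfolding F_def by (intro floor_mono) auto
  have "int (sum_list x) = \<lfloor>F k\<rfloor> - \<lfloor>F 0\<rfloor>" unfolding x_def by (rule sum_list_map_telescope) (rule mono)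
  also have "\<dots> = int m" by (simp add: F_def s_def sum)
  finally have "x \<in> partitions k m" by (simp add: partitions_def x_def)
  moreover have "\<bar>real (x ! a) - g a\<bar> \<le> 2" if "a < k" for a
  proof -
    have "s (Suc a) = s a + g a" using that by (simp add: s_def min_def)
    then have "F (Suc a) - F a \<le> g a" "g a - 1 \<le> F (Suc a) - F a"
      using sm[of "Suc a"] nonneg[OF that] by (auto simp: F_def min_def)
    moreover have "real (x ! a) = of_int \<lfloor>F (Suc a)\<rfloor> - of_int \<lfloor>F a\<rfloor>"
      using that mono[of a] by (simp add: x_def)
    ultimately show ?thesis by linarith
  qed
  ultimately show ?thesis using that by blast
qed

lemma fractional_equilibrium_exists:
  fixes v :: "nat \<Rightarrow> nat \<Rightarrow> nat list \<Rightarrow> real"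
  assumes "0 < k" "0 < l"
    and lip: "\<And>i a x y. i \<le> m \<Longrightarrow> a < k \<Longrightarrow> x \<in> partitions k m \<Longrightarrow> y \<in> partitions k m \<Longrightarrow>
      \<bar>v i a x - v i a y\<bar> \<le> l * (\<Sum>c<k. \<bar>real (x ! c) - real (y ! c)\<bar>)"
  obtains x \<sigma> where "x \<in> partitions k m"
    "\<And>i a. a < k \<Longrightarrow> 0 \<le> \<sigma> i a" "\<And>i. (\<Sum>a<k. \<sigma> i a) = (1::real)"
    "\<And>a. a < k \<Longrightarrow> \<bar>(\<Sum>i\<le>m. \<sigma> i a) - real (x ! a)\<bar> \<le> 2"
    "\<And>i a b. i \<le> m \<Longrightarrow> a < k \<Longrightarrow> b < k \<Longrightarrow> 0 < \<sigma> i a \<Longrightarrow> v i b x - 7 * real k * l \<le> v i a x"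
proof -
  let ?n = "real m + 1"
  define V where "V y i a = extension k m l (v i a) (\<lambda>c. ?n * y c)" for y i a
  define \<sigma> where "\<sigma> y i = response k l (V y i)" for y i
  define f where "f y a = (\<Sum>i\<le>m. \<sigma> y i a) / ?n" for y a
  have \<sigma>: "0 \<le> \<sigma> y i a" "\<sigma> y i a \<le> 1" "(\<Sum>b<k. \<sigma> y i b) = 1" if "a < k" for y i a
    using response_props[OF assms(1,2) that] by (auto simp: \<sigma>_def)
  obtain y where y: "\<And>i. i < k \<Longrightarrow> \<bar>f y i - y i\<bar> \<le> 1 / ?n"
  \<comment> \<open>The cube holds fractions of the \<open>?n\<close> players; an error of
    \<open>1 / ?n\<close> in a fraction is an error of 1 in a count. The Lipschitz constant is that
    of \<open>response\<close> times that of the rescaled extension, which moves by at most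
    \<open>l * ?n * k\<close> per unit of the maximum norm.\<close>
  proof (rule approx_fixed_point_cube[of k f "2 * (real k + 1) / l * (l * (?n * real k))" "1 / ?n"])
    fix y a assume a: "a < k"
    have "(\<Sum>i\<le>m. \<sigma> y i a) \<le> (\<Sum>i\<le>m. 1)" using \<sigma>[OF a] by (intro sum_mono) auto
    then show "0 \<le> f y a \<and> f y a \<le> 1"
      using \<sigma>[OF a] unfolding f_def by (auto intro!: divide_nonneg_pos sum_nonneg)
  next
    fix y z :: "nat \<Rightarrow> real" and h a assume h: "\<And>j. j < k \<Longrightarrow> \<bar>y j - z j\<bar> \<le> h" and a: "a < k"
    let ?t = "l * (?n * real k * h)"
    have "\<bar>V y i b - V z i b\<bar> \<le> ?t" for i b
    proof -
      have "\<bar>V y i b - V z i b\<bar> \<le> l * (\<Sum>c<k. \<bar>?n * y c - ?n * z c\<bar>)"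
        unfolding V_def using assms by (intro extension_lipschitz) auto
      also have "(\<Sum>c<k. \<bar>?n * y c - ?n * z c\<bar>) \<le> (\<Sum>c<k. ?n * h)"
      proof (rule sum_mono)
        fix c assume "c \<in> {..<k}"
        then have "?n * \<bar>y c - z c\<bar> \<le> ?n * h" using h by (intro mult_left_mono) auto
        then show "\<bar>?n * y c - ?n * z c\<bar> \<le> ?n * h" by (simp add: abs_mult flip: right_diff_distrib)
      qed
      finally show ?thesis using \<open>0 < l\<close> by (simp add: mult_left_mono algebra_simps)
    qed
    then have *: "\<bar>\<sigma> y i a - \<sigma> z i a\<bar> \<le> 2 * (real k + 1) / l * ?t" for i
      unfolding \<sigma>_def using assms(1,2) a by (intro response_lipschitz) auto
    have "\<bar>f y a - f z a\<bar> = \<bar>\<Sum>i\<le>m. \<sigma> y i a - \<sigma> z i a\<bar> / ?n"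
      by (simp add: f_def sum_subtractf abs_divide flip: diff_divide_distrib)
    also have "\<dots> \<le> (\<Sum>i\<le>m. 2 * (real k + 1) / l * ?t) / ?n"
      using * by (intro divide_right_mono order_trans[OF sum_abs sum_mono]) auto
    also have "\<dots> = 2 * (real k + 1) / l * ?t"
    proof -
      have "(\<Sum>i\<le>m. X) / ?n = X" for X :: real by (simp add: field_simps)
      then show ?thesis .
    qed
    finally show "\<bar>f y a - f z a\<bar> \<le> 2 * (real k + 1) / l * (l * (?n * real k)) * h"
      by (simp only: mult.assoc)
  qed auto
  have near: "\<bar>(\<Sum>i\<le>m. \<sigma> y i a) - ?n * y a\<bar> \<le> 1" if "a < k" for a
  proof -
    have "(\<Sum>i\<le>m. \<sigma> y i a) - ?n * y a = ?n * (f y a - y a)" by (simp add: f_def field_simps)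
    also have "\<bar>\<dots>\<bar> \<le> ?n * (1 / ?n)"
      unfolding abs_mult using y[OF that] by (intro mult_mono) auto
    finally show ?thesis by simp
  qed
  obtain x where x: "x \<in> partitions k m" "\<And>a. a < k \<Longrightarrow> \<bar>real (x ! a) - (\<Sum>i\<le>m. \<sigma> y i a)\<bar> \<le> 2"
  proof (rule round_to_partition[of k "\<lambda>a. \<Sum>i\<le>m. \<sigma> y i a" m])
    show "0 \<le> (\<Sum>i\<le>m. \<sigma> y i a)" if "a < k" for a using \<sigma>(1)[OF that] by (auto intro: sum_nonneg)
    show "(\<Sum>a<k. \<Sum>i\<le>m. \<sigma> y i a) = real m + 1"
      using \<sigma>(3)[OF \<open>0 < k\<close>] by (subst sum.swap) simp
  qed blast
  \<comment> \<open>Each count is off by 1 from the approximate fixed point and by 2 from the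
    rounding. Two such payoff comparisons and the slack \<open>l\<close> of the response make the
    final \<open>7 = 3 + 3 + 1\<close>.\<close>
  have close: "\<bar>V y i a - v i a x\<bar> \<le> 3 * real k * l" if "i \<le> m" "a < k" for i a
  proof -
    have "\<bar>V y i a - v i a x\<bar> \<le> l * (\<Sum>c<k. \<bar>real (x ! c) - ?n * y c\<bar>)"
      unfolding V_def using assms that x by (intro extension_near) auto
    also have "(\<Sum>c<k. \<bar>real (x ! c) - ?n * y c\<bar>) \<le> (\<Sum>c<k. 3)"
    proof (rule sum_mono)
      fix c assume "c \<in> {..<k}"
      then show "\<bar>real (x ! c) - ?n * y c\<bar> \<le> 3" using near[of c] x(2)[of c] by simp
    qed
    finally show ?thesis using \<open>0 < l\<close> by (simp add: mult_left_mono algebra_simps)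
  qed
  show ?thesis
  proof (rule that[of x "\<sigma> y"])
    fix i a b assume *: "i \<le> m" "a < k" "b < k" "0 < \<sigma> y i a"
    have "V y i b - l \<le> V y i a"
      using response_props(4)[OF assms(1,2) \<open>a < k\<close> _ \<open>b < k\<close>] * by (simp add: \<sigma>_def)
    moreover have "l \<le> real k * l" using assms(1,2) by simp
    ultimately show "v i b x - 7 * real k * l \<le> v i a x"
      using close[OF *(1,2)] close[OF *(1,3)] by linarith
  qed (use x \<sigma> \<open>0 < k\<close> in \<open>auto simp: abs_minus_commute\<close>)
qed

section \<open>Smoothing by trembles\<close>

text \<open>The probability of \<open>j\<close> successes in \<open>m\<close> trials, given by
  conditioning on one trial instead of the closed form: \<open>mean_mix\<close> and
  \<open>mean_diff_aux\<close> follow this recursion, and the program fills its table with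
  it.\<close>

primrec bin :: "real \<Rightarrow> nat \<Rightarrow> nat \<Rightarrow> real" where
  "bin t 0 j = (if j = 0 then 1 else 0)"
| "bin t (Suc m) j = (1 - t) * bin t m j + (if j = 0 then 0 else t * bin t m (j - 1))"

lemma bin_0: "m < j \<Longrightarrow> bin t m j = 0"
  by (induction m arbitrary: j) auto

lemma bin_nonneg: "0 \<le> t \<Longrightarrow> t \<le> 1 \<Longrightarrow> 0 \<le> bin t m j"
  by (induction m arbitrary: j) auto

lemma bin_eq: "bin t m j = real (m choose j) * t ^ j * (1 - t) ^ (m - j)"
proof (induction m arbitrary: j)
  case (Suc m)
  show ?case
  proof (cases j)
    case 0
    then show ?thesis by (simp add: Suc)
  next
    case (Suc i)
    consider "i < m" | "i = m" | "m < i" by linarith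
    then show ?thesis
    proof cases
      case 1
      then have "m - i = Suc (m - Suc i)" by simp
      then show ?thesis using Suc.IH Suc by (simp add: algebra_simps)
    qed (use Suc.IH Suc in \<open>auto simp: binomial_eq_0\<close>)
  qed
qed (simp add: binomial_eq_0)

lemma sum_bin_Suc:
  fixes \<phi> :: "nat \<Rightarrow> real"
  shows "(\<Sum>j\<le>Suc m. bin t (Suc m) j * \<phi> j) =
    (1 - t) * (\<Sum>j\<le>m. bin t m j * \<phi> j) + t * (\<Sum>j\<le>m. bin t m j * \<phi> (Suc j))"
proof -
  have "(\<Sum>j\<le>Suc m. bin t (Suc m) j * \<phi> j) = (\<Sum>j\<le>Suc m. (1 - t) * (bin t m j * \<phi> j)) +
      (\<Sum>j\<le>Suc m. if j = 0 then 0 else t * (bin t m (j - 1) * \<phi> j))"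
    unfolding sum.distrib[symmetric] by (rule sum.cong) (auto simp: algebra_simps)
  also have "(\<Sum>j\<le>Suc m. if j = 0 then 0 else t * (bin t m (j - 1) * \<phi> j)) =
      (\<Sum>j\<le>m. t * (bin t m j * \<phi> (Suc j)))"
    by (subst sum.atMost_Suc_shift) simp
  also have "(\<Sum>j\<le>Suc m. (1 - t) * (bin t m j * \<phi> j)) = (\<Sum>j\<le>m. (1 - t) * (bin t m j * \<phi> j))"
    by (simp add: bin_0)
  finally show ?thesis by (simp add: sum_distrib_left)
qed

lemma sum_bin: "(\<Sum>j\<le>m. bin t m j) = 1"
proof (induction m)
  case (Suc m)
  then show ?case using sum_bin_Suc[of t m "\<lambda>_. 1"] by simp
qed simp

text \<open>\<open>2 * j - m\<close> is the position of a simple random walk after \<open>m\<close>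
  fair steps. Averaging (d - 1)^2 and (d + 1)^2 gives d^2 + 1, so every step adds 1 to the second
  moment.\<close>

lemma fair_bin_variance: "(\<Sum>j\<le>m. bin (1/2) m j * (2 * real j - real m)\<^sup>2) = real m"
proof (induction m)
  case (Suc m)
  have "(\<Sum>j\<le>Suc m. bin (1/2) (Suc m) j * (2 * real j - real (Suc m))\<^sup>2) =
      (\<Sum>j\<le>m. bin (1/2) m j * (((2 * real j - real (Suc m))\<^sup>2 + (2 * real (Suc j) - real (Suc m))\<^sup>2) / 2))"
    unfolding sum_bin_Suc sum_distrib_left sum.distrib[symmetric]
    by (rule sum.cong) (auto simp: algebra_simps add_divide_distrib)
  also have "\<dots> = (\<Sum>j\<le>m. bin (1/2) m j * (2 * real j - real m)\<^sup>2 + bin (1/2) m j)"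
  proof (rule sum.cong)
    fix j
    have "((2 * real j - real (Suc m))\<^sup>2 + (2 * real (Suc j) - real (Suc m))\<^sup>2) / 2 = (2 * real j - real m)\<^sup>2 + 1"
      by (simp add: power2_eq_square field_simps)
    then show "bin (1/2) m j * (((2 * real j - real (Suc m))\<^sup>2 + (2 * real (Suc j) - real (Suc m))\<^sup>2) / 2) =
        bin (1/2) m j * (2 * real j - real m)\<^sup>2 + bin (1/2) m j"
      by (simp only: distrib_left mult_1_right)
  qed simp
  finally show ?case by (simp add: sum.distrib Suc sum_bin)
qed simp

text \<open>The mean of 1 / (1 + X) for a binomial X. Absorption turns each term into a probability
  for \<open>m + 1\<close> trials, shifted by one, and these add up to at most 1. It serves to
  average a bound for a fixed number of coins over their random number.\<close>

lemma sum_bin_inverse_le: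
  assumes "0 < p" "p \<le> 1"
  shows "(\<Sum>j\<le>m. bin p m j / (real j + 1)) \<le> 1 / ((real m + 1) * p)"
proof -
  have "bin p m j / (real j + 1) = bin p (Suc m) (Suc j) / ((real m + 1) * p)" if "j \<le> m" for j
  proof -
    have "real (Suc m) * real (m choose j) = real (Suc m choose Suc j) * real (Suc j)"
      using Suc_times_binomial_eq[of m j] by (metis of_nat_mult)
    then have "real (m choose j) / (real j + 1) = real (Suc m choose Suc j) / (real m + 1)"
      by (simp add: field_simps)
    moreover have "bin p m j / (real j + 1) = real (m choose j) / (real j + 1) * p ^ j * (1 - p) ^ (m - j)"
      by (simp add: bin_eq)
    ultimately have "bin p m j / (real j + 1) =
        real (Suc m choose Suc j) / (real m + 1) * p ^ j * (1 - p) ^ (m - j)" by simp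
    also have "\<dots> = bin p (Suc m) (Suc j) / ((real m + 1) * p)"
      using \<open>0 < p\<close> by (simp add: bin_eq[of p "Suc m"] del: binomial_Suc_Suc bin.simps)
    finally show ?thesis .
  qed
  then have "(\<Sum>j\<le>m. bin p m j / (real j + 1)) = (\<Sum>j\<le>m. bin p (Suc m) (Suc j)) / ((real m + 1) * p)"
    by (simp add: sum_divide_distrib del: bin.simps)
  also have "(\<Sum>j\<le>m. bin p (Suc m) (Suc j)) \<le> (\<Sum>j\<le>Suc m. bin p (Suc m) j)"
    using assms bin_nonneg[of p "Suc m" 0] sum.atMost_Suc_shift[of "bin p (Suc m)" m] by linarith
  finally show ?thesis using assms sum_bin[of p "Suc m"] by (simp add: divide_right_mono)
qed

section \<open>Expected values under independent players\<close>

definition bump :: "nat \<Rightarrow> (nat \<Rightarrow> nat) \<Rightarrow> nat \<Rightarrow> nat" where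
  "bump c y = y(c := Suc (y c))"

lemma bump_commute: "bump c (bump d y) = bump d (bump c y)"
  by (auto simp: bump_def fun_eq_iff)

text \<open>\<open>mean k ds f y\<close> is the expectation of \<open>f\<close> at \<open>y\<close> plus the counts of independent players with
  the distributions \<open>ds\<close>.\<close>

primrec mean :: "nat \<Rightarrow> (nat \<Rightarrow> real) list \<Rightarrow> ((nat \<Rightarrow> nat) \<Rightarrow> real) \<Rightarrow> (nat \<Rightarrow> nat) \<Rightarrow> real" where
  "mean k [] f = f"
| "mean k (d # ds) f = (\<lambda>y. \<Sum>c<k. d c * mean k ds f (bump c y))"

lemma mean_move_front: "mean k (ds @ d # es) f y = mean k (d # ds @ es) f y"
proof (induction ds arbitrary: y)
  case (Cons e ds)
  have "mean k ((e # ds) @ d # es) f y = (\<Sum>b<k. e b * (\<Sum>c<k. d c * mean k (ds @ es) f (bump c (bump b y))))"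
    using Cons by simp
  also have "\<dots> = (\<Sum>c<k. \<Sum>b<k. d c * (e b * mean k (ds @ es) f (bump b (bump c y))))"
    by (subst sum.swap) (simp add: sum_distrib_left mult_ac bump_commute)
  finally show ?case by (simp add: sum_distrib_left)
qed simp

lemma mean_cong_mset: "mset ds = mset es \<Longrightarrow> mean k ds f y = mean k es f y"
proof (induction ds arbitrary: es y)
  case (Cons d ds)
  then obtain es1 es2 where es: "es = es1 @ d # es2"
    by (metis list.set_intros(1) mset_eq_setD split_list)
  have "mean k ds f y = mean k (es1 @ es2) f y" for y using Cons es by (intro Cons.IH) simp
  then show ?case unfolding es mean_move_front by simp
qed simp

text \<open>Conditioning on how many of the \<open>m\<close> players follow \<open>e\<close>. It is
  used twice: to expand coins into point masses, and to turn an elementary tremble of the kernel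
  into a sum over moves.\<close>

lemma mean_mix:
  assumes "d' = (\<lambda>c. (1 - t) * d c + t * e c)"
  shows "mean k (replicate m d' @ ds) f y =
    (\<Sum>j\<le>m. bin t m j * mean k (replicate (m - j) d @ replicate j e @ ds) f y)"
proof (induction m arbitrary: y)
  case (Suc m)
  let ?G = "\<lambda>j. mean k (replicate (m - j) d @ replicate j e @ ds) f"
  have "mean k (replicate (Suc m) d' @ ds) f y = (\<Sum>c<k. d' c * (\<Sum>j\<le>m. bin t m j * ?G j (bump c y)))"
    using Suc by simp
  also have "\<dots> = (\<Sum>j\<le>m. bin t m j * (\<Sum>c<k. d' c * ?G j (bump c y)))"
    unfolding sum_distrib_left by (subst sum.swap) (simp add: mult_ac)
  also have "\<dots> = (\<Sum>j\<le>m. (1 - t) * (bin t m j * (\<Sum>c<k. d c * ?G j (bump c y))) +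
      t * (bin t m j * (\<Sum>c<k. e c * ?G j (bump c y))))"
    by (rule sum.cong)
      (auto simp: assms distrib_right distrib_left sum.distrib sum_distrib_left mult_ac)
  also have "\<dots> = (1 - t) * (\<Sum>j\<le>m. bin t m j * mean k (replicate (Suc m - j) d @ replicate j e @ ds) f y) +
      t * (\<Sum>j\<le>m. bin t m j * mean k (replicate (Suc m - Suc j) d @ replicate (Suc j) e @ ds) f y)"
  proof -
    have "(\<Sum>c<k. d c * ?G j (bump c y)) = mean k (replicate (Suc m - j) d @ replicate j e @ ds) f y"
      if "j \<le> m" for j
      using that by (simp add: Suc_diff_le)
    moreover have "(\<Sum>c<k. e c * ?G j (bump c y)) =
        mean k (replicate (Suc m - Suc j) d @ replicate (Suc j) e @ ds) f y" for j
      using mean_move_front[of k "replicate (m - j) d" e "replicate j e @ ds" f y] by simp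
    ultimately show ?thesis by (simp add: sum.distrib sum_distrib_left)
  qed
  finally show ?case unfolding sum_bin_Suc .
qed simp

section \<open>Effect of moving one opponent on an expected payoff\<close>

definition point :: "nat \<Rightarrow> nat \<Rightarrow> real" where
  "point b c = (if c = b then 1 else 0)"

lemma sum_point: "b < k \<Longrightarrow> (\<Sum>c<k. point b c * G c) = (G b :: real)"
proof -
  assume "b < k"
  have "(\<Sum>c<k. point b c * G c) = (\<Sum>c<k. if c = b then G c else 0)"
    by (rule sum.cong) (auto simp: point_def)
  then show ?thesis using \<open>b < k\<close> by simp
qed

lemma mean_point:
  assumes "b < k"
  shows "mean k (replicate m (point b) @ ds) f y = mean k ds f (y(b := y b + m))"
proof (induction m arbitrary: y)
  case (Suc m)
  have "mean k (replicate (Suc m) (point b) @ ds) f y = mean k (replicate m (point b) @ ds) f (bump b y)"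
    using \<open>b < k\<close> by (simp add: sum_point)
  moreover have "(bump b y)(b := bump b y b + m) = y(b := y b + Suc m)"
    by (auto simp: bump_def fun_eq_iff)
  ultimately show ?case by (simp only: Suc)
qed simp

text \<open>The factor \<open>1 - 1/2\<close> is left unreduced so that the definition itself is an
  instance of the mixture hypothesis of \<open>mean_mix\<close>, with \<open>b\<close> as the
  success.\<close>

definition coin :: "nat \<Rightarrow> nat \<Rightarrow> nat \<Rightarrow> real" where
  "coin b c = (\<lambda>a. (1 - 1/2) * point c a + 1/2 * point b a)"

text \<open>Expanding (|x| - 2 s)^2 >= 0. It bounds an absolute first moment by a second moment
  without a square root; the free parameter \<open>s\<close> is finally set to the tremble
  probability.\<close>

lemma young: "0 < s \<Longrightarrow> \<bar>x\<bar> \<le> s + x\<^sup>2 / (4 * s)" for x s :: real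
proof -
  assume "0 < s"
  have "0 \<le> (\<bar>x\<bar> - 2 * s)\<^sup>2" by simp
  then have "4 * s * \<bar>x\<bar> \<le> 4 * s * s + x\<^sup>2" by (simp add: power2_eq_square algebra_simps)
  then show ?thesis using \<open>0 < s\<close> by (simp add: field_simps)
qed

text \<open>Discrete integration by parts turns the shift by one coin into the score of the binomial
  distribution, whose second moment is known.\<close>

lemma mean_coins_diff:
  assumes "b < k" "c < k" "b \<noteq> c" and f: "\<And>y. \<bar>f y\<bar> \<le> 1" and "0 < s"
  shows "\<bar>mean k (replicate m (coin b c)) f (bump b y) - mean k (replicate m (coin b c)) f (bump c y)\<bar>
    \<le> s + 1 / (s * (real m + 1))"
proof -
  define L where "L = real (Suc m)"
  have L: "0 < L" "real m + 1 = L" by (simp_all add: L_def)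
  \<comment> \<open>With the extra player included, \<open>m + 1\<close> players are divided between
    \<open>b\<close> and \<open>c\<close>, and \<open>g i\<close> is the value when \<open>i\<close>
    of them are at \<open>b\<close>. An extra player at \<open>b\<close> gives
    \<open>i = j + 1\<close>, one at \<open>c\<close> gives \<open>i = j\<close>.\<close>
  define g where "g i = f (y(c := y c + (Suc m - i), b := y b + i))" for i
  define P where "P i = bin (1/2) (Suc m) i" for i
  have expand: "mean k (replicate m (coin b c)) f z =
      (\<Sum>j\<le>m. bin (1/2) m j * f (z(c := z c + (m - j), b := z b + j)))" for z
  proof -
    have "mean k (replicate (m - j) (point c) @ replicate j (point b)) f z =
        f (z(c := z c + (m - j), b := z b + j))" for j
      using mean_point[of c k "m - j" "replicate j (point b)" f z]
        mean_point[of b k j "[]" f "z(c := z c + (m - j))"] assms by simp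
    then show ?thesis using mean_mix[OF coin_def, of k m b c "[]" f z] by simp
  qed
  have gb: "f ((bump b y)(c := bump b y c + (m - j), b := bump b y b + j)) = g (Suc j)" for j
    using \<open>b \<noteq> c\<close> unfolding g_def by (intro arg_cong[of _ _ f]) (auto simp: bump_def fun_eq_iff)
  have gc: "f ((bump c y)(c := bump c y c + (m - j), b := bump c y b + j)) = g j" if "j \<le> m" for j
    using \<open>b \<noteq> c\<close> that unfolding g_def by (intro arg_cong[of _ _ f]) (auto simp: bump_def fun_eq_iff)
  have bin_half: "bin (1/2) m j = real (m choose j) / 2 ^ m" if "j \<le> m" for m j
    using that by (simp add: bin_eq power_divide flip: power_add)
  \<comment> \<open>Both expectations are rewritten over the law \<open>P\<close> of
    \<open>L\<close> fair coins, with densities \<open>2 * i / L\<close> and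
    \<open>2 * (L - i) / L\<close>. Their difference is the score \<open>\<tau>\<close>, whose
    second moment is \<open>4 / L\<close>.\<close>
  have up: "bin (1/2) m j = 2 * real (Suc j) / L * P (Suc j)" if "j \<le> m" for j
  proof -
    have "real (Suc m) * real (m choose j) = real (Suc m choose Suc j) * real (Suc j)"
      using Suc_times_binomial_eq[of m j] by (metis of_nat_mult)
    then have "real (m choose j) = real (Suc m choose Suc j) * real (Suc j) / L"
      using L(1) by (simp add: L_def field_simps del: binomial_Suc_Suc of_nat_Suc)
    then show ?thesis using that unfolding P_def
      by (simp add: bin_half del: binomial_Suc_Suc bin.simps of_nat_Suc)
  qed
  have down: "bin (1/2) m j = 2 * (L - real j) / L * P j" if "j \<le> m" for j
  proof -
    have "real (Suc m) * real (m choose j) = real (Suc m choose j) * (L - real j)"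
      unfolding L_def using binomial_absorb_comp[of "Suc m" j] that
      by (metis (no_types, lifting) diff_Suc_1 le_SucI mult.commute of_nat_diff of_nat_mult)
    then have "real (m choose j) = real (Suc m choose j) * (L - real j) / L"
      using L(1) by (simp add: L_def field_simps del: binomial_Suc_Suc of_nat_Suc)
    then show ?thesis using that unfolding P_def
      by (simp add: bin_half del: binomial_Suc_Suc bin.simps of_nat_Suc right_diff_distrib_numeral)
  qed
  have "mean k (replicate m (coin b c)) f (bump b y) = (\<Sum>j\<le>m. 2 * real (Suc j) / L * P (Suc j) * g (Suc j))"
    unfolding expand gb by (rule sum.cong) (auto simp: up)
  also have "\<dots> = (\<Sum>i\<le>Suc m. 2 * real i / L * P i * g i)"
    by (subst sum.atMost_Suc_shift[of _ m]) simp
  finally have B: "mean k (replicate m (coin b c)) f (bump b y) = (\<Sum>i\<le>Suc m. 2 * real i / L * P i * g i)" .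
  have "mean k (replicate m (coin b c)) f (bump c y) = (\<Sum>j\<le>m. 2 * (L - real j) / L * P j * g j)"
    unfolding expand by (rule sum.cong[OF refl]) (simp only: down gc atMost_iff)
  also have "\<dots> = (\<Sum>i\<le>Suc m. 2 * (L - real i) / L * P i * g i)" by (simp add: L_def)
  finally have C: "mean k (replicate m (coin b c)) f (bump c y) = (\<Sum>i\<le>Suc m. 2 * (L - real i) / L * P i * g i)" .
  define \<tau> where "\<tau> i = 2 * (2 * real i - L) / L" for i
  have "mean k (replicate m (coin b c)) f (bump b y) - mean k (replicate m (coin b c)) f (bump c y) =
      (\<Sum>i\<le>Suc m. \<tau> i * P i * g i)"
    unfolding B C sum_subtractf[symmetric] \<tau>_def by (rule sum.cong) (use L in \<open>auto simp: field_simps\<close>)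
  also have "\<bar>\<dots>\<bar> \<le> (\<Sum>i\<le>Suc m. P i * \<bar>\<tau> i\<bar>)"
  proof (rule order_trans[OF sum_abs sum_mono])
    fix i
    have "0 \<le> P i" unfolding P_def by (rule bin_nonneg) auto
    then show "\<bar>\<tau> i * P i * g i\<bar> \<le> P i * \<bar>\<tau> i\<bar>"
      using mult_left_mono[OF f, of "P i * \<bar>\<tau> i\<bar>"] by (simp add: g_def abs_mult mult_ac)
  qed
  also have "\<dots> \<le> (\<Sum>i\<le>Suc m. P i * s + 1 / (s * L\<^sup>2) * (P i * (2 * real i - L)\<^sup>2))"
  proof (rule sum_mono)
    fix i
    have "0 \<le> P i" unfolding P_def by (rule bin_nonneg) auto
    then have "P i * \<bar>\<tau> i\<bar> \<le> P i * (s + (\<tau> i)\<^sup>2 / (4 * s))"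
      using young[OF \<open>0 < s\<close>, of "\<tau> i"] by (rule mult_left_mono[rotated])
    also have "\<dots> = P i * s + 1 / (s * L\<^sup>2) * (P i * (2 * real i - L)\<^sup>2)"
    proof -
      have "(\<tau> i)\<^sup>2 = 4 * (2 * real i - L)\<^sup>2 / L\<^sup>2"
        unfolding \<tau>_def power_divide power_mult_distrib by simp
      then show ?thesis by (simp add: distrib_left mult_ac)
    qed
    finally show "P i * \<bar>\<tau> i\<bar> \<le> P i * s + 1 / (s * L\<^sup>2) * (P i * (2 * real i - L)\<^sup>2)" .
  qed
  also have "\<dots> = s + 1 / (s * L\<^sup>2) * L"
    unfolding sum.distrib sum_distrib_left[symmetric] sum_distrib_right[symmetric] P_def
    by (simp only: sum_bin fair_bin_variance mult_1 L_def)
  also have "\<dots> = s + 1 / (s * (real m + 1))" using L by (simp add: power2_eq_square)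
  finally show ?thesis .
qed

definition stoch :: "nat \<Rightarrow> (nat \<Rightarrow> real) \<Rightarrow> bool" where
  "stoch k d \<longleftrightarrow> (\<forall>c<k. 0 \<le> d c) \<and> (\<Sum>c<k. d c) = 1"

text \<open>A distribution giving mass at least \<open>q\<close> to both \<open>b\<close> and \<open>c\<close> is a mixture in which a fair
  coin between \<open>b\<close> and \<open>c\<close> has weight \<open>2 q\<close>.\<close>

lemma mean_diff_aux:
  assumes bc: "b < k" "c < k" "b \<noteq> c" and f: "\<And>y. \<bar>f y\<bar> \<le> 1" and "0 < s" "0 \<le> q"
    and ds: "\<forall>d\<in>set ds. stoch k d \<and> q \<le> d b \<and> q \<le> d c"
  shows "\<bar>mean k (replicate m (coin b c) @ ds) f (bump b y) - mean k (replicate m (coin b c) @ ds) f (bump c y)\<bar>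
    \<le> (\<Sum>j\<le>length ds. bin (2 * q) (length ds) j * (s + 1 / (s * (real (m + j) + 1))))"
  using ds
proof (induction ds arbitrary: m y)
  case Nil
  then show ?case using mean_coins_diff[OF bc f \<open>0 < s\<close>, where m = m and y = y] by simp
next
  case (Cons d ds)
  let ?R = "\<lambda>m. replicate m (coin b c) @ ds"
  let ?\<Phi> = "\<lambda>m. \<Sum>j\<le>length ds. bin (2 * q) (length ds) j * (s + 1 / (s * (real (m + j) + 1)))"
  \<comment> \<open>The part of \<open>d\<close> left after removing the coin with weight
    \<open>2 * q\<close>. It is nonnegative because the coin has mass 1/2 at \<open>b\<close> and at
    \<open>c\<close>, and it keeps its mass \<open>1 - 2 * q\<close> without being normalised.
    Peeling off \<open>d\<close> either adds a coin or shifts \<open>y\<close>, which is why the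
    induction varies \<open>m\<close> and \<open>y\<close>.\<close>
  define d0 where "d0 a = d a - 2 * q * coin b c a" for a
  have IH: "\<bar>mean k (?R m) f (bump b y) - mean k (?R m) f (bump c y)\<bar> \<le> ?\<Phi> m" for m y
    using Cons by simp
  have d: "stoch k d" "q \<le> d b" "q \<le> d c" using Cons.prems by auto
  have d0: "0 \<le> d0 a" if "a < k" for a
    using d that bc by (auto simp: d0_def coin_def point_def stoch_def)
  have "(\<Sum>a<k. coin b c a) = 1"
    using bc by (simp add: coin_def point_def sum.distrib flip: sum_divide_distrib)
  then have sum_d0: "(\<Sum>a<k. d0 a) = 1 - 2 * q"
    using d(1) by (simp add: d0_def sum_subtractf stoch_def flip: sum_distrib_left)
  have split: "mean k (replicate m (coin b c) @ d # ds) f y =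
      2 * q * mean k (?R (Suc m)) f y + (\<Sum>a<k. d0 a * mean k (?R m) f (bump a y))" for y
    unfolding mean_move_front by (simp add: d0_def left_diff_distrib sum_subtractf sum_distrib_left mult_ac)
  have "\<bar>mean k (replicate m (coin b c) @ d # ds) f (bump b y) - mean k (replicate m (coin b c) @ d # ds) f (bump c y)\<bar> =
      \<bar>2 * q * (mean k (?R (Suc m)) f (bump b y) - mean k (?R (Suc m)) f (bump c y)) +
       (\<Sum>a<k. d0 a * (mean k (?R m) f (bump b (bump a y)) - mean k (?R m) f (bump c (bump a y))))\<bar>"
    unfolding split by (simp add: right_diff_distrib sum_subtractf bump_commute)
  also have "\<dots> \<le> 2 * q * ?\<Phi> (Suc m) + (\<Sum>a<k. d0 a * ?\<Phi> m)"
  proof (rule order_trans[OF abs_triangle_ineq add_mono])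
    show "\<bar>2 * q * (mean k (?R (Suc m)) f (bump b y) - mean k (?R (Suc m)) f (bump c y))\<bar> \<le> 2 * q * ?\<Phi> (Suc m)"
      using IH[of "Suc m" y] \<open>0 \<le> q\<close> unfolding abs_mult by (intro mult_mono) auto
    show "\<bar>\<Sum>a<k. d0 a * (mean k (?R m) f (bump b (bump a y)) - mean k (?R m) f (bump c (bump a y)))\<bar> \<le> (\<Sum>a<k. d0 a * ?\<Phi> m)"
      using IH[of m] d0 by (intro order_trans[OF sum_abs sum_mono]) (auto simp: abs_mult intro!: mult_left_mono)
  qed
  also have "\<dots> = 2 * q * ?\<Phi> (Suc m) + (1 - 2 * q) * ?\<Phi> m"
    unfolding sum_distrib_right[symmetric] sum_d0 ..
  finally show ?case unfolding list.size add_0_right add_Suc_right sum_bin_Suc by simp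
qed

text \<open>Each player acts as a fair coin between \<open>b\<close> and \<open>c\<close> with
  probability \<open>2 * q\<close>; the bound for a fixed number of coins is averaged over this
  binomial number by \<open>sum_bin_inverse_le\<close>.\<close>

lemma mean_diff:
  assumes bc: "b < k" "c < k" and f: "\<And>y. \<bar>f y\<bar> \<le> 1" and "0 < s" "0 < q"
    and ds: "\<And>d. d \<in> set ds \<Longrightarrow> stoch k d \<and> (\<forall>c<k. q \<le> d c)" and q: "2 * q \<le> 1"
  shows "\<bar>mean k ds f (bump b y) - mean k ds f (bump c y)\<bar> \<le> s + 1 / (s * ((real (length ds) + 1) * (2 * q)))"
proof (cases "b = c")
  case True
  then show ?thesis using \<open>0 < s\<close> \<open>0 < q\<close> by simp
next
  case False
  let ?m = "length ds"
  have "\<bar>mean k ds f (bump b y) - mean k ds f (bump c y)\<bar> \<le>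
      (\<Sum>j\<le>?m. bin (2 * q) ?m j * (s + 1 / (s * (real (0 + j) + 1))))"
    using mean_diff_aux[OF bc False f \<open>0 < s\<close>, where q = q and ds = ds and m = 0 and y = y] ds \<open>0 < q\<close> bc by simp
  also have "\<dots> = s + 1 / s * (\<Sum>j\<le>?m. bin (2 * q) ?m j / (real j + 1))"
  proof -
    have "bin (2 * q) ?m j * (s + 1 / (s * (real (0 + j) + 1))) =
        bin (2 * q) ?m j * s + 1 / s * (bin (2 * q) ?m j / (real j + 1))" for j
      by (simp add: distrib_left)
    then show ?thesis by (simp only: sum.distrib sum_bin sum_distrib_left[symmetric] sum_distrib_right[symmetric] mult_1)
  qed
  also have "\<dots> \<le> s + 1 / s * (1 / ((real ?m + 1) * (2 * q)))"
    using sum_bin_inverse_le[of "2 * q" ?m] \<open>0 < s\<close> \<open>0 < q\<close> q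
    by (intro add_left_mono mult_left_mono) auto
  finally show ?thesis by simp
qed

section \<open>Count vectors and elementary trembles\<close>

definition move :: "nat \<Rightarrow> nat \<Rightarrow> nat \<Rightarrow> nat list \<Rightarrow> nat list" where
  "move a b j x = (let y = x[a := x ! a - j] in y[b := y ! b + j])"

lemma length_move [simp]: "length (move a b j x) = length x"
  by (simp add: move_def Let_def)

text \<open>For \<open>a = b\<close> the addition reads the entry that has already been decreased,
  so that \<open>move a a j\<close> is the identity when \<open>j \<le> x ! a\<close>. The sweeps
  below include this case and need no exception for it.\<close>

lemma nth_move:
  assumes "a < length x" "b < length x"
  shows "move a b j x ! c =
    (if c = b then (if a = b then x ! a - j + j else x ! b + j) else if c = a then x ! a - j else x ! c)"
  using assms by (cases "c = b"; cases "a = b"; cases "c = a") (simp_all add: move_def Let_def)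

lemma sum_list_nth: "length x = k \<Longrightarrow> sum_list x = (\<Sum>c<k. x ! c)"
  by (simp add: sum_list_sum_nth atLeast0LessThan)

lemma move_in_partitions:
  assumes "x \<in> partitions k m" "a < k" "b < k" "j \<le> x ! a"
  shows "move a b j x \<in> partitions k m"
proof -
  have len: "length x = k" using assms(1) by (simp add: partitions_def)
  define y where "y = x[a := x ! a - j]"
  have "sum_list y + j = sum_list x"
    using assms(2,4) len member_le_sum_list[of "x ! a" x] nth_mem[of a x]
    by (simp add: y_def sum_list_update)
  moreover have "sum_list (y[b := y ! b + j]) = sum_list y + j"
    using assms(3) len by (simp add: y_def sum_list_update member_le_sum_list)
  ultimately show ?thesis using assms(1) by (simp add: partitions_def move_def y_def Let_def)
qed

text \<open>A pure profile with the counts \<open>x\<close>. The order chosen is immaterial, since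
  \<open>mean\<close> depends only on the multiset of distributions.\<close>

definition spread :: "nat list \<Rightarrow> nat list" where
  "spread x = concat (map (\<lambda>a. replicate (x ! a) a) [0..<length x])"

lemma count_spread: "count (mset (spread x)) c = (if c < length x then x ! c else 0)"
proof -
  have "count (mset (concat (map (\<lambda>a. replicate (f a) a) [0..<n]))) c = (if c < n then f c else 0)"
    for f :: "nat \<Rightarrow> nat" and n
    by (induction n) auto
  then show ?thesis by (simp add: spread_def)
qed

lemma set_spread: "set (spread x) \<subseteq> {..<length x}"
  by (auto simp: spread_def)

lemma length_spread: "x \<in> partitions k m \<Longrightarrow> length (spread x) = m"
  by (auto simp: spread_def length_concat comp_def partitions_def map_nth)

lemma mset_spread_move:
  assumes "a < length x" "b < length x" "j \<le> x ! a"
  shows "mset (spread (move a b j x)) =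
    mset (replicate (x ! a - j) a @ replicate j b @ filter (\<lambda>c. c \<noteq> a) (spread x))"
proof (rule multiset_eqI)
  fix c
  show "count (mset (spread (move a b j x))) c =
      count (mset (replicate (x ! a - j) a @ replicate j b @ filter (\<lambda>c. c \<noteq> a) (spread x))) c"
    using assms by (auto simp: count_spread nth_move)
qed

lemma mset_spread_split:
  assumes "a < length x"
  shows "mset (spread x) = mset (replicate (x ! a) a @ filter (\<lambda>c. c \<noteq> a) (spread x))"
  using assms by (intro multiset_eqI) (auto simp: count_spread)

text \<open>The expectation of the payoff \<open>g\<close> when opponents with counts
  \<open>x\<close> tremble independently, one assigned to \<open>a\<close> drawing from
  \<open>\<kappa> a\<close>.\<close>

definition val :: "nat \<Rightarrow> (nat \<Rightarrow> nat \<Rightarrow> real) \<Rightarrow> (nat list \<Rightarrow> real) \<Rightarrow> nat list \<Rightarrow> real" where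
  "val k \<kappa> g x = mean k (map \<kappa> (spread x)) (\<lambda>y. g (map y [0..<k])) (\<lambda>_. 0)"

text \<open>If every player at \<open>a\<close> switches to \<open>b\<close> with probability \<open>t\<close>, then the kernel changes by \<open>kstep\<close>
  and a payoff table by \<open>vstep\<close>. Composing such elementary trembles instead of one uniform tremble
  keeps the cost of smoothing at \<open>O(n)\<close> per count vector and step.\<close>

definition vstep :: "real \<Rightarrow> nat \<Rightarrow> nat \<Rightarrow> (nat list \<Rightarrow> real) \<Rightarrow> nat list \<Rightarrow> real" where
  "vstep t a b g x = (\<Sum>j\<le>x ! a. bin t (x ! a) j * g (move a b j x))"

definition kstep :: "real \<Rightarrow> nat \<Rightarrow> nat \<Rightarrow> (nat \<Rightarrow> nat \<Rightarrow> real) \<Rightarrow> nat \<Rightarrow> nat \<Rightarrow> real" where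
  "kstep t a b \<kappa> = \<kappa>(a := (\<lambda>c. (1 - t) * \<kappa> a c + t * \<kappa> b c))"

text \<open>Under the new kernel a player at \<open>a\<close> first decides, with probability
  \<open>t\<close>, to behave like a player at \<open>b\<close>. Hence the step added last to the
  kernel is the first one made by the players, and the table of \<open>val k \<kappa> g\<close> on
  count vectors already determines the next table.\<close>

lemma val_kstep:
  assumes "a < length x" "b < length x"
  shows "val k (kstep t a b \<kappa>) g x = vstep t a b (val k \<kappa> g) x"
proof -
  let ?f = "\<lambda>y. g (map y [0..<k])"
  let ?zs = "filter (\<lambda>c. c \<noteq> a) (spread x)"
  let ?d = "kstep t a b \<kappa> a"
  have zs: "map (kstep t a b \<kappa>) ?zs = map \<kappa> ?zs" by (simp add: kstep_def)
  have "mset (map (kstep t a b \<kappa>) (spread x)) = mset (replicate (x ! a) ?d @ map \<kappa> ?zs)"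
    using arg_cong[OF mset_spread_split[OF assms(1)], of "image_mset (kstep t a b \<kappa>)"]
      arg_cong[OF zs, of mset] by simp
  then have "val k (kstep t a b \<kappa>) g x = mean k (replicate (x ! a) ?d @ map \<kappa> ?zs) ?f (\<lambda>_. 0)"
    unfolding val_def by (rule mean_cong_mset)
  also have "\<dots> = (\<Sum>j\<le>x ! a. bin t (x ! a) j *
      mean k (replicate (x ! a - j) (\<kappa> a) @ replicate j (\<kappa> b) @ map \<kappa> ?zs) ?f (\<lambda>_. 0))"
    by (rule mean_mix) (simp add: kstep_def)
  also have "\<dots> = vstep t a b (val k \<kappa> g) x"
    unfolding vstep_def
  proof (rule sum.cong)
    fix j assume "j \<in> {..x ! a}"
    then have "mset (spread (move a b j x)) = mset (replicate (x ! a - j) a @ replicate j b @ ?zs)"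
      using assms by (intro mset_spread_move) auto
    from arg_cong[OF this, of "image_mset \<kappa>"]
    have "mset (replicate (x ! a - j) (\<kappa> a) @ replicate j (\<kappa> b) @ map \<kappa> ?zs) =
        mset (map \<kappa> (spread (move a b j x)))"
      by simp
    from mean_cong_mset[OF this] show "bin t (x ! a) j *
        mean k (replicate (x ! a - j) (\<kappa> a) @ replicate j (\<kappa> b) @ map \<kappa> ?zs) ?f (\<lambda>_. 0) =
        bin t (x ! a) j * val k \<kappa> g (move a b j x)"
      by (simp add: val_def)
  qed simp
  finally show ?thesis .
qed

lemma mean_points:
  "set ps \<subseteq> {..<k} \<Longrightarrow> mean k (map point ps) f y = f (\<lambda>a. y a + count (mset ps) a)"
proof (induction ps arbitrary: y)
  case (Cons p ps)
  then have "mean k (map point (p # ps)) f y = f (\<lambda>a. bump p y a + count (mset ps) a)"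
    by (simp add: sum_point)
  also have "(\<lambda>a. bump p y a + count (mset ps) a) = (\<lambda>a. y a + count (mset (p # ps)) a)"
    by (auto simp: bump_def)
  finally show ?case .
qed simp

lemma val_point: "length x = k \<Longrightarrow> val k point g x = g x"
proof -
  assume len: "length x = k"
  have "val k point g x = g (map (\<lambda>a. 0 + count (mset (spread x)) a) [0..<k])"
    unfolding val_def using set_spread len by (subst mean_points) auto
  also have "map (\<lambda>a. 0 + count (mset (spread x)) a) [0..<k] = x"
    using len by (auto simp: count_spread intro: nth_equalityI)
  finally show ?thesis .
qed

section \<open>The sweep over all pairs of strategies\<close>

primrec smooth_row :: "real \<Rightarrow> nat \<Rightarrow> nat \<Rightarrow> (nat list \<Rightarrow> real) \<Rightarrow> nat list \<Rightarrow> real" where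
  "smooth_row t a 0 g = g"
| "smooth_row t a (Suc b) g = vstep t a b (smooth_row t a b g)"

primrec smooth :: "real \<Rightarrow> nat \<Rightarrow> nat \<Rightarrow> (nat list \<Rightarrow> real) \<Rightarrow> nat list \<Rightarrow> real" where
  "smooth t k 0 g = g"
| "smooth t k (Suc a) g = smooth_row t a k (smooth t k a g)"

primrec kernel_row :: "real \<Rightarrow> nat \<Rightarrow> nat \<Rightarrow> (nat \<Rightarrow> nat \<Rightarrow> real) \<Rightarrow> nat \<Rightarrow> nat \<Rightarrow> real" where
  "kernel_row t a 0 \<kappa> = \<kappa>"
| "kernel_row t a (Suc b) \<kappa> = kstep t a b (kernel_row t a b \<kappa>)"

primrec kernel :: "real \<Rightarrow> nat \<Rightarrow> nat \<Rightarrow> nat \<Rightarrow> nat \<Rightarrow> real" where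
  "kernel t k 0 = point"
| "kernel t k (Suc a) = kernel_row t a k (kernel t k a)"

lemma vstep_cong:
  assumes "\<And>x. length x = k \<Longrightarrow> g x = h x" "length x = k"
  shows "vstep t a b g x = vstep t a b h x"
  using assms by (simp add: vstep_def)

lemma smooth_row_eq_val:
  assumes "a < k" "\<And>x. length x = k \<Longrightarrow> g x = val k \<kappa> g0 x" "b \<le> k" "length x = k"
  shows "smooth_row t a b g x = val k (kernel_row t a b \<kappa>) g0 x"
  using assms(3,4)
proof (induction b arbitrary: x)
  case (Suc b)
  have "smooth_row t a (Suc b) g x = vstep t a b (val k (kernel_row t a b \<kappa>) g0) x"
    unfolding smooth_row.simps using Suc by (intro vstep_cong[of k]) auto
  also have "\<dots> = val k (kernel_row t a (Suc b) \<kappa>) g0 x"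
    unfolding kernel_row.simps using Suc.prems \<open>a < k\<close> by (intro val_kstep[symmetric]) auto
  finally show ?case .
qed (use assms in simp)

lemma smooth_eq_val: "a \<le> k \<Longrightarrow> length x = k \<Longrightarrow> smooth t k a g x = val k (kernel t k a) g x"
proof (induction a arbitrary: x)
  case (Suc a)
  then show ?case unfolding smooth.simps kernel.simps by (intro smooth_row_eq_val) auto
qed (simp add: val_point)

lemma stoch_kstep:
  assumes "0 \<le> t" "t \<le> 1" "b < k" "\<And>p. p < k \<Longrightarrow> stoch k (\<kappa> p)" "p < k"
  shows "stoch k (kstep t a b \<kappa> p)"
proof (cases "p = a")
  case True
  have *: "stoch k (\<kappa> a)" "stoch k (\<kappa> b)" using assms True by auto
  then have "(\<Sum>c<k. (1 - t) * \<kappa> a c + t * \<kappa> b c) = 1"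
    by (simp add: stoch_def sum.distrib flip: sum_distrib_left)
  then show ?thesis using * assms True by (auto simp: kstep_def stoch_def)
qed (use assms in \<open>simp add: kstep_def\<close>)

lemma stoch_point: "p < k \<Longrightarrow> stoch k (point p)"
  by (auto simp: stoch_def point_def)

lemma stoch_kernel_row:
  assumes "0 \<le> t" "t \<le> 1" "b \<le> k" "\<And>p. p < k \<Longrightarrow> stoch k (\<kappa> p)" "p < k"
  shows "stoch k (kernel_row t a b \<kappa> p)"
  using assms(3,5) by (induction b arbitrary: p) (use assms in \<open>auto intro: stoch_kstep\<close>)

lemma stoch_kernel: "0 \<le> t \<Longrightarrow> t \<le> 1 \<Longrightarrow> a \<le> k \<Longrightarrow> p < k \<Longrightarrow> stoch k (kernel t k a p)"
  by (induction a arbitrary: p) (auto intro: stoch_point stoch_kernel_row)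

lemma kernel_row_other: "p \<noteq> a \<Longrightarrow> kernel_row t a b \<kappa> p = \<kappa> p"
  by (induction b) (auto simp: kstep_def)

text \<open>Every step shrinks row \<open>a\<close> by \<open>1 - t\<close> and adds
  \<open>t\<close> times row \<open>b\<close>. The diagonal starts at 1, since row \<open>a\<close>
  is still a point mass, and only shrinking has to be counted. Column \<open>c\<close> receives at
  least \<open>t * (1 - t) ^ k\<close> from the diagonal of row \<open>c\<close> in the step for
  \<open>c\<close> and is afterwards shrunk by at most the remaining factors.\<close>

lemma kernel_row_bounds:
  assumes t: "0 \<le> t" "t \<le> 1" and "a < k" and st: "\<And>p. p < k \<Longrightarrow> stoch k (\<kappa> p)"
    and "\<kappa> a = point a" and diag: "\<And>p. p < k \<Longrightarrow> (1 - t) ^ k \<le> \<kappa> p p" and "b \<le> k"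
  shows "(1 - t) ^ b \<le> kernel_row t a b \<kappa> a a"
    "\<And>c. c < b \<Longrightarrow> t * (1 - t) ^ k * (1 - t) ^ b \<le> kernel_row t a b \<kappa> a c"
proof -
  have pow: "(1 - t) ^ k \<le> (1 - t) ^ b" if "b \<le> k" for b using t that by (intro power_decreasing) auto
  have "(1 - t) ^ b \<le> kernel_row t a b \<kappa> a a \<and>
      (\<forall>c<b. t * (1 - t) ^ k * (1 - t) ^ b \<le> kernel_row t a b \<kappa> a c)"
    using \<open>b \<le> k\<close>
  proof (induction b)
    case 0
    then show ?case using \<open>\<kappa> a = point a\<close> by (simp add: point_def)
  next
    case (Suc b)
    let ?\<kappa> = "kernel_row t a b \<kappa>"
    have new: "kernel_row t a (Suc b) \<kappa> a c = (1 - t) * ?\<kappa> a c + t * ?\<kappa> b c" for c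
      by (simp add: kstep_def)
    have nonneg: "0 \<le> ?\<kappa> p c" if "p < k" "c < k" for p c
      using stoch_kernel_row[OF t _ st, where b = b and p = p and a = a] that Suc.prems by (auto simp: stoch_def)
    have d: "(1 - t) ^ k \<le> ?\<kappa> b b"
    proof (cases "b = a")
      case True
      then show ?thesis using Suc pow[of b] by auto
    next
      case False
      then show ?thesis using kernel_row_other[of b a t b \<kappa>] diag[of b] Suc.prems by simp
    qed
    have "(1 - t) ^ Suc b \<le> (1 - t) * ?\<kappa> a a" using Suc t by (simp add: mult_left_mono)
    then have "(1 - t) ^ Suc b \<le> kernel_row t a (Suc b) \<kappa> a a"
      unfolding new using nonneg[of b a] Suc.prems t \<open>a < k\<close> by (simp add: add_increasing2)
    moreover have "t * (1 - t) ^ k * (1 - t) ^ Suc b \<le> kernel_row t a (Suc b) \<kappa> a c" if "c < Suc b" for c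
    proof (cases "c = b")
      case True
      have "(1 - t) ^ Suc b \<le> 1" using t by (intro power_le_one) auto
      then have "t * (1 - t) ^ k * (1 - t) ^ Suc b \<le> t * (1 - t) ^ k * 1"
        using t by (intro mult_left_mono) auto
      also have "\<dots> \<le> t * ?\<kappa> b b" using d t by (simp add: mult_left_mono)
      finally show ?thesis unfolding new True using nonneg[of a b] Suc.prems t \<open>a < k\<close>
        by (simp add: add_increasing)
    next
      case False
      then have "t * (1 - t) ^ k * (1 - t) ^ b \<le> ?\<kappa> a c" using Suc that by auto
      from mult_left_mono[OF this, of "1 - t"]
      have "t * (1 - t) ^ k * (1 - t) ^ Suc b \<le> (1 - t) * ?\<kappa> a c" using t by (simp add: mult_ac)
      then show ?thesis unfolding new using nonneg[of b c] Suc.prems t that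
        by (simp add: add_increasing2)
    qed
    ultimately show ?case by blast
  qed
  then show "(1 - t) ^ b \<le> kernel_row t a b \<kappa> a a"
    "\<And>c. c < b \<Longrightarrow> t * (1 - t) ^ k * (1 - t) ^ b \<le> kernel_row t a b \<kappa> a c" by auto
qed

text \<open>The three claims have to be carried together: the sweep of row \<open>a\<close> needs
  that row untouched and a large diagonal in every other row, whether finished or still a point
  mass.\<close>

lemma kernel_bounds_aux:
  assumes t: "0 \<le> t" "t \<le> 1" and "a \<le> k"
  shows "(\<forall>p<k. (1 - t) ^ k \<le> kernel t k a p p) \<and> (\<forall>p<k. a \<le> p \<longrightarrow> kernel t k a p = point p) \<and>
    (\<forall>p<a. \<forall>c<k. t * (1 - t) ^ k * (1 - t) ^ k \<le> kernel t k a p c)"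
  using \<open>a \<le> k\<close>
proof (induction a)
  case 0
  then show ?case using t by (auto simp: point_def power_le_one)
next
  case (Suc a)
  note IH = Suc.IH[OF Suc_leD[OF Suc.prems]]
  have "a < k" using Suc.prems by simp
  have st: "\<And>p. p < k \<Longrightarrow> stoch k (kernel t k a p)" using t \<open>a < k\<close> by (intro stoch_kernel) auto
  have a: "kernel t k a a = point a" using IH \<open>a < k\<close> by simp
  have diag: "\<And>p. p < k \<Longrightarrow> (1 - t) ^ k \<le> kernel t k a p p" using IH by blast
  note b = kernel_row_bounds[OF t \<open>a < k\<close> st a diag le_refl]
  have o: "kernel t k (Suc a) p = kernel t k a p" if "p \<noteq> a" for p using that by (simp add: kernel_row_other)
  show ?case
  proof (intro conjI allI impI)
    fix p assume "p < k"
    show "(1 - t) ^ k \<le> kernel t k (Suc a) p p" using b(1) o diag[OF \<open>p < k\<close>] by (cases "p = a") auto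
    assume "Suc a \<le> p"
    then show "kernel t k (Suc a) p = point p" using IH o[of p] \<open>p < k\<close> by simp
  next
    fix p c assume "p < Suc a" "c < k"
    then show "t * (1 - t) ^ k * (1 - t) ^ k \<le> kernel t k (Suc a) p c"
      using b(2)[of c] o[of p] IH by (cases "p = a") auto
  qed
qed

lemma kernel_bounds:
  assumes "0 \<le> t" "4 * real k * t \<le> 1" "p < k"
  shows "1 - real k * t \<le> kernel t k k p p" "c < k \<Longrightarrow> t / 2 \<le> kernel t k k p c"
proof -
  have "1 * t \<le> real k * t" using assms(1,3) by (intro mult_right_mono) auto
  then have t1: "t \<le> 1" using assms(1,2) by linarith
  have bern: "1 - real k * t \<le> (1 - t) ^ k"
    using Bernoulli_inequality[of "- t" k] t1 by simp
  note b = kernel_bounds_aux[OF \<open>0 \<le> t\<close> t1 le_refl, of k]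
  show "1 - real k * t \<le> kernel t k k p p" using b bern \<open>p < k\<close> by force
  assume "c < k"
  \<comment> \<open>The margin 4 in \<open>4 * k * t \<le> 1\<close> is used here: 9/16 is still at
    least 1/2.\<close>
  have "3/4 \<le> (1 - t) ^ k" using bern assms(2) by linarith
  then have "(3/4) * (3/4) \<le> (1 - t) ^ k * (1 - t) ^ k" by (intro mult_mono) auto
  then have "t * (1/2) \<le> t * ((1 - t) ^ k * (1 - t) ^ k)" using \<open>0 \<le> t\<close> by (intro mult_left_mono) auto
  also have "\<dots> \<le> kernel t k k p c" using b \<open>p < k\<close> \<open>c < k\<close> by (simp add: mult.assoc)
  finally show "t / 2 \<le> kernel t k k p c" by simp
qed

section \<open>Lipschitz bound for smoothed payoffs\<close>

lemma mean_cong_total: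
  assumes "\<And>z. (\<Sum>c<k. z c) = (\<Sum>c<k. y c) + length ds \<Longrightarrow> f z = h z"
  shows "mean k ds f y = mean k ds h y"
  using assms
proof (induction ds arbitrary: y)
  case (Cons d ds)
  have "mean k ds f (bump c y) = mean k ds h (bump c y)" if "c < k" for c
  proof (rule Cons.IH)
    have "(\<Sum>b<k. bump c y b) = (\<Sum>b<k. y b + (if b = c then 1 else 0))"
      by (rule sum.cong) (auto simp: bump_def)
    also have "\<dots> = Suc (\<Sum>b<k. y b)" using that by (simp add: sum.distrib)
    finally show "f z = h z" if "(\<Sum>b<k. z b) = (\<Sum>b<k. bump c y b) + length ds" for z
      using that by (intro Cons.prems) simp
  qed
  then show ?case by simp
qed simp

text \<open>The independent coupling: both expectations become sums over pairs weighted by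
  \<open>d a * e b\<close>, so only differences of values of \<open>G\<close> remain.\<close>

lemma stoch_diff:
  assumes "stoch k d" "stoch k e" and G: "\<And>a b. a < k \<Longrightarrow> b < k \<Longrightarrow> \<bar>G a - G b\<bar> \<le> l"
  shows "\<bar>(\<Sum>a<k. d a * G a) - (\<Sum>a<k. e a * G a)\<bar> \<le> (l :: real)"
proof -
  have "(\<Sum>a<k. d a * G a) = (\<Sum>a<k. \<Sum>b<k. d a * e b * G a)"
    using assms(2) by (simp add: stoch_def flip: sum_distrib_left sum_distrib_right)
  moreover have "(\<Sum>b<k. e b * G b) = (\<Sum>a<k. \<Sum>b<k. d a * e b * G b)"
    using assms(1) by (subst sum.swap) (simp add: stoch_def mult.assoc flip: sum_distrib_right)
  ultimately have "(\<Sum>a<k. d a * G a) - (\<Sum>a<k. e a * G a) = (\<Sum>a<k. \<Sum>b<k. d a * e b * (G a - G b))"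
    by (simp add: sum_subtractf right_diff_distrib)
  also have "\<bar>\<dots>\<bar> \<le> (\<Sum>a<k. \<Sum>b<k. d a * e b * l)"
  proof (intro order_trans[OF sum_abs] sum_mono)
    fix a b assume "a \<in> {..<k}" "b \<in> {..<k}"
    then show "\<bar>d a * e b * (G a - G b)\<bar> \<le> d a * e b * l"
      using assms unfolding abs_mult by (intro mult_mono) (auto simp: stoch_def)
  qed
  also have "\<dots> = l"
    using assms(1,2) by (simp add: stoch_def mult.assoc flip: sum_distrib_left sum_distrib_right)
  finally show ?thesis .
qed

text \<open>The two profiles share \<open>m - 1\<close> players and differ in one. Whatever that
  player's tremble yields, \<open>mean_diff\<close> compares any two outcomes, and
  \<open>stoch_diff\<close> averages over them.\<close>

lemma val_move_diff:
  assumes \<kappa>: "\<And>p. p < k \<Longrightarrow> stoch k (\<kappa> p)" "\<And>p c. p < k \<Longrightarrow> c < k \<Longrightarrow> q \<le> \<kappa> p c"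
    and "0 < q" "2 * q \<le> 1" "0 < s"
    and g: "\<And>x. x \<in> partitions k m \<Longrightarrow> \<bar>g x\<bar> \<le> 1"
    and x: "x \<in> partitions k m" and ab: "a < k" "b < k" "0 < x ! a"
  shows "\<bar>val k \<kappa> g x - val k \<kappa> g (move a b 1 x)\<bar> \<le> s + 1 / (s * (real m * (2 * q)))"
proof -
  \<comment> \<open>\<open>mean_diff\<close> requires a bound at all arguments, but \<open>g\<close>
    is bounded only on count vectors of total \<open>m\<close>. Cutting \<open>g\<close> off to 0
    elsewhere does not change the mean, as every outcome has total \<open>m\<close>.\<close>
  define h where "h y = (if map y [0..<k] \<in> partitions k m then g (map y [0..<k]) else 0)" for y :: "nat \<Rightarrow> nat"
  define zs where "zs = replicate (x ! a - 1) a @ filter (\<lambda>c. c \<noteq> a) (spread x)"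
  have len: "length x = k" using x by (simp add: partitions_def)
  have cut: "val k \<kappa> g x = mean k (map \<kappa> (spread x)) h (\<lambda>_. 0)" if "x \<in> partitions k m" for x
    unfolding val_def
  proof (rule mean_cong_total)
    fix z :: "nat \<Rightarrow> nat" assume "(\<Sum>c<k. z c) = (\<Sum>c<k. 0) + length (map \<kappa> (spread x))"
    then have "map z [0..<k] \<in> partitions k m"
      using length_spread[OF that] by (simp add: partitions_def sum_list_sum_nth atLeast0LessThan)
    then show "g (map z [0..<k]) = h z" by (simp add: h_def)
  qed
  have ms: "mset (spread x) = mset (a # zs)"
    using mset_spread_split[of a x] ab len by (cases "x ! a") (auto simp: zs_def)
  have ms': "mset (spread (move a b 1 x)) = mset (b # zs)"
    using mset_spread_move[of a x b 1] ab len by (simp add: zs_def)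
  have "length (spread x) = Suc (length zs)" using arg_cong[OF ms, of size] by simp
  then have lz: "real (length zs) + 1 = real m" using length_spread[OF x] by simp
  have zs: "set zs \<subseteq> {..<k}" using set_spread[of x] len ab by (auto simp: zs_def)
  have mv: "move a b 1 x \<in> partitions k m" using x ab by (intro move_in_partitions) auto
  have 1: "val k \<kappa> g x = mean k (\<kappa> a # map \<kappa> zs) h (\<lambda>_. 0)"
    unfolding cut[OF x] using arg_cong[OF ms, of "image_mset \<kappa>"] by (intro mean_cong_mset) simp
  have 2: "val k \<kappa> g (move a b 1 x) = mean k (\<kappa> b # map \<kappa> zs) h (\<lambda>_. 0)"
    unfolding cut[OF mv] using arg_cong[OF ms', of "image_mset \<kappa>"] by (intro mean_cong_mset) simp
  show ?thesis
    unfolding 1 2 mean.simps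
  proof (rule stoch_diff)
    fix c d assume "c < k" "d < k"
    have h1: "\<bar>h y\<bar> \<le> 1" for y using g by (auto simp: h_def)
    show "\<bar>mean k (map \<kappa> zs) h (bump c (\<lambda>_. 0)) - mean k (map \<kappa> zs) h (bump d (\<lambda>_. 0))\<bar>
        \<le> s + 1 / (s * (real m * (2 * q)))"
    proof -
      have "stoch k d \<and> (\<forall>c<k. q \<le> d c)" if "d \<in> set (map \<kappa> zs)" for d using \<kappa> zs that by auto
      from mean_diff[where f = h and ds = "map \<kappa> zs", OF \<open>c < k\<close> \<open>d < k\<close> h1 \<open>0 < s\<close> \<open>0 < q\<close> this \<open>2 * q \<le> 1\<close>]
      show ?thesis by (simp add: lz)
    qed
  qed (use \<kappa> ab in auto)
qed

text \<open>A path of unit moves from overfull to underfull strategies leads from \<open>x\<close>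
  to \<open>y\<close>. Its length is the sum of the truncated differences, half of the l1
  distance.\<close>

lemma lipschitz_of_move:
  fixes v :: "nat list \<Rightarrow> real"
  assumes mv: "\<And>x a b. x \<in> partitions k m \<Longrightarrow> a < k \<Longrightarrow> b < k \<Longrightarrow> 0 < x ! a \<Longrightarrow>
      \<bar>v x - v (move a b 1 x)\<bar> \<le> l"
    and "x \<in> partitions k m" "y \<in> partitions k m" "0 \<le> l"
  shows "\<bar>v x - v y\<bar> \<le> l * (\<Sum>c<k. \<bar>real (x ! c) - real (y ! c)\<bar>)"
proof -
  have "\<bar>v x - v y\<bar> \<le> l * real (\<Sum>c<k. x ! c - y ! c)"
    using assms(2)
  proof (induction "\<Sum>c<k. x ! c - y ! c" arbitrary: x)
    case 0
    have xy: "length x = k" "length y = k" "(\<Sum>c<k. x ! c) = (\<Sum>c<k. y ! c)"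
      using 0 \<open>y \<in> partitions k m\<close> by (auto simp: partitions_def sum_list_nth)
    have le: "x ! c \<le> y ! c" if "c \<in> {..<k}" for c using 0(1) that by simp
    have "x ! c = y ! c" if "c < k" for c
      using sum_mono_inv[OF xy(3) le] that by simp
    then have "x = y" using xy by (intro nth_equalityI) auto
    then show ?case by simp
  next
    case (Suc D)
    have xy: "length x = k" "length y = k" "(\<Sum>c<k. x ! c) = (\<Sum>c<k. y ! c)"
      using Suc \<open>y \<in> partitions k m\<close> by (auto simp: partitions_def sum_list_nth)
    have "\<exists>a<k. y ! a < x ! a"
    proof (rule ccontr)
      assume "\<not> ?thesis"
      then have "\<forall>c\<in>{..<k}. x ! c \<le> y ! c" by (meson lessThan_iff not_less)
      then have "(\<Sum>c<k. x ! c - y ! c) = 0" by simp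
      then show False using Suc(2) by simp
    qed
    then obtain a where a: "a < k" "y ! a < x ! a" by blast
    have "\<exists>b<k. x ! b < y ! b"
    proof (rule ccontr)
      assume "\<not> ?thesis"
      then have "\<forall>c\<in>{..<k}. y ! c \<le> x ! c" by (meson lessThan_iff not_less)
      moreover have "\<exists>c\<in>{..<k}. y ! c < x ! c" using a by blast
      ultimately have "(\<Sum>c<k. y ! c) < (\<Sum>c<k. x ! c)" by (intro sum_strict_mono_ex1) auto
      then show False using xy by simp
    qed
    then obtain b where b: "b < k" "x ! b < y ! b" by blast
    let ?x = "move a b 1 x"
    have "a \<noteq> b" using a b by auto
    have x': "?x \<in> partitions k m" using Suc.prems a b by (intro move_in_partitions) auto
    have "(\<Sum>c<k. x ! c - y ! c) = (\<Sum>c<k. (?x ! c - y ! c) + (if c = a then 1 else 0))"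
      using a b xy \<open>a \<noteq> b\<close> by (intro sum.cong) (auto simp: nth_move)
    then have "D = (\<Sum>c<k. ?x ! c - y ! c)" using Suc(2) a by (simp add: sum.distrib)
    from Suc(1)[OF this x'] have "\<bar>v ?x - v y\<bar> \<le> l * real D"
      unfolding \<open>D = (\<Sum>c<k. ?x ! c - y ! c)\<close>[symmetric] .
    moreover have "\<bar>v x - v ?x\<bar> \<le> l" using a by (intro mv[OF Suc.prems a(1) b(1)]) simp
    moreover have "\<bar>v x - v y\<bar> \<le> \<bar>v x - v ?x\<bar> + \<bar>v ?x - v y\<bar>" by linarith
    moreover have "l * real (Suc D) = l + l * real D" by (simp add: distrib_left)
    ultimately show ?case unfolding Suc(2)[symmetric] by linarith
  qed
  also have "real (\<Sum>c<k. x ! c - y ! c) \<le> (\<Sum>c<k. \<bar>real (x ! c) - real (y ! c)\<bar>)"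
    unfolding of_nat_sum by (rule sum_mono) linarith
  finally show ?thesis using \<open>0 \<le> l\<close> by (simp add: mult_left_mono)
qed

section \<open>Rounding by local search\<close>

text \<open>The players in \<open>J\<close> are assigned to strategies by \<open>p\<close>; the target counts are \<open>x\<close>. After an
  insertion one strategy \<open>h\<close> is hot: without its newest player the assignment would be settled.
  Moving a player from \<open>h\<close> to \<open>c\<close> leaves \<open>rest\<close> unchanged and makes \<open>c\<close> hot, with a strictly smaller
  value of \<open>rest\<close>, so there are fewer than \<open>k\<close> moves per insertion.\<close>

definition excess :: "nat set \<Rightarrow> (nat \<Rightarrow> nat) \<Rightarrow> (nat \<Rightarrow> nat) \<Rightarrow> nat \<Rightarrow> int" where
  "excess J x p a = int (card {j \<in> J. p j = a}) - int (x a)"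

definition settled ::
    "nat \<Rightarrow> nat set \<Rightarrow> (nat \<Rightarrow> nat \<Rightarrow> bool) \<Rightarrow> (nat \<Rightarrow> nat) \<Rightarrow> (nat \<Rightarrow> nat) \<Rightarrow> bool" where
  "settled k J ok x p \<longleftrightarrow>
     (\<forall>j\<in>J. \<forall>c<k. ok j c \<longrightarrow> excess J x p (p j) \<le> excess J x p c + 1)"

definition rest :: "nat set \<Rightarrow> (nat \<Rightarrow> nat) \<Rightarrow> (nat \<Rightarrow> nat) \<Rightarrow> nat \<Rightarrow> nat \<Rightarrow> int" where
  "rest J x p h a = excess J x p a - (if a = h then 1 else 0)"

definition hot ::
    "nat \<Rightarrow> nat set \<Rightarrow> (nat \<Rightarrow> nat \<Rightarrow> bool) \<Rightarrow> (nat \<Rightarrow> nat) \<Rightarrow> (nat \<Rightarrow> nat) \<Rightarrow> nat \<Rightarrow> bool" where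
  "hot k J ok x p h \<longleftrightarrow> h < k \<and>
     (\<forall>j\<in>J. \<forall>c<k. ok j c \<longrightarrow> rest J x p h (p j) \<le> rest J x p h c + 1)"

definition below :: "nat \<Rightarrow> nat set \<Rightarrow> (nat \<Rightarrow> nat) \<Rightarrow> (nat \<Rightarrow> nat) \<Rightarrow> nat \<Rightarrow> nat" where
  "below k J x p h = card {c. c < k \<and> rest J x p h c < rest J x p h h}"

lemma below_less: "h < k \<Longrightarrow> below k J x p h < k"
proof -
  assume "h < k"
  then have "{c. c < k \<and> rest J x p h c < rest J x p h h} \<subset> {..<k}" by force
  from psubset_card_mono[OF _ this] show ?thesis by (simp add: below_def)
qed

lemma count_update:
  assumes "finite J" "j \<in> J"
  shows "int (card {i \<in> J. (p(j := c)) i = a}) =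
    int (card {i \<in> J. p i = a}) - (if a = p j then 1 else 0) + (if a = c then 1 else 0)"
proof -
  have *: "card {i \<in> J. q i = a} = card {i \<in> J - {j}. q i = a} + (if a = q j then 1 else 0)" for q
  proof (cases "a = q j")
    case True
    then have "{i \<in> J. q i = a} = insert j {i \<in> J - {j}. q i = a}" using assms by auto
    then show ?thesis using assms True by simp
  next
    case False
    then have "{i \<in> J. q i = a} = {i \<in> J - {j}. q i = a}" by auto
    then show ?thesis using False by simp
  qed
  have "{i \<in> J - {j}. (p(j := c)) i = a} = {i \<in> J - {j}. p i = a}" by auto
  then show ?thesis using *[of p] *[of "p(j := c)"] by auto
qed

lemma hot_move:
  assumes "finite J" "hot k J ok x p h" "j \<in> J" "c < k" "ok j c"
    and v: "excess J x p c + 2 \<le> excess J x p (p j)"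
  shows "hot k J ok x (p(j := c)) c" "below k J x (p(j := c)) c < below k J x p h"
proof -
  have r: "rest J x p h (p j) \<le> rest J x p h c + 1" using assms(2-5) by (auto simp: hot_def)
  \<comment> \<open>\<open>rest\<close> allows a gap of 1 only, whereas the move requires a gap of 2
    in \<open>excess\<close>; the two differ only at \<open>h\<close>, so the moving player must sit
    there.\<close>
  have pj: "p j = h" "c \<noteq> h" using r v by (auto simp: rest_def split: if_splits)
  have rest: "rest J x (p(j := c)) c = rest J x p h"
    using count_update[OF \<open>finite J\<close> \<open>j \<in> J\<close>, of p c] pj by (auto simp: fun_eq_iff rest_def excess_def)
  have le: "rest J x p h c + 1 \<le> rest J x p h h" using v pj by (simp add: rest_def)
  show "hot k J ok x (p(j := c)) c"
    unfolding hot_def rest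
  proof (intro conjI ballI allI impI)
    fix i d assume i: "i \<in> J" "d < k" "ok i d"
    show "rest J x p h ((p(j := c)) i) \<le> rest J x p h d + 1"
    proof (cases "i = j")
      case True
      have "rest J x p h (p i) \<le> rest J x p h d + 1" using i assms(2) by (auto simp: hot_def)
      then show ?thesis using le True pj by simp
    next
      case False
      then show ?thesis using i assms(2) by (auto simp: hot_def)
    qed
  qed fact
  have "{d. d < k \<and> rest J x p h d < rest J x p h c} \<subset> {d. d < k \<and> rest J x p h d < rest J x p h h}"
    using le \<open>c < k\<close> by force
  from psubset_card_mono[OF _ this] show "below k J x (p(j := c)) c < below k J x p h"
    by (simp add: below_def rest)
qed

text \<open>Discounting the new player at \<open>b\<close> restores the old excesses, for which the
  old players are settled; the new player satisfies the condition because \<open>b\<close> has least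
  excess among the strategies open to it.\<close>

lemma hot_insert:
  assumes "finite J" "settled k J ok x p" "i \<notin> J" "b < k"
    and min: "\<And>c. c < k \<Longrightarrow> ok i c \<Longrightarrow> excess J x p b \<le> excess J x p c"
  shows "hot k (insert i J) ok x (p(i := b)) b"
proof -
  have rest: "rest (insert i J) x (p(i := b)) b = excess J x p"
  proof
    fix a
    have "{j \<in> insert i J. (p(i := b)) j = a} =
        (if a = b then insert i {j \<in> J. p j = a} else {j \<in> J. p j = a})"
      using \<open>i \<notin> J\<close> by auto
    then show "rest (insert i J) x (p(i := b)) b a = excess J x p a"
      using assms(1,3) by (simp add: rest_def excess_def)
  qed
  show ?thesis
    unfolding hot_def rest
  proof (intro conjI ballI allI impI)
    fix j c assume j: "j \<in> insert i J" "c < k" "ok j c"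
    show "excess J x p ((p(i := b)) j) \<le> excess J x p c + 1"
    proof (cases "j = i")
      case True
      then show ?thesis using min[of c] j by simp
    next
      case False
      then show ?thesis using assms(2) j by (auto simp: settled_def)
    qed
  qed fact
qed

definition progress ::
    "nat \<Rightarrow> nat set \<Rightarrow> (nat \<Rightarrow> nat \<Rightarrow> bool) \<Rightarrow> (nat \<Rightarrow> nat) \<Rightarrow> nat \<Rightarrow> (nat \<Rightarrow> nat) \<Rightarrow> bool" where
  "progress k J ok x s p \<longleftrightarrow>
     settled k J ok x p \<or> (\<exists>h. hot k J ok x p h \<and> below k J x p h + s < k)"

text \<open>The state in a pass over all pairs, just before \<open>(i, b)\<close>, after
  \<open>s\<close> complete passes. Either this pass has already made a move, which has lowered
  \<open>below\<close> and so paid for the pass, or all pairs examined so far were stable. A pass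
  without moves thus ends in a settled assignment, and \<open>k\<close> passes suffice.\<close>

definition scan ::
    "nat \<Rightarrow> nat set \<Rightarrow> (nat \<Rightarrow> nat \<Rightarrow> bool) \<Rightarrow> (nat \<Rightarrow> nat) \<Rightarrow> nat \<Rightarrow> nat \<Rightarrow> nat \<Rightarrow> (nat \<Rightarrow> nat) \<Rightarrow> bool" where
  "scan k J ok x s i b p \<longleftrightarrow> settled k J ok x p \<or>
     (\<exists>h. hot k J ok x p h \<and> (below k J x p h + Suc s < k \<or>
       below k J x p h + s < k \<and>
       (\<forall>j\<in>J. \<forall>c<k. (j < i \<or> j = i \<and> c < b) \<longrightarrow> ok j c \<longrightarrow>
          excess J x p (p j) \<le> excess J x p c + 1)))"

lemma scan_start: "progress k J ok x s p \<Longrightarrow> scan k J ok x s 0 0 p"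
  by (auto simp: progress_def scan_def)

lemma scan_row: "scan k J ok x s i k p \<Longrightarrow> scan k J ok x s (Suc i) 0 p"
  unfolding scan_def by (metis less_SucE less_nat_zero_code)

lemma scan_end: "scan k {..<i} ok x s i 0 p \<Longrightarrow> progress k {..<i} ok x (Suc s) p"
  by (auto simp: scan_def progress_def settled_def)

lemma progress_end: "progress k J ok x k p \<Longrightarrow> settled k J ok x p"
  by (auto simp: progress_def)

lemma progress_start: "hot k J ok x p h \<Longrightarrow> progress k J ok x 0 p"
  using below_less by (auto simp: progress_def hot_def)

lemma scan_skip:
  assumes "scan k J ok x s i b p" "\<not> (ok i b \<and> excess J x p b + 2 \<le> excess J x p (p i))"
  shows "scan k J ok x s i (Suc b) p"
  using assms unfolding scan_def by (auto simp: less_Suc_eq)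

lemma scan_move:
  assumes "scan k J ok x s i b p" "finite J" "i \<in> J" "b < k" "ok i b"
    and v: "excess J x p b + 2 \<le> excess J x p (p i)"
  shows "scan k J ok x s i (Suc b) (p(i := b))"
proof -
  have "\<not> settled k J ok x p" using assms(3-6) by (force simp: settled_def)
  then obtain h where h: "hot k J ok x p h" "below k J x p h + s < k"
    using assms(1) by (auto simp: scan_def)
  have "hot k J ok x (p(i := b)) b" "below k J x (p(i := b)) b + Suc s < k"
    using hot_move[OF assms(2) h(1) assms(3-6)] h(2) by auto
  then show ?thesis unfolding scan_def by blast
qed

text \<open>If some excess is larger than \<open>T + k\<close>, then there is a level \<open>t > T\<close> such that no strategy
  has excess \<open>t - 1\<close>; the players on the strategies of excess at least \<open>t\<close> cannot leave them,
  although these strategies are overfull.\<close>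

lemma settled_excess_le:
  fixes \<sigma> :: "nat \<Rightarrow> nat \<Rightarrow> real"
  assumes set: "settled k {..<n} ok x p" and p: "\<And>i. i < n \<Longrightarrow> p i < k"
    and nonneg: "\<And>i a. i < n \<Longrightarrow> a < k \<Longrightarrow> 0 \<le> \<sigma> i a"
    and one: "\<And>i. i < n \<Longrightarrow> (\<Sum>a<k. \<sigma> i a) = 1"
    and supp: "\<And>i a. i < n \<Longrightarrow> a < k \<Longrightarrow> 0 < \<sigma> i a \<Longrightarrow> ok i a"
    and near: "\<And>a. a < k \<Longrightarrow> (\<Sum>i<n. \<sigma> i a) \<le> real (x a + T)"
    and "a < k"
  shows "excess {..<n} x p a \<le> int (T + k)"
proof (rule ccontr)
  let ?e = "excess {..<n} x p"
  assume "\<not> ?thesis"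
  then have big: "int (T + k) < ?e a" by simp
  have level: "\<exists>b<k. ?e b = t - 1" if t: "int T < t" "t \<le> int (T + k) + 1" for t
  proof (rule ccontr)
    assume no: "\<not> (\<exists>b<k. ?e b = t - 1)"
    define S where "S = {b. b < k \<and> t \<le> ?e b}"
    have S: "S = {b. b < k \<and> t - 1 \<le> ?e b}" using no unfolding S_def by force
    have "a \<in> S" using big t \<open>a < k\<close> by (simp add: S_def)
    have fin: "finite S" and sub: "S \<subseteq> {..<k}" by (auto simp: S_def)
    have stay: "c \<in> S" if "i < n" "p i \<in> S" "c < k" "ok i c" for i c
    proof -
      have "?e (p i) \<le> ?e c + 1" using set that by (auto simp: settled_def)
      moreover have "t \<le> ?e (p i)" using that by (simp add: S_def)
      ultimately show ?thesis using that unfolding S by simp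
    qed
    have full: "1 \<le> (\<Sum>c\<in>S. \<sigma> i c)" if "i < n" "p i \<in> S" for i
    proof -
      have "\<sigma> i c = 0" if "c \<in> {..<k} - S" for c
        using stay[OF \<open>i < n\<close> \<open>p i \<in> S\<close>, of c] supp[of i c] nonneg[of i c] that \<open>i < n\<close> by force
      then have "(\<Sum>c<k. \<sigma> i c) = (\<Sum>c\<in>S. \<sigma> i c)"
        using sub by (intro sum.mono_neutral_right) auto
      then show ?thesis using one[OF \<open>i < n\<close>] by simp
    qed
    have "(\<Sum>c\<in>S. card {i \<in> {..<n}. p i = c}) = card {i \<in> {..<n}. p i \<in> S}"
    proof -
      have "{i \<in> {..<n}. p i \<in> S} = (\<Union>c\<in>S. {i \<in> {..<n}. p i = c})" by auto
      then show ?thesis using fin by (subst card_UN_disjoint[symmetric]) auto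
    qed
    then have "real (\<Sum>c\<in>S. card {i \<in> {..<n}. p i = c}) = (\<Sum>i\<in>{i \<in> {..<n}. p i \<in> S}. 1)" by simp
    also have "\<dots> \<le> (\<Sum>i\<in>{i \<in> {..<n}. p i \<in> S}. \<Sum>c\<in>S. \<sigma> i c)"
      by (rule sum_mono) (use full in auto)
    also have "\<dots> \<le> (\<Sum>i<n. \<Sum>c\<in>S. \<sigma> i c)"
      using nonneg sub by (intro sum_mono2) (auto intro!: sum_nonneg)
    also have "\<dots> = (\<Sum>c\<in>S. \<Sum>i<n. \<sigma> i c)" by (rule sum.swap)
    also have "\<dots> \<le> (\<Sum>c\<in>S. real (x c + T))" using near sub by (intro sum_mono) auto
    also have "\<dots> = real (\<Sum>c\<in>S. x c + T)" by simp
    finally have "(\<Sum>c\<in>S. card {i \<in> {..<n}. p i = c}) \<le> (\<Sum>c\<in>S. x c + T)" by linarith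
    moreover have "(\<Sum>c\<in>S. x c + T) < (\<Sum>c\<in>S. card {i \<in> {..<n}. p i = c})"
    proof (rule sum_strict_mono)
      fix c assume "c \<in> S"
      then have "t \<le> ?e c" by (simp add: S_def)
      then show "x c + T < card {i \<in> {..<n}. p i = c}" using t by (simp add: excess_def)
    qed (use fin \<open>a \<in> S\<close> in auto)
    ultimately show False by simp
  qed
  \<comment> \<open>The \<open>k + 1\<close> levels from \<open>T\<close> to \<open>T + k\<close>
    would all have to occur among the excesses of only \<open>k\<close> strategies.\<close>
  have "(\<lambda>j. int T + int j) ` {..k} \<subseteq> ?e ` {..<k}"
  proof
    fix y assume "y \<in> (\<lambda>j. int T + int j) ` {..k}"
    then show "y \<in> ?e ` {..<k}" using level[of "y + 1"] by force
  qed
  then have "card ((\<lambda>j. int T + int j) ` {..k}) \<le> card (?e ` {..<k})"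
    by (rule card_mono[rotated]) simp
  also have "\<dots> \<le> k" using card_image_le[of "{..<k}" ?e] by simp
  finally show False by (subst (asm) card_image) (auto simp: inj_on_def)
qed

section \<open>Equilibria from assignments\<close>

text \<open>The product measure is unfolded one player at a time into the nested sums of
  \<open>mean\<close>; the offset \<open>y\<close> collects the counts of the players already
  drawn.\<close>

lemma expectation_profile:
  fixes h :: "(nat \<Rightarrow> nat) \<Rightarrow> real" and js :: "nat list"
  assumes "distinct js" "\<And>j. j \<in> set js \<Longrightarrow> set_pmf (s j) \<subseteq> {..<k}"
  shows "measure_pmf.expectation (Pi_pmf (set js) 0 s) (\<lambda>f. h (\<lambda>a. y a + card {j \<in> set js. f j = a})) =
    mean k (map (\<lambda>j. pmf (s j)) js) h y"
  using assms
proof (induction js arbitrary: y)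
  case (Cons i js)
  let ?P = "Pi_pmf (set js) 0 s"
  have fin: "finite (set_pmf ?P)"
  proof (rule finite_subset[OF set_Pi_pmf_subset'])
    show "finite (PiE_dflt (set js) 0 (set_pmf \<circ> s))"
      using Cons.prems(2) by (intro finite_PiE_dflt) (auto intro: finite_subset[OF _ finite_lessThan])
  qed simp
  have "Pi_pmf (set (i # js)) 0 s = s i \<bind> (\<lambda>c. map_pmf (\<lambda>f. f(i := c)) ?P)"
    using Cons.prems(1) by (simp add: Pi_pmf_insert' map_pmf_def)
  then have "measure_pmf.expectation (Pi_pmf (set (i # js)) 0 s)
        (\<lambda>f. h (\<lambda>a. y a + card {j \<in> set (i # js). f j = a})) =
      (\<Sum>c<k. pmf (s i) c *\<^sub>R measure_pmf.expectation (map_pmf (\<lambda>f. f(i := c)) ?P)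
        (\<lambda>f. h (\<lambda>a. y a + card {j \<in> set (i # js). f j = a})))"
    using Cons.prems fin by (simp only:) (rule pmf_expectation_bind, auto)
  also have "\<dots> = (\<Sum>c<k. pmf (s i) c * mean k (map (\<lambda>j. pmf (s j)) js) h (bump c y))"
  proof (rule sum.cong)
    fix c :: nat
    have card: "card {j \<in> set (i # js). (f(i := c)) j = a} = (if a = c then 1 else 0) + card {j \<in> set js. f j = a}"
      for f :: "nat \<Rightarrow> nat" and a
    proof -
      have "{j \<in> set (i # js). (f(i := c)) j = a} =
          (if a = c then insert i {j \<in> set js. f j = a} else {j \<in> set js. f j = a})"
        using Cons.prems(1) by auto
      then show ?thesis using Cons.prems(1) by simp
    qed
    have "(\<lambda>a. y a + ((if a = c then 1 else 0) + card {j \<in> set js. f j = a})) =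
        (\<lambda>a. bump c y a + card {j \<in> set js. f j = a})" for f :: "nat \<Rightarrow> nat"
      by (auto simp: bump_def)
    then have "measure_pmf.expectation (map_pmf (\<lambda>f. f(i := c)) ?P)
        (\<lambda>f. h (\<lambda>a. y a + card {j \<in> set (i # js). f j = a})) =
        measure_pmf.expectation ?P (\<lambda>f. h (\<lambda>a. bump c y a + card {j \<in> set js. f j = a}))"
      unfolding integral_map_pmf card by simp
    then show "pmf (s i) c *\<^sub>R measure_pmf.expectation (map_pmf (\<lambda>f. f(i := c)) ?P)
        (\<lambda>f. h (\<lambda>a. y a + card {j \<in> set (i # js). f j = a})) =
        pmf (s i) c * mean k (map (\<lambda>j. pmf (s j)) js) h (bump c y)"
      using Cons by simp
  qed simp
  finally show ?case by simp
qed simp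

lemma expectation_pair:
  fixes u :: "'a \<Rightarrow> nat \<Rightarrow> real"
  assumes "finite (set_pmf P)" "set_pmf q \<subseteq> {..<k}"
  shows "measure_pmf.expectation (pair_pmf P q) (\<lambda>(x, a). u x a) =
    (\<Sum>a<k. pmf q a * measure_pmf.expectation P (\<lambda>x. u x a))"
proof -
  have "pair_pmf P q = q \<bind> (\<lambda>a. map_pmf (\<lambda>x. (x, a)) P)"
    unfolding pair_commute_pmf[of P q] by (simp add: pair_pmf_def map_pmf_def bind_assoc_pmf bind_return_pmf)
  then have "measure_pmf.expectation (pair_pmf P q) (\<lambda>(x, a). u x a) =
      (\<Sum>a<k. pmf q a *\<^sub>R measure_pmf.expectation (map_pmf (\<lambda>x. (x, a)) P) (\<lambda>(x, a). u x a))"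
    using assms by (simp only:) (rule pmf_expectation_bind, auto)
  then show ?thesis by simp
qed

lemma stoch_pmf_exists:
  assumes "stoch k d"
  obtains p :: "nat pmf" where "set_pmf p \<subseteq> {..<k}" "\<And>c. c < k \<Longrightarrow> pmf p c = d c"
proof -
  define f where "f c = (if c < k then d c else 0)" for c
  have nonneg: "0 \<le> f c" for c using assms by (simp add: f_def stoch_def)
  have "(\<integral>\<^sup>+ c. ennreal (f c) \<partial>count_space UNIV) = (\<Sum>c<k. ennreal (f c))"
    by (rule nn_integral_count_space') (auto simp: f_def)
  also have "\<dots> = ennreal (\<Sum>c<k. f c)" using nonneg by (intro sum_ennreal) auto
  also have "(\<Sum>c<k. f c) = 1" using assms by (simp add: f_def stoch_def)
  finally have one: "(\<integral>\<^sup>+ c. ennreal (f c) \<partial>count_space UNIV) = 1" by simp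
  show ?thesis
  proof (rule that[of "embed_pmf f"])
    show "set_pmf (embed_pmf f) \<subseteq> {..<k}"
      using set_embed_pmf[of f, OF nonneg one] by (auto simp: f_def)
    show "pmf (embed_pmf f) c = d c" if "c < k" for c
      using pmf_embed_pmf[of f, OF nonneg one] that by (simp add: f_def)
  qed
qed

lemma card_fibers:
  fixes k :: nat
  assumes "finite A" "\<And>j. j \<in> A \<Longrightarrow> p j < k"
  shows "(\<Sum>a<k. card {j \<in> A. p j = a}) = card A"
  using sum.group[of A "{..<k}" p "\<lambda>_. 1 :: nat"] assms by auto

definition view :: "nat \<Rightarrow> nat \<Rightarrow> (nat \<Rightarrow> nat) \<Rightarrow> nat \<Rightarrow> nat list" where
  "view n k p i = map (\<lambda>a. card {j \<in> {..<n} - {i}. p j = a}) [0..<k]"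

lemma view_in_partitions:
  assumes "\<And>i. i < n \<Longrightarrow> p i < k" "i < n"
  shows "view n k p i \<in> partitions k (n - 1)"
proof -
  have "(\<Sum>a<k. card {j \<in> {..<n} - {i}. p j = a}) = card ({..<n} - {i})"
    using assms by (intro card_fibers) auto
  then show ?thesis using assms by (simp add: view_def partitions_def sum_list_sum_nth atLeast0LessThan)
qed

text \<open>The law of an opponent depends only on the strategy assigned to it, and the multiset of
  these strategies is what \<open>spread\<close> lists for the view of player \<open>i\<close>.
  Expected payoffs in the trembled profile are thus entries of the smoothed tables.\<close>

lemma others_expectation:
  assumes p: "\<And>i. i < n \<Longrightarrow> p i < k" and "i < n"
    and s: "\<And>j. j < n \<Longrightarrow> set_pmf (s j) \<subseteq> {..<k} \<and> (\<forall>c<k. pmf (s j) c = \<kappa> (p j) c)"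
  shows "measure_pmf.expectation (others n k s i) g = val k \<kappa> g (view n k p i)"
proof -
  define js where "js = filter (\<lambda>j. j \<noteq> i) [0..<n]"
  have js: "distinct js" "set js = {..<n} - {i}" by (auto simp: js_def)
  have zero: "pmf (s j) c = 0" if "j < n" "\<not> c < k" for j c
    using s[OF that(1)] that(2) by (auto simp: pmf_eq_0_set_pmf)
  have "measure_pmf.expectation (others n k s i) g =
      measure_pmf.expectation (Pi_pmf (set js) 0 s)
        (\<lambda>f. (\<lambda>y. g (map y [0..<k])) (\<lambda>a. 0 + card {j \<in> set js. f j = a}))"
    by (simp add: others_def js)
  also have "\<dots> = mean k (map (\<lambda>j. pmf (s j)) js) (\<lambda>y. g (map y [0..<k])) (\<lambda>_. 0)"
    using js s by (intro expectation_profile[where y = "\<lambda>_. 0"]) auto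
  also have "\<dots> = mean k (map \<kappa> (map p js)) (\<lambda>y. g (map y [0..<k])) (\<lambda>_. 0)"
  proof -
    have "mean k (map d js) f y = mean k (map e js) f y"
      if "\<forall>j\<in>set js. \<forall>c<k. d j c = e j c" for d e f y and js :: "nat list"
      using that by (induction js arbitrary: y) auto
    then show ?thesis using js s by simp
  qed
  also have "\<dots> = val k \<kappa> g (view n k p i)"
    unfolding val_def
  proof (rule mean_cong_mset)
    have "mset (map p js) = mset (spread (view n k p i))"
    proof (rule multiset_eqI)
      fix c
      have "count (mset (map p js)) c = length (filter (\<lambda>j. p j = c) js)" by (induction js) auto
      also have "\<dots> = card {j \<in> {..<n} - {i}. p j = c}"
        unfolding distinct_length_filter[OF js(1)] js(2) by (auto intro!: arg_cong[of _ _ card])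
      finally have "count (mset (map p js)) c = card {j \<in> {..<n} - {i}. p j = c}" .
      then show "count (mset (map p js)) c = count (mset (spread (view n k p i))) c"
        using p by (auto simp: count_spread view_def)
    qed
    from arg_cong[OF this, of "image_mset \<kappa>"]
    show "mset (map \<kappa> (map p js)) = mset (map \<kappa> (spread (view n k p i)))" by (simp only: mset_map)
  qed
  finally show ?thesis .
qed

lemma sum_excess:
  assumes p: "\<And>i. i < n \<Longrightarrow> p i < k"
  shows "(\<Sum>a<k. excess {..<n} x p a) = int n - int (\<Sum>a<k. x a)"
proof -
  have "(\<Sum>a<k. card {j \<in> {..<n}. p j = a}) = n" using assms card_fibers[of "{..<n}" p k] by auto
  then show ?thesis by (simp only: excess_def sum_subtractf of_nat_sum[symmetric])
qed

text \<open>A one-sided bound suffices because the differences z between view and \<open>x\<close>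
  add up to 0: from z <= K follows |z| <= 2 K - z, and the summation removes z. Player
  \<open>i\<close>, who is absent from the view, accounts for the correction at
  \<open>p i\<close>.\<close>

lemma view_distance:
  assumes p: "\<And>i. i < n \<Longrightarrow> p i < k" and "i < n" and x: "x \<in> partitions k (n - 1)"
    and e: "\<And>a. a < k \<Longrightarrow> excess {..<n} ((!) x) p a \<le> int K"
  shows "(\<Sum>c<k. \<bar>real (view n k p i ! c) - real (x ! c)\<bar>) \<le> 2 * real k * real K"
proof -
  let ?e = "excess {..<n} ((!) x) p"
  have z: "int (view n k p i ! c) - int (x ! c) = ?e c - (if c = p i then 1 else 0)" if "c < k" for c
  proof -
    have "{j \<in> {..<n}. p j = c} = (if c = p i then insert i {j \<in> {..<n} - {i}. p j = c} else {j \<in> {..<n} - {i}. p j = c})"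
      using \<open>i < n\<close> by auto
    then have "card {j \<in> {..<n}. p j = c} = card {j \<in> {..<n} - {i}. p j = c} + (if c = p i then 1 else 0)" by simp
    then show ?thesis using that by (simp add: view_def excess_def)
  qed
  have "(\<Sum>c<k. \<bar>int (view n k p i ! c) - int (x ! c)\<bar>) \<le> (\<Sum>c<k. 2 * int K - ?e c + (if c = p i then 1 else 0))"
  proof (rule sum_mono)
    fix c assume "c \<in> {..<k}"
    then show "\<bar>int (view n k p i ! c) - int (x ! c)\<bar> \<le> 2 * int K - ?e c + (if c = p i then 1 else 0)"
      using z[of c] e[of c] by (auto simp: abs_if)
  qed
  also have "\<dots> = 2 * int k * int K - (int n - int (n - 1)) + 1"
  proof -
    have "(\<Sum>a<k. x ! a) = n - 1" using x by (auto simp: partitions_def sum_list_nth)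
    then have "(\<Sum>a<k. ?e a) = int n - int (n - 1)" using sum_excess[of n p k "(!) x"] p by simp
    then show ?thesis using p[OF \<open>i < n\<close>] by (simp add: sum.distrib sum_subtractf)
  qed
  also have "\<dots> = 2 * int k * int K" using \<open>i < n\<close> by simp
  finally have "real_of_int (\<Sum>c<k. \<bar>int (view n k p i ! c) - int (x ! c)\<bar>) \<le> real_of_int (2 * int k * int K)"
    by (simp only: of_int_le_iff)
  then show ?thesis by simp
qed

lemma finite_others:
  assumes "mixed_profile n k s"
  shows "finite (set_pmf (others n k s i))"
proof -
  have "finite (set_pmf (Pi_pmf ({..<n} - {i}) 0 s))"
  proof (rule finite_subset[OF set_Pi_pmf_subset'])
    show "finite (PiE_dflt ({..<n} - {i}) 0 (set_pmf \<circ> s))"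
      using assms by (intro finite_PiE_dflt) (auto simp: mixed_profile_def intro: finite_subset[OF _ finite_lessThan])
  qed simp
  then show ?thesis by (simp add: others_def)
qed

lemma set_others:
  assumes "mixed_profile n k s" "i < n" "0 < k"
  shows "set_pmf (others n k s i) \<subseteq> partitions k (n - 1)"
proof
  fix y assume "y \<in> set_pmf (others n k s i)"
  then obtain f where f: "f \<in> set_pmf (Pi_pmf ({..<n} - {i}) 0 s)" "y = view n k f i"
    by (auto simp: others_def view_def)
  have "f \<in> PiE_dflt ({..<n} - {i}) 0 (set_pmf \<circ> s)" using f(1) set_Pi_pmf_subset'[of "{..<n} - {i}" 0 s] by auto
  then have f': "f j < k" if "j < n" "j \<noteq> i" for j
    using assms(1) that by (auto simp: PiE_dflt_def mixed_profile_def)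
  \<comment> \<open>The view of player \<open>i\<close> ignores the value at \<open>i\<close>, which
    may therefore be set to the legal strategy 0.\<close>
  have "view n k f i = view n k (f(i := 0)) i" by (auto simp: view_def intro!: arg_cong[of _ _ card])
  moreover have "(f(i := 0)) j < k" if "j < n" for j using f' that \<open>0 < k\<close> by simp
  ultimately show "y \<in> partitions k (n - 1)" using f(2) view_in_partitions[of n "f(i := 0)" k i] \<open>i < n\<close> by simp
qed

lemma expected_payoff_bounds:
  assumes game: "anonymous_game n k u" and prof: "mixed_profile n k s" and "i < n" "a < k"
  shows "0 \<le> measure_pmf.expectation (others n k s i) (u i a)"
    "measure_pmf.expectation (others n k s i) (u i a) \<le> 1"
proof -
  have *: "0 \<le> u i a y \<and> u i a y \<le> 1" if "y \<in> set_pmf (others n k s i)" for y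
    using game \<open>i < n\<close> \<open>a < k\<close> set_others[OF prof \<open>i < n\<close>] that by (auto simp: anonymous_game_def)
  have int: "integrable (measure_pmf (others n k s i)) (u i a)"
    by (rule integrable_measure_pmf_finite[OF finite_others[OF prof]])
  show "0 \<le> measure_pmf.expectation (others n k s i) (u i a)"
    using * by (intro integral_nonneg_AE) (auto simp: AE_measure_pmf_iff)
  show "measure_pmf.expectation (others n k s i) (u i a) \<le> 1"
    using * by (intro measure_pmf.integral_le_const int) (auto simp: AE_measure_pmf_iff)
qed

lemma approx_nash_trivial:
  assumes game: "anonymous_game n k u" and prof: "mixed_profile n k s" and "1 \<le> \<epsilon>"
  shows "approx_nash n k u \<epsilon> s"
  unfolding approx_nash_def
proof (intro conjI allI impI)
  fix i b assume "i < n" "b < k"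
  have "measure_pmf.expectation (pair_pmf (others n k s i) (s i)) (\<lambda>(x, a). u i a x) =
      (\<Sum>a<k. pmf (s i) a * measure_pmf.expectation (others n k s i) (u i a))"
    using expectation_pair[OF finite_others[OF prof, of i], of "s i" k "\<lambda>x a. u i a x"] prof \<open>i < n\<close>
    by (simp add: mixed_profile_def)
  also have "0 \<le> \<dots>"
    using expected_payoff_bounds(1)[OF game prof \<open>i < n\<close>] by (intro sum_nonneg) auto
  finally show "measure_pmf.expectation (others n k s i) (u i b)
      \<le> measure_pmf.expectation (pair_pmf (others n k s i) (s i)) (\<lambda>(x, a). u i a x) + \<epsilon>"
    using expected_payoff_bounds(2)[OF game prof \<open>i < n\<close> \<open>b < k\<close>] \<open>1 \<le> \<epsilon>\<close> by linarith
qed (rule prof)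

text \<open>The error budget. \<open>\<eta>\<close> is the regret at \<open>x\<close>; replacing
  \<open>x\<close> by the actual view shifts each of the two payoffs compared by at most
  \<open>2 * l * k * K\<close>; and playing \<open>p i\<close> with probability at least
  \<open>1 - \<delta>\<close> only loses at most \<open>\<delta>\<close>, since payoffs lie between
  0 and 1.\<close>

lemma approx_nash_of_search:
  assumes game: "anonymous_game n k u" and p: "\<And>i. i < n \<Longrightarrow> p i < k"
    and \<kappa>: "\<And>a. a < k \<Longrightarrow> stoch k (\<kappa> a)" "\<And>a. a < k \<Longrightarrow> 1 - \<delta> \<le> \<kappa> a a"
    and s: "\<And>j. j < n \<Longrightarrow> set_pmf (s j) \<subseteq> {..<k} \<and> (\<forall>c<k. pmf (s j) c = \<kappa> (p j) c)"
    and lip: "\<And>i a x y. i < n \<Longrightarrow> a < k \<Longrightarrow> x \<in> partitions k (n - 1) \<Longrightarrow> y \<in> partitions k (n - 1) \<Longrightarrow>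
      \<bar>val k \<kappa> (u i a) x - val k \<kappa> (u i a) y\<bar> \<le> l * (\<Sum>c<k. \<bar>real (x ! c) - real (y ! c)\<bar>)"
    and x: "x \<in> partitions k (n - 1)"
    and ok: "\<And>i b. i < n \<Longrightarrow> b < k \<Longrightarrow> val k \<kappa> (u i b) x - \<eta> \<le> val k \<kappa> (u i (p i)) x"
    and e: "\<And>a. a < k \<Longrightarrow> excess {..<n} ((!) x) p a \<le> int K"
    and "0 \<le> l" "0 \<le> \<delta>" "\<eta> + 4 * l * real k * real K + \<delta> \<le> \<epsilon>"
  shows "approx_nash n k u \<epsilon> s"
  unfolding approx_nash_def
proof (intro conjI allI impI)
  show "mixed_profile n k s" using s by (simp add: mixed_profile_def)
  fix i b assume "i < n" "b < k"
  let ?z = "view n k p i"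
  define F where "F a = measure_pmf.expectation (others n k s i) (u i a)" for a
  have Fv: "F a = val k \<kappa> (u i a) ?z" for a
    unfolding F_def using p \<open>i < n\<close> s by (intro others_expectation) auto
  have prof: "mixed_profile n k s" using s by (simp add: mixed_profile_def)
  note fin' = finite_others[OF prof, of i]
  have F01: "0 \<le> F a" "F a \<le> 1" if "a < k" for a
    unfolding F_def using expected_payoff_bounds[OF game prof \<open>i < n\<close> that] by auto
  have zx: "l * (\<Sum>c<k. \<bar>real (?z ! c) - real (x ! c)\<bar>) \<le> l * (2 * real k * real K)"
    using view_distance[OF p \<open>i < n\<close> x e] \<open>0 \<le> l\<close> by (intro mult_left_mono) auto
  have zp: "?z \<in> partitions k (n - 1)" using p \<open>i < n\<close> by (rule view_in_partitions)
  note close = order_trans[OF lip[OF \<open>i < n\<close> _ zp x] zx]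
  have "F b - \<eta> - 4 * l * real k * real K \<le> F (p i)"
    using close[OF \<open>b < k\<close>] close[OF p[OF \<open>i < n\<close>]] ok[OF \<open>i < n\<close> \<open>b < k\<close>] unfolding Fv by (simp add: abs_le_iff)
  moreover have "F (p i) - \<delta> \<le> (\<Sum>a<k. pmf (s i) a * F a)"
  proof -
    have pi: "p i < k" using p \<open>i < n\<close> .
    have "(1 - \<delta>) * F (p i) \<le> pmf (s i) (p i) * F (p i)"
      using \<kappa>(2)[OF pi] s[OF \<open>i < n\<close>] pi F01[OF pi] by (intro mult_right_mono) auto
    also have "\<dots> \<le> (\<Sum>a<k. pmf (s i) a * F a)"
      using pi F01 by (intro member_le_sum) auto
    finally have "F (p i) - \<delta> * F (p i) \<le> (\<Sum>a<k. pmf (s i) a * F a)" by (simp add: algebra_simps)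
    moreover have "\<delta> * F (p i) \<le> \<delta> * 1" using F01[OF pi] \<open>0 \<le> \<delta>\<close> by (intro mult_left_mono) auto
    ultimately show ?thesis by simp
  qed
  moreover have "measure_pmf.expectation (pair_pmf (others n k s i) (s i)) (\<lambda>(x, a). u i a x) =
      (\<Sum>a<k. pmf (s i) a * F a)"
    unfolding F_def using expectation_pair[OF fin', of "s i" k "\<lambda>x a. u i a x"] s[OF \<open>i < n\<close>] by simp
  ultimately show "measure_pmf.expectation (others n k s i) (u i b)
      \<le> measure_pmf.expectation (pair_pmf (others n k s i) (s i)) (\<lambda>(x, a). u i a x) + \<epsilon>"
    using \<open>\<eta> + 4 * l * real k * real K + \<delta> \<le> \<epsilon>\<close> by (simp add: F_def)
qed

definition admissible ::
    "nat \<Rightarrow> (nat \<Rightarrow> nat \<Rightarrow> nat list \<Rightarrow> real) \<Rightarrow> real \<Rightarrow> nat list \<Rightarrow> nat \<Rightarrow> nat \<Rightarrow> bool" where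
  "admissible k v \<eta> x i a \<longleftrightarrow> (\<forall>b<k. v i b x - \<eta> \<le> v i a x)"

section \<open>Trembles of probability about n^(-1/3)\<close>

locale noisy_game =
  fixes n k r :: nat and u :: "nat \<Rightarrow> nat \<Rightarrow> nat list \<Rightarrow> real"
  assumes k: "1 \<le> k" and n_large: "64 * k ^ 11 < n" and r_ge: "n \<le> r ^ 3" and r_less: "(r - 1) ^ 3 < n"
    and game: "anonymous_game n k u"
begin

definition t :: real where "t = 1 / real r"

definition v :: "nat \<Rightarrow> nat \<Rightarrow> nat list \<Rightarrow> real" where "v i a = smooth t k k (u i a)"

abbreviation ok :: "nat list \<Rightarrow> nat \<Rightarrow> nat \<Rightarrow> bool" where
  "ok \<equiv> admissible k v (21 * real k * t)"

text \<open>The 64 of the threshold is 4^3. The conclusion becomes \<open>4 * k * t \<le> 1\<close>,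
  the hypothesis of \<open>kernel_bounds\<close>.\<close>

lemma r_gt: "4 * k < r"
proof (rule ccontr)
  assume "\<not> 4 * k < r"
  then have "r ^ 3 \<le> (4 * k) ^ 3" by (intro power_mono) auto
  also have "\<dots> = 64 * k ^ 3" by (simp add: power_mult_distrib)
  also have "\<dots> \<le> 64 * k ^ 11" using k by (intro mult_left_mono power_increasing) auto
  finally show False using n_large r_ge by simp
qed

lemma t_props: "0 < t" "4 * real k * t \<le> 1" "t \<le> 1"
  using r_gt k by (auto simp: t_def field_simps)

lemma stoch_noise: "a < k \<Longrightarrow> stoch k (kernel t k k a)"
  using t_props by (intro stoch_kernel) auto

lemma v_eq_val: "length x = k \<Longrightarrow> v i a x = val k (kernel t k k) (u i a) x"
  by (simp add: v_def smooth_eq_val)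

text \<open>Taking \<open>s = t\<close> and \<open>q = t / 2\<close> in \<open>val_move_diff\<close>
  gives \<open>t + r ^ 2 / (n - 1)\<close>. As \<open>r - 1\<close> is below the cube root of
  \<open>n\<close> and \<open>r\<close> is at least 5, the cube of 5/4 being below 2 yields
  \<open>r ^ 3 \<le> 2 * (n - 1)\<close>, and the second term is at most
  \<open>2 * t\<close>.\<close>

lemma v_lipschitz:
  assumes "i < n" "a < k" "x \<in> partitions k (n - 1)" "y \<in> partitions k (n - 1)"
  shows "\<bar>val k (kernel t k k) (u i a) x - val k (kernel t k k) (u i a) y\<bar>
    \<le> 3 * t * (\<Sum>c<k. \<bar>real (x ! c) - real (y ! c)\<bar>)"
proof (rule lipschitz_of_move[OF _ assms(3,4)])
  fix x b c assume x: "x \<in> partitions k (n - 1)" and bc: "b < k" "c < k" "0 < x ! b"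
  have "\<bar>val k (kernel t k k) (u i a) x - val k (kernel t k k) (u i a) (move b c 1 x)\<bar>
      \<le> t + 1 / (t * (real (n - 1) * (2 * (t / 2))))"
  proof (rule val_move_diff[OF stoch_noise _ _ _ _ _ x bc])
    show "t / 2 \<le> kernel t k k p d" if "p < k" "d < k" for p d
      using kernel_bounds(2) t_props that by simp
    show "\<bar>u i a y\<bar> \<le> 1" if "y \<in> partitions k (n - 1)" for y
      using game assms(1,2) that by (force simp: anonymous_game_def)
  qed (use t_props in auto)
  also have "\<dots> \<le> 3 * t"
  proof -
    have r5: "5 \<le> r" using r_gt k by simp
    have n1: "(real r - 1) ^ 3 \<le> real (n - 1)"
    proof -
      have "(r - 1) ^ 3 \<le> n - 1" using r_less by simp
      then have "real ((r - 1) ^ 3) \<le> real (n - 1)" by (simp only: of_nat_le_iff)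
      then show ?thesis using r5 by (simp add: of_nat_diff)
    qed
    define z where "z = real r - 1"
    have z: "4 \<le> z" using r5 by (simp add: z_def)
    have "(z + 1) ^ 3 \<le> (z * (5/4)) ^ 3" using z by (intro power_mono) auto
    also have "\<dots> \<le> 2 * z ^ 3" using z by (simp add: power_mult_distrib power_divide)
    finally have "real r ^ 3 \<le> 2 * real (n - 1)" using n1 by (simp add: z_def)
    moreover have "0 < (real r - 1) ^ 3" using r5 by (intro zero_less_power) simp
    then have "0 < real (n - 1)" using n1 by linarith
    ultimately have le: "real r ^ 2 / real (n - 1) \<le> 2 / real r"
      using r5 by (simp add: field_simps power3_eq_cube power2_eq_square)
    have eq: "1 / (t * (real (n - 1) * (2 * (t / 2)))) = real r ^ 2 / real (n - 1)"
      using r5 by (simp add: t_def power2_eq_square)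
    have "real r ^ 2 / real (n - 1) \<le> 2 * t" using le by (simp add: t_def)
    then show ?thesis unfolding eq by simp
  qed
  finally show "\<bar>val k (kernel t k k) (u i a) x - val k (kernel t k k) (u i a) (move b c 1 x)\<bar> \<le> 3 * t" .
qed (use t_props in simp)

definition good :: "nat list \<Rightarrow> (nat \<Rightarrow> nat) \<Rightarrow> bool" where
  "good x p \<longleftrightarrow> (\<forall>i<n. p i < k \<and> ok x i (p i)) \<and> (\<forall>a<k. excess {..<n} ((!) x) p a \<le> int (k + 2))"

text \<open>The bound is stated for every settled assignment, since it is left open which one the
  local search reaches. The slack 2 is the rounding error of \<open>x\<close>, and 21 is 7 times the
  3 of the Lipschitz constant \<open>3 * t\<close>.\<close>

lemma feasible_exists:
  "\<exists>x\<in>partitions k (n - 1). \<forall>p. (\<forall>i<n. p i < k) \<longrightarrow> settled k {..<n} (ok x) ((!) x) p \<longrightarrow>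
     (\<forall>a<k. excess {..<n} ((!) x) p a \<le> int (k + 2))"
proof -
  have n: "n = Suc (n - 1)" using n_large by simp
  obtain x \<sigma> where x: "x \<in> partitions k (n - 1)"
    and s: "\<And>i a. a < k \<Longrightarrow> 0 \<le> \<sigma> i a" "\<And>i. (\<Sum>a<k. \<sigma> i a) = (1::real)"
      "\<And>a. a < k \<Longrightarrow> \<bar>(\<Sum>i\<le>n - 1. \<sigma> i a) - real (x ! a)\<bar> \<le> 2"
      "\<And>i a b. i \<le> n - 1 \<Longrightarrow> a < k \<Longrightarrow> b < k \<Longrightarrow> 0 < \<sigma> i a \<Longrightarrow>
         v i b x - 7 * real k * (3 * t) \<le> v i a x"
  proof (rule fractional_equilibrium_exists[of k "3 * t" "n - 1" v])
    fix i a x y assume *: "i \<le> n - 1" "a < k" "x \<in> partitions k (n - 1)" "y \<in> partitions k (n - 1)"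
    moreover have "length x = k" "length y = k" using * by (auto simp: partitions_def)
    ultimately show "\<bar>v i a x - v i a y\<bar> \<le> 3 * t * (\<Sum>c<k. \<bar>real (x ! c) - real (y ! c)\<bar>)"
      using v_lipschitz[of i a x y] n by (simp add: v_eq_val)
  qed (use t_props k in auto)
  show ?thesis
  proof (intro bexI[OF _ x] allI impI)
    fix p a assume p: "\<forall>i<n. p i < k" "settled k {..<n} (ok x) ((!) x) p" and "a < k"
    have "excess {..<n} ((!) x) p a \<le> int (2 + k)"
    proof (rule settled_excess_le[OF p(2) p(1)[rule_format] _ _ _ _ \<open>a < k\<close>])
      show "ok x i a" if "i < n" "a < k" "0 < \<sigma> i a" for i a
        using s(4)[of i a] that n by (auto simp: admissible_def mult.assoc mult.left_commute)
      show "(\<Sum>i<n. \<sigma> i a) \<le> real (x ! a + 2)" if "a < k" for a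
      proof -
        have "{..<n} = {..n - 1}" using n by auto
        then show ?thesis using s(3)[OF that] by simp
      qed
    qed (use s in auto)
    then show "excess {..<n} ((!) x) p a \<le> int (k + 2)" by simp
  qed
qed

lemma good_approx_nash:
  assumes "x \<in> partitions k (n - 1)" "good x p" and \<epsilon>: "58 * real k ^ 2 * t \<le> \<epsilon>"
  shows "\<exists>s. mixed_profile n k s \<and> (\<forall>i<n. \<forall>a<k. pmf (s i) a = kernel t k k (p i) a) \<and> approx_nash n k u \<epsilon> s"
proof -
  have p: "p i < k" if "i < n" for i using assms that by (simp add: good_def)
  have "\<exists>q :: nat pmf. set_pmf q \<subseteq> {..<k} \<and> (\<forall>c<k. pmf q c = kernel t k k (p j) c)" if "j < n" for j
    using stoch_pmf_exists[OF stoch_noise[OF p[OF that]]] by metis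
  then obtain s :: "nat \<Rightarrow> nat pmf"
    where s: "\<And>j. j < n \<Longrightarrow> set_pmf (s j) \<subseteq> {..<k} \<and> (\<forall>c<k. pmf (s j) c = kernel t k k (p j) c)"
    by metis
  show ?thesis
  proof (intro exI conjI allI impI)
    show "mixed_profile n k s" using s by (simp add: mixed_profile_def)
    show "pmf (s i) a = kernel t k k (p i) a" if "i < n" "a < k" for i a using s that by simp
    have len: "length x = k" using assms(1) by (simp add: partitions_def)
    show "approx_nash n k u \<epsilon> s"
    proof (rule approx_nash_of_search[OF game p stoch_noise _ s v_lipschitz assms(1),
          where \<delta> = "real k * t" and \<eta> = "21 * real k * t" and K = "k + 2"])
      show "1 - real k * t \<le> kernel t k k a a" if "a < k" for a
        using kernel_bounds(1) t_props that by simp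
      show "val k (kernel t k k) (u i b) x - 21 * real k * t \<le> val k (kernel t k k) (u i (p i)) x"
        if "i < n" "b < k" for i b
        using assms(2) that len by (auto simp: good_def admissible_def v_eq_val)
      show "excess {..<n} ((!) x) p a \<le> int (k + 2)" if "a < k" for a using assms(2) that by (simp add: good_def)
      \<comment> \<open>The linear terms are 21 from the regret, 24 from
        \<open>12 * k * (k + 2)\<close> and 1 from the tremble, together 46; with the quadratic 12
        they make 58.\<close>
      have "real k * 1 \<le> real k * real k" using k by (intro mult_left_mono) auto
      then have "t * (46 * real k + 12 * real k ^ 2) \<le> t * (58 * real k ^ 2)"
        using t_props by (intro mult_left_mono) (auto simp: power2_eq_square)
      then show "21 * real k * t + 4 * (3 * t) * real k * real (k + 2) + real k * t \<le> \<epsilon>"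
        using \<epsilon> by (simp add: algebra_simps power2_eq_square)
    qed (use t_props in auto)
  qed
qed

end

section \<open>Coding count vectors\<close>

text \<open>The leading entry is the most significant digit, so that the numerical order of the codes is the
  lexicographic order of the input.\<close>

primrec code :: "nat \<Rightarrow> nat list \<Rightarrow> nat" where
  "code n [] = 0"
| "code n (x # xs) = x * n ^ length xs + code n xs"

fun digit_sum :: "nat \<Rightarrow> nat \<Rightarrow> nat" where
  "digit_sum n c = (if n < 2 \<or> c = 0 then 0 else digit_sum n (c div n) + c mod n)"

declare digit_sum.simps [simp del]

lemma digit_sum_eq: "2 \<le> n \<Longrightarrow> digit_sum n c = digit_sum n (c div n) + c mod n"
  by (cases "c = 0") (simp_all add: digit_sum.simps[of n c] digit_sum.simps[of n 0])

lemma digit_sum_less: "2 \<le> n \<Longrightarrow> c < n \<Longrightarrow> digit_sum n c = c"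
  using digit_sum_eq[of n c] by (simp add: digit_sum.simps[of n 0])

lemma digit_sum_lead:
  assumes "2 \<le> n" "j < n" "c < n ^ k"
  shows "digit_sum n (j * n ^ k + c) = j + digit_sum n c"
  using assms(3)
proof (induction k arbitrary: c)
  case 0
  then show ?case using assms by (simp add: digit_sum_less)
next
  case (Suc k)
  have "j * n ^ Suc k + c = j * n ^ k * n + c" by simp
  then have "(j * n ^ Suc k + c) div n = j * n ^ k + c div n" "(j * n ^ Suc k + c) mod n = c mod n"
    using assms by (simp_all only: div_mult_self3 mod_mult_self3)
  moreover have "c div n < n ^ k" using Suc.prems assms by (simp add: less_mult_imp_div_less mult.commute)
  ultimately show ?case
    using Suc.IH digit_sum_eq[OF \<open>2 \<le> n\<close>, of "j * n ^ Suc k + c"] digit_sum_eq[OF \<open>2 \<le> n\<close>, of c] by simp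
qed

lemma filter_blocks:
  fixes B :: nat
  shows "filter P [0..<l * B] = concat (map (\<lambda>j. map ((+) (j * B)) (filter (\<lambda>c. P (j * B + c)) [0..<B])) [0..<l])"
proof (induction l)
  case (Suc l)
  have "[0..<Suc l * B] = [0..<l * B] @ [l * B..<B + l * B]"
    using upt_add_eq_append[of 0 "l * B" B] by (simp add: add.commute)
  also have "[l * B..<B + l * B] = map (\<lambda>i. i + l * B) [0..<B]" by (rule map_add_upt[symmetric])
  also have "(\<lambda>i. i + l * B) = (+) (l * B)" by auto
  finally have "[0..<Suc l * B] = [0..<l * B] @ map ((+) (l * B)) [0..<B]" .
  then show ?case using Suc by (simp add: filter_map comp_def)
qed simp

text \<open>Entries are at most \<open>m < n\<close>, hence digits in base \<open>n\<close>. Running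
  through all codes below \<open>n ^ k\<close> and keeping those with digit sum \<open>m\<close>
  therefore produces the count vectors in input order. Leading digits above \<open>m\<close>
  contribute nothing, so the recursion over \<open>0..m\<close> extends to all \<open>n\<close>
  blocks.\<close>

lemma map_code_partition_list:
  assumes "2 \<le> n" "m < n"
  shows "map (code n) (partition_list k m) = filter (\<lambda>c. digit_sum n c = m) [0..<n ^ k]"
  using \<open>m < n\<close>
proof (induction k arbitrary: m)
  case 0
  then show ?case using digit_sum_less[OF \<open>2 \<le> n\<close>, of 0] by auto
next
  case (Suc k)
  have len: "length xs = k" if "xs \<in> set (partition_list k m)" for xs m
    using that by (simp add: set_partition_list partitions_def)
  have "map (code n) (partition_list (Suc k) m) =
      concat (map (\<lambda>j. map ((+) (j * n ^ k)) (map (code n) (partition_list k (m - j)))) [0..<Suc m])"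
    unfolding partition_list.simps map_concat map_map
    by (intro arg_cong[of _ _ concat] map_cong) (auto simp: comp_def len)
  also have "\<dots> = concat (map (\<lambda>j. map ((+) (j * n ^ k)) (filter (\<lambda>c. digit_sum n (j * n ^ k + c) = m) [0..<n ^ k])) [0..<Suc m])"
  proof (rule arg_cong[of _ _ concat], rule map_cong[OF refl])
    fix j assume "j \<in> set [0..<Suc m]"
    then have j: "j \<le> m" by auto
    have "map (code n) (partition_list k (m - j)) = filter (\<lambda>c. digit_sum n c = m - j) [0..<n ^ k]"
      using Suc.prems by (intro Suc.IH) simp
    also have "\<dots> = filter (\<lambda>c. digit_sum n (j * n ^ k + c) = m) [0..<n ^ k]"
      using j Suc.prems \<open>2 \<le> n\<close> by (intro filter_cong) (auto simp: digit_sum_lead)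
    finally show "map ((+) (j * n ^ k)) (map (code n) (partition_list k (m - j))) =
        map ((+) (j * n ^ k)) (filter (\<lambda>c. digit_sum n (j * n ^ k + c) = m) [0..<n ^ k])" by simp
  qed
  also have "\<dots> = concat (map (\<lambda>j. map ((+) (j * n ^ k)) (filter (\<lambda>c. digit_sum n (j * n ^ k + c) = m) [0..<n ^ k])) [0..<n])"
  proof -
    have "[0..<n] = [0..<Suc m] @ [Suc m..<n]" using Suc.prems upt_add_eq_append[of 0 "Suc m" "n - Suc m"] by simp
    moreover have "filter (\<lambda>c. digit_sum n (j * n ^ k + c) = m) [0..<n ^ k] = []" if "j \<in> set [Suc m..<n]" for j
      using that \<open>2 \<le> n\<close> by (auto simp: filter_empty_conv digit_sum_lead)
    then have "concat (map (\<lambda>j. map ((+) (j * n ^ k)) (filter (\<lambda>c. digit_sum n (j * n ^ k + c) = m) [0..<n ^ k])) [Suc m..<n]) = []"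
      by simp
    ultimately show ?thesis by (simp only: map_append concat_append append_Nil2)
  qed
  also have "\<dots> = filter (\<lambda>c. digit_sum n c = m) [0..<n ^ Suc k]"
    by (simp add: filter_blocks)
  finally show ?case .
qed

lemma code_less: "(\<forall>x\<in>set xs. x < n) \<Longrightarrow> code n xs < n ^ length xs"
proof (induction xs)
  case (Cons x xs)
  then have "Suc x * n ^ length xs \<le> n * n ^ length xs" by (intro mult_le_mono1) auto
  then show ?case using Cons by simp
qed simp

lemma code_digit:
  "(\<forall>x\<in>set xs. x < n) \<Longrightarrow> a < length xs \<Longrightarrow> code n xs div n ^ (length xs - 1 - a) mod n = xs ! a"
proof (induction xs arbitrary: a)
  case (Cons x xs)
  have n: "0 < n" using Cons.prems by auto
  show ?case
  proof (cases a)
    case 0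
    then show ?thesis using Cons.prems code_less[of xs n] n by simp
  next
    case (Suc b)
    let ?q = "length xs - 1 - b"
    have "length xs = Suc b + ?q" using Cons.prems Suc by simp
    then have "n ^ length xs = n * n ^ b * n ^ ?q" by (metis power_Suc power_add)
    then have "(x * n ^ length xs + code n xs) div n ^ ?q = x * n ^ b * n + code n xs div n ^ ?q"
      using n by (simp add: div_mult_self3[symmetric] mult_ac) 
    then show ?thesis using Cons Suc by simp
  qed
qed simp

lemma code_update:
  "a < length xs \<Longrightarrow> code n (xs[a := y]) + xs ! a * n ^ (length xs - 1 - a) = code n xs + y * n ^ (length xs - 1 - a)"
proof (induction xs arbitrary: a)
  case (Cons x xs)
  show ?case
  proof (cases a)
    case (Suc b)
    then show ?thesis using Cons.IH[of b] Cons.prems by simp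
  qed simp
qed simp

text \<open>Adding before subtracting keeps truncated subtraction exact. Consecutive values of
  \<open>j\<close> differ by a fixed shift of the code, so the program follows the moves at constant
  cost each.\<close>

lemma code_move:
  assumes "a < length x" "b < length x" "j \<le> x ! a"
  shows "code n (move a b j x) = code n x + j * n ^ (length x - 1 - b) - j * n ^ (length x - 1 - a)"
    "j * n ^ (length x - 1 - a) \<le> code n x"
proof -
  have 1: "code n (x[a := x ! a - j]) + j * n ^ (length x - 1 - a) = code n x"
    using code_update[OF assms(1), of n "x ! a - j"] add_mult_distrib[of "x ! a - j" j "n ^ (length x - 1 - a)"] assms(3)
    by simp
  show "j * n ^ (length x - 1 - a) \<le> code n x" unfolding 1[symmetric] by simp
  have "code n (move a b j x) = code n (x[a := x ! a - j]) + j * n ^ (length x - 1 - b)"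
    using code_update[of b "x[a := x ! a - j]" n "x[a := x ! a - j] ! b + j"] assms(2)
    by (simp add: move_def Let_def distrib_right)
  then show "code n (move a b j x) = code n x + j * n ^ (length x - 1 - b) - j * n ^ (length x - 1 - a)"
    using 1 by simp
qed

lemma partition_entry_le: "x \<in> partitions k m \<Longrightarrow> c \<in> set x \<Longrightarrow> c \<le> m"
  using member_le_sum_list[of c x] by (simp add: partitions_def)

section \<open>The number of count vectors\<close>

lemma distinct_partition_list: "2 \<le> n \<Longrightarrow> m < n \<Longrightarrow> distinct (map (code n) (partition_list k m))"
  by (simp add: map_code_partition_list)

lemma length_partition_list: "length (partition_list k m) = (m + k - 1) choose m"
proof -
  have "distinct (map (code (m + 2)) (partition_list k m))" by (rule distinct_partition_list) auto
  then have "distinct (partition_list k m)" by (simp add: distinct_map)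
  then have "length (partition_list k m) = card (partitions k m)"
    by (simp add: distinct_card flip: set_partition_list)
  then show ?thesis by (simp add: partitions_def card_length_sum_list)
qed

lemma square_le_fact: "k ^ 2 \<le> 5 * fact (k - 1)" if "1 \<le> k" for k :: nat
proof -
  have "Suc m ^ 2 \<le> 5 * fact m" for m
  proof (induction m)
    case (Suc m)
    show ?case
    proof (cases "m \<le> 2")
      case True
      then have "m = 0 \<or> m = 1 \<or> m = 2" by auto
      then show ?thesis by (auto simp: power2_eq_square fact_numeral eval_nat_numeral)
    next
      case False
      have "Suc (Suc m) ^ 2 \<le> Suc m * Suc m ^ 2"
      proof -
        have "Suc (Suc m) ^ 2 \<le> (2 * Suc m) * (2 * Suc m)" unfolding power2_eq_square by (intro mult_le_mono) auto
        also have "\<dots> = 4 * Suc m ^ 2" by (simp add: power2_eq_square)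
        also have "\<dots> \<le> Suc m * Suc m ^ 2" using False by (intro mult_le_mono) auto
        finally show ?thesis .
      qed
      also have "\<dots> \<le> Suc m * (5 * fact m)" using Suc by (intro mult_le_mono) auto
      finally show ?thesis by simp
    qed
  qed simp
  from this[of "k - 1"] show ?thesis using that by simp
qed

text \<open>The number is a binomial coefficient, so its product with \<open>fact (k - 1)\<close> is
  at most (n + k)^(k - 1). Relative to n^(k - 1) this is at most exp (k (k - 1) / n), hence at most
  e, because \<open>k ^ 2 \<le> n\<close>. The 15 is 3 times the 5 of
  \<open>square_le_fact\<close>.\<close>

lemma length_partition_list_le:
  assumes "1 \<le> k" "k ^ 2 \<le> n"
  shows "k ^ 2 * length (partition_list k (n - 1)) \<le> 15 * n ^ (k - 1)"
proof -
  let ?N = "length (partition_list k (n - 1))"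
  have n: "1 \<le> n" using assms by (cases n) auto
  have "?N = (n + k - 2) choose (k - 1)"
    unfolding length_partition_list using n assms(1) by (subst binomial_symmetric) (auto simp: numeral_2_eq_2)
  then have "?N * fact (k - 1) \<le> (n + k - 2) ^ (k - 1)" by (simp add: binomial_fact_pow)
  also have "\<dots> \<le> (n + k) ^ (k - 1)" by (intro power_mono) auto
  also have "real \<dots> \<le> 3 * real n ^ (k - 1)"
  proof -
    have "(1 + real k / real n) ^ (k - 1) \<le> exp (real k / real n) ^ (k - 1)"
      by (intro power_mono exp_ge_add_one_self) auto
    also have "\<dots> = exp (real (k - 1) * (real k / real n))" by (simp only: exp_of_nat_mult)
    also have "\<dots> \<le> exp 1"
    proof -
      have "real (k - 1) * real k \<le> real n"
      proof -
        have "(k - 1) * k \<le> k ^ 2" by (simp add: power2_eq_square)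
        then have "(k - 1) * k \<le> n" using assms by linarith
        then show ?thesis by (metis of_nat_le_iff of_nat_mult)
      qed
      then show ?thesis using n by (simp add: field_simps)
    qed
    also have "\<dots> \<le> 3" by (rule exp_le)
    finally have "(1 + real k / real n) ^ (k - 1) * real n ^ (k - 1) \<le> 3 * real n ^ (k - 1)"
      by (intro mult_right_mono) auto
    moreover have "(1 + real k / real n) * real n = real (n + k)" using n by (simp add: field_simps)
    ultimately show ?thesis by (simp flip: power_mult_distrib)
  qed
  finally have "real (?N * fact (k - 1)) \<le> real (3 * n ^ (k - 1))" by simp
  then have N: "?N * fact (k - 1) \<le> 3 * n ^ (k - 1)" by (simp only: of_nat_le_iff)
  have "k ^ 2 * ?N \<le> 5 * fact (k - 1) * ?N" using square_le_fact[OF assms(1)] by (rule mult_le_mono1)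
  also have "\<dots> = 5 * (?N * fact (k - 1))" by (simp only: mult_ac)
  also have "\<dots> \<le> 5 * (3 * n ^ (k - 1))" using N by (rule mult_le_mono2)
  finally show ?thesis by simp
qed

section \<open>Program logic\<close>

text \<open>Total correctness with the running time as an argument of the postcondition. As
  \<open>exec\<close> is deterministic, some run meeting the postcondition is the only run.\<close>

definition wp :: "com \<Rightarrow> memory \<Rightarrow> (nat \<Rightarrow> memory \<Rightarrow> bool) \<Rightarrow> bool" where
  "wp c m Q \<longleftrightarrow> (\<exists>t m'. exec c m t m' \<and> Q t m')"

inductive_cases exec_NStoreE: "exec (NStore A e f) m t m'"
inductive_cases exec_RStoreE: "exec (RStore A e f) m t m'"
inductive_cases exec_SeqE: "exec (Seq c d) m t m'"
inductive_cases exec_CondE: "exec (Cond b c d) m t m'"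
inductive_cases exec_SkipE: "exec Skip m t m'"

lemma wp_Skip [simp]: "wp Skip m Q \<longleftrightarrow> Q 1 m"
  unfolding wp_def by (metis exec.Skip exec_SkipE)

lemma wp_NStore [simp]: "wp (NStore A e f) m Q \<longleftrightarrow> Q 1 (nstore A (nval e m) (nval f m) m)"
  unfolding wp_def by (metis exec.NStore exec_NStoreE)

lemma wp_RStore [simp]: "wp (RStore A e f) m Q \<longleftrightarrow> Q 1 (rstore A (nval e m) (rval f m) m)"
  unfolding wp_def by (metis exec.RStore exec_RStoreE)

lemma wp_Seq [simp]: "wp (Seq c d) m Q \<longleftrightarrow> wp c m (\<lambda>t m'. wp d m' (\<lambda>t' m''. Q (t + t') m''))"
  unfolding wp_def by (blast elim: exec_SeqE intro: exec.Seq)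

lemma wp_Cond [simp]:
  "wp (Cond b c d) m Q \<longleftrightarrow>
     (bval b m \<longrightarrow> wp c m (\<lambda>t. Q (Suc t))) \<and> (\<not> bval b m \<longrightarrow> wp d m (\<lambda>t. Q (Suc t)))"
  unfolding wp_def by (metis exec.CondTrue exec.CondFalse exec_CondE plus_1_eq_Suc)

lemma wp_mono: "wp c m Q \<Longrightarrow> (\<And>t m'. Q t m' \<Longrightarrow> Q' t m') \<Longrightarrow> wp c m Q'"
  unfolding wp_def by blast

lemma nats_nstore [simp]:
  "nats (nstore A j v m) B i = (if A = B \<and> i = j then v else nats m B i)"
  by (simp add: nstore_def)

lemma nats_rstore [simp]: "nats (rstore A j v m) = nats m"
  by (simp add: rstore_def)

lemma reals_nstore [simp]: "reals (nstore A j v m) = reals m"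
  by (simp add: nstore_def)

lemma reals_rstore [simp]:
  "reals (rstore A j v m) B i = (if A = B \<and> i = j then v else reals m B i)"
  by (simp add: rstore_def)

primrec nwrites :: "com \<Rightarrow> nat set" where
  "nwrites Skip = {}"
| "nwrites (NStore A e f) = {A}"
| "nwrites (RStore A e f) = {}"
| "nwrites (Seq c d) = nwrites c \<union> nwrites d"
| "nwrites (Cond b c d) = nwrites c \<union> nwrites d"
| "nwrites (While b c) = nwrites c"

primrec rwrites :: "com \<Rightarrow> nat set" where
  "rwrites Skip = {}"
| "rwrites (NStore A e f) = {}"
| "rwrites (RStore A e f) = {A}"
| "rwrites (Seq c d) = rwrites c \<union> rwrites d"
| "rwrites (Cond b c d) = rwrites c \<union> rwrites d"
| "rwrites (While b c) = rwrites c"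

definition agree :: "nat set \<Rightarrow> nat set \<Rightarrow> memory \<Rightarrow> memory \<Rightarrow> bool" where
  "agree N R m m' \<longleftrightarrow> (\<forall>A. A \<notin> N \<longrightarrow> nats m' A = nats m A) \<and> (\<forall>A. A \<notin> R \<longrightarrow> reals m' A = reals m A)"

lemma agreeD:
  "agree N R m m' \<Longrightarrow> A \<notin> N \<Longrightarrow> nats m' A = nats m A"
  "agree N R m m' \<Longrightarrow> A \<notin> R \<Longrightarrow> reals m' A = reals m A"
  by (simp_all add: agree_def)

lemma exec_agree: "exec c m t m' \<Longrightarrow> agree (nwrites c) (rwrites c) m m'"
proof (induction rule: exec.induct)
  case (NStore A e f m)
  then show ?case by (auto simp: agree_def fun_eq_iff)
next
  case (RStore A e f m)
  then show ?case by (auto simp: agree_def fun_eq_iff)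
qed (auto simp: agree_def)

lemma wp_agree: "wp c m Q \<Longrightarrow> wp c m (\<lambda>t m'. agree (nwrites c) (rwrites c) m m' \<and> Q t m')"
  unfolding wp_def using exec_agree by blast

text \<open>The bound \<open>e\<close> is evaluated again at every test, so the rule for this loop
  asks that the writes of the body leave its value unchanged.\<close>

definition For :: "nat \<Rightarrow> nexp \<Rightarrow> com \<Rightarrow> com" where
  "For A e c = Seq (NStore A (NConst 0) (NConst 0))
     (While (NLess (NLoad A (NConst 0)) e)
       (Seq c (NStore A (NConst 0) (NAdd (NLoad A (NConst 0)) (NConst 1)))))"

lemma writes_For [simp]:
  "nwrites (For A e c) = insert A (nwrites c)" "rwrites (For A e c) = rwrites c"
  by (auto simp: For_def)

lemma wp_While_count:
  assumes "\<And>j m'. j \<le> K \<Longrightarrow> I j m' \<Longrightarrow> bval b m' \<longleftrightarrow> j < K"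
    and "\<And>j m'. j < K \<Longrightarrow> I j m' \<Longrightarrow> wp c m' (\<lambda>t m''. t \<le> B \<and> I (Suc j) m'')"
    and "I j m" "j \<le> K"
  shows "wp (While b c) m (\<lambda>t m'. t \<le> (K - j) * (B + 1) + 1 \<and> I K m')"
  using assms(3,4)
proof (induction "K - j" arbitrary: j m)
  case 0
  then have "j = K" by simp
  then show ?case using assms(1)[of j m] 0 exec.WhileFalse[of b m c] unfolding wp_def by auto
next
  case (Suc d)
  then have "j < K" by simp
  obtain t m' where t: "exec c m t m'" "t \<le> B" "I (Suc j) m'"
    using assms(2)[OF \<open>j < K\<close> \<open>I j m\<close>] unfolding wp_def by blast
  have "wp (While b c) m' (\<lambda>t m'. t \<le> (K - Suc j) * (B + 1) + 1 \<and> I K m')"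
    using Suc t \<open>j < K\<close> by simp
  then obtain t' m'' where t': "exec (While b c) m' t' m''" "t' \<le> (K - Suc j) * (B + 1) + 1" "I K m''"
    unfolding wp_def by blast
  have "bval b m" using assms(1)[of j m] \<open>j < K\<close> Suc.prems by simp
  then have "exec (While b c) m (1 + t + t') m''" using t(1) t'(1) by (rule exec.WhileTrue)
  moreover have "K - j = Suc (K - Suc j)" using \<open>j < K\<close> by simp
  then have "1 + t + t' \<le> (K - j) * (B + 1) + 1" using t(2) t'(2) by simp
  ultimately show ?case unfolding wp_def using t'(3) by blast
qed

text \<open>The frame facts are supplied to the body for free, so an invariant only has to mention the
  arrays that the loop changes.\<close>

lemma wp_For:
  assumes A: "A \<notin> nwrites c"
    and e: "\<And>m'. agree (insert A (nwrites c)) (rwrites c) m m' \<Longrightarrow> nval e m' = K"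
    and init: "I 0 (nstore A 0 0 m)"
    and step: "\<And>j m'. j < K \<Longrightarrow> agree (insert A (nwrites c)) (rwrites c) m m' \<Longrightarrow> nats m' A 0 = j \<Longrightarrow>
       I j m' \<Longrightarrow> wp c m' (\<lambda>t m''. t \<le> B \<and> I (Suc j) (nstore A 0 (Suc j) m''))"
  shows "wp (For A e c) m (\<lambda>t m'. t \<le> K * (B + 2) + 2 \<and>
           agree (insert A (nwrites c)) (rwrites c) m m' \<and> I K m')"
proof -
  let ?N = "insert A (nwrites c)" and ?R = "rwrites c"
  let ?I = "\<lambda>j m'. agree ?N ?R m m' \<and> nats m' A 0 = j \<and> I j m'"
  have "wp (While (NLess (NLoad A (NConst 0)) e)
       (Seq c (NStore A (NConst 0) (NAdd (NLoad A (NConst 0)) (NConst 1))))) (nstore A 0 0 m)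
       (\<lambda>t m'. t \<le> (K - 0) * (Suc B + 1) + 1 \<and> ?I K m')"
  proof (rule wp_While_count)
    show "bval (NLess (NLoad A (NConst 0)) e) m' = (j < K)" if "?I j m'" for j m'
      using that e by simp
    show "?I 0 (nstore A 0 0 m)" using init by (auto simp: agree_def fun_eq_iff)
    fix j m' assume j: "j < K" and I: "?I j m'"
    have "wp c m' (\<lambda>t m''. agree (nwrites c) (rwrites c) m' m'' \<and> t \<le> B \<and> I (Suc j) (nstore A 0 (Suc j) m''))"
      using step[OF j] I by (intro wp_agree) blast
    then show "wp (Seq c (NStore A (NConst 0) (NAdd (NLoad A (NConst 0)) (NConst 1)))) m'
      (\<lambda>t m''. t \<le> Suc B \<and> ?I (Suc j) m'')"
      unfolding wp_Seq
    proof (rule wp_mono)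
      fix t m''
      assume *: "agree (nwrites c) (rwrites c) m' m'' \<and> t \<le> B \<and> I (Suc j) (nstore A 0 (Suc j) m'')"
      then have "nats m'' A 0 = j" using I A by (simp add: agree_def)
      moreover have "agree ?N ?R m (nstore A 0 (Suc j) m'')"
        using * I by (auto simp: agree_def fun_eq_iff)
      ultimately show "wp (NStore A (NConst 0) (NAdd (NLoad A (NConst 0)) (NConst 1))) m''
          (\<lambda>t' m'''. t + t' \<le> Suc B \<and> ?I (Suc j) m''')"
        using * by simp
    qed
  qed simp
  then show ?thesis unfolding For_def by (auto elim: wp_mono)
qed

abbreviation seq :: "com \<Rightarrow> com \<Rightarrow> com" (infixr ";;" 60) where
  "c ;; d \<equiv> Seq c d"

abbreviation var :: "nat \<Rightarrow> nexp" where "var A \<equiv> NLoad A (NConst 0)"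

abbreviation assign :: "nat \<Rightarrow> nexp \<Rightarrow> com" (infix "::=" 61) where
  "A ::= e \<equiv> NStore A (NConst 0) e"

abbreviation players :: nexp where "players \<equiv> NLoad 0 (NConst 0)"
abbreviation strategies :: nexp where "strategies \<equiv> NLoad 0 (NConst 1)"
abbreviation rconst :: "nat \<Rightarrow> rexp" where "rconst c \<equiv> ROfNat (NConst c)"
abbreviation theta :: rexp where "theta \<equiv> RLoad 6 (NConst 0)"

lemma wp_use:
  assumes "wp c m R" "\<And>t m'. agree (nwrites c) (rwrites c) m m' \<Longrightarrow> R t m' \<Longrightarrow> Q t m'"
  shows "wp c m Q"
  using wp_mono[OF wp_agree[OF assms(1)]] assms(2) by blast

lemma wp_For_use:
  assumes "A \<notin> nwrites c"
    and "\<And>m'. agree (insert A (nwrites c)) (rwrites c) m m' \<Longrightarrow> nval e m' = K"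
    and "I 0 (nstore A 0 0 m)"
    and "\<And>j m'. j < K \<Longrightarrow> agree (insert A (nwrites c)) (rwrites c) m m' \<Longrightarrow> nats m' A 0 = j \<Longrightarrow>
       I j m' \<Longrightarrow> wp c m' (\<lambda>t m''. t \<le> B \<and> I (Suc j) (nstore A 0 (Suc j) m''))"
    and "\<And>t m'. t \<le> K * (B + 2) + 2 \<Longrightarrow> agree (insert A (nwrites c)) (rwrites c) m m' \<Longrightarrow> I K m' \<Longrightarrow> Q t m'"
  shows "wp (For A e c) m Q"
  by (rule wp_mono[OF wp_For[OF assms(1-4)]]) (use assms(5) in auto)

section \<open>The program\<close>

text \<open>Arrays of naturals: \<open>2\<close>, \<open>3\<close>, \<open>4\<close> quotient by \<open>n\<close>, remainder by \<open>n\<close> and digit sum of a code;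
  \<open>5\<close> the codes of the count vectors in input order; \<open>41\<close> their entries, row by row; \<open>40\<close> the weights
  of the digits; \<open>7\<close> and \<open>28\<close> the multiples of \<open>n\<close> and of \<open>k\<close>; \<open>8\<close> the strategies of the players; \<open>9\<close> their
  counts; \<open>10\<close> the admissible pairs of a player and a strategy. Arrays of reals: \<open>2\<close>, \<open>3\<close> a payoff
  table indexed by codes; \<open>4\<close> binomial probabilities; \<open>5\<close> the kernel; \<open>6\<close> the tremble probability.
  All other arrays hold a single scalar; counters of loops start at \<open>30\<close>.\<close>

definition root_com :: com where
  "root_com =
     11 ::= NConst 0 ;;
     For 30 players
       (Cond (RLess (RMul (ROfNat (var 11)) (RMul (ROfNat (var 11)) (ROfNat (var 11)))) (ROfNat players))
         (11 ::= NAdd (var 11) (NConst 1)) Skip) ;;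
     RStore 6 (NConst 0) (RDiv (rconst 1) (ROfNat (var 11)))"

text \<open>The cube is compared in the reals, where multiplication exists. The candidate is
  increased only while its cube is below \<open>n\<close>, which gives minimality, and
  \<open>n\<close> rounds suffice because \<open>n \<le> n ^ 3\<close>.\<close>

lemma root_spec:
  assumes n: "nats m 0 0 = n" "2 \<le> n"
  shows "wp root_com m (\<lambda>t m'. t \<le> 4 * n + 4 \<and>
    (\<exists>r. n \<le> r ^ 3 \<and> (r - 1) ^ 3 < n \<and> reals m' 6 0 = 1 / real r))"
proof -
  define I where "I j m' \<longleftrightarrow> (nats m' 11 0 = 0 \<or> (nats m' 11 0 - 1) ^ 3 < n) \<and>
    (n \<le> nats m' 11 0 ^ 3 \<or> nats m' 11 0 = j)" for j and m' :: memory
  show ?thesis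
    unfolding root_com_def wp_Seq wp_NStore
  proof (rule wp_For_use[where K = n and B = 2 and I = I], goal_cases)
    case (2 m')
    then show ?case using n by (auto dest: agreeD(1)[where A = 0])
  next
    case 3
    show ?case by (simp add: I_def)
  next
    case (4 j m')
    have "nats m' 0 0 = n" using 4(2) n by (auto dest: agreeD(1)[where A = 0])
    moreover have "real (nats m' 11 0) * (real (nats m' 11 0) * real (nats m' 11 0)) < real n \<longleftrightarrow> nats m' 11 0 ^ 3 < n"
      by (simp add: power3_eq_cube mult.assoc flip: of_nat_mult)
    ultimately show ?case using 4(4) by (auto simp: I_def not_less)
  next
    case (5 t m')
    then have I: "I n m'" and t: "t \<le> n * 4 + 2" by auto
    have "n \<le> n ^ 3" using self_le_power[of n 3] n by simp
    then have "n \<le> nats m' 11 0 ^ 3" using I by (auto simp: I_def)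
    moreover have "(nats m' 11 0 - 1) ^ 3 < n" using I n by (auto simp: I_def)
    ultimately show ?case using t by (auto intro!: exI[of _ "nats m' 11 0"])
  qed simp
qed

text \<open>The inner loop multiplies by \<open>n\<close> through repeated addition. The power
  \<open>n ^ j\<close> goes to position \<open>k - 1 - j\<close>, as the leading entry of a count
  vector is its most significant digit.\<close>

definition powers_com :: com where
  "powers_com =
     12 ::= NConst 1 ;;
     For 30 strategies
       (NStore 40 (NSub (NSub strategies (NConst 1)) (var 30)) (var 12) ;;
        14 ::= NConst 0 ;;
        For 31 players (14 ::= NAdd (var 14) (var 12)) ;;
        12 ::= var 14)"

lemma powers_spec:
  assumes m: "nats m 0 0 = n" "nats m 0 1 = k"
  shows "wp powers_com m (\<lambda>t m'. t \<le> k * (3 * n + 8) + 3 \<and>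
    nats m' 12 0 = n ^ k \<and> (\<forall>a<k. nats m' 40 a = n ^ (k - 1 - a)))"
proof -
  define I where "I j m' \<longleftrightarrow> nats m' 12 0 = n ^ j \<and> (\<forall>a<k. k - 1 - a < j \<longrightarrow> nats m' 40 a = n ^ (k - 1 - a))"
    for j and m' :: memory
  show ?thesis
    unfolding powers_com_def wp_Seq wp_NStore
  proof (rule wp_For_use[where K = k and B = "3 * n + 6" and I = I], goal_cases)
    case (2 m')
    then show ?case using m by (auto dest: agreeD(1)[where A = 0])
  next
    case 3
    show ?case by (simp add: I_def)
  next
    case (4 j m')
    have a: "nats m' 0 0 = n" "nats m' 0 1 = k" using 4(2) m by (auto dest: agreeD(1)[where A = 0])
    show ?case
      unfolding wp_Seq wp_NStore
    proof (rule wp_For_use[where K = n and B = 1 and I = "\<lambda>j m''. nats m'' 14 0 = j * nats m' 12 0"], goal_cases)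
      case (2 m'')
      then show ?case using a by (auto dest: agreeD(1)[where A = 0])
    next
      case (4 i m'')
      then show ?case by (auto dest: agreeD(1)[where A = 12])
    next
      case (5 t m'')
      then have 14: "nats m'' 14 0 = n * n ^ j" "t \<le> n * 3 + 2" using \<open>I j m'\<close> by (auto simp: I_def)
      have 1: "nats m'' 40 = (nats m' 40)(k - 1 - j := n ^ j)"
        using 5 a \<open>I j m'\<close> \<open>nats m' 30 0 = j\<close> by (auto dest!: agreeD(1)[where A = 40] simp: I_def fun_eq_iff)
      show ?case
        using 14 \<open>I j m'\<close> \<open>j < k\<close> by (auto simp: I_def 1 less_Suc_eq)
    qed simp_all
  next
    case (5 t m')
    then show ?case by (auto simp: I_def algebra_simps)
  qed simp
qed


text \<open>Digits are read by following the quotient table from a code to its successive quotients,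
  which yields the last entry of the count vector first.\<close>

definition emit_com :: com where
  "emit_com =
     17 ::= var 30 ;;
     For 31 strategies
       (NStore 41 (NAdd (var 19) (NSub (NSub strategies (NConst 1)) (var 31))) (NLoad 3 (var 17)) ;;
        17 ::= NLoad 2 (var 17)) ;;
     NStore 5 (var 13) (var 30) ;;
     13 ::= NAdd (var 13) (NConst 1) ;;
     19 ::= NAdd (var 19) strategies"

text \<open>Quotient and remainder are advanced like a two-digit counter with carry, and the digit
  sum is looked up at the quotient, a code already treated.\<close>

definition tables_com :: com where
  "tables_com =
     NStore 2 (var 30) (var 15) ;;
     NStore 3 (var 30) (var 16) ;;
     NStore 4 (var 30) (NAdd (NLoad 4 (var 15)) (var 16)) ;;
     16 ::= NAdd (var 16) (NConst 1) ;;
     Cond (NLess (var 16) players) Skip (16 ::= NConst 0 ;; 15 ::= NAdd (var 15) (NConst 1))"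

definition codes_com :: com where
  "codes_com =
     NStore 4 (NConst 0) (NConst 0) ;;
     13 ::= NConst 0 ;;
     15 ::= NConst 0 ;;
     16 ::= NConst 0 ;;
     19 ::= NConst 0 ;;
     For 30 (var 12)
       (tables_com ;;
        Cond (And (Not (NLess (NLoad 4 (var 30)) (NSub players (NConst 1))))
                  (Not (NLess (NSub players (NConst 1)) (NLoad 4 (var 30)))))
          emit_com Skip)"

lemma tables_spec:
  assumes "nats m 0 0 = n" "2 \<le> n" "nats m 30 0 = j" "nats m 15 0 = j div n" "nats m 16 0 = j mod n"
    and "nats m 4 (j div n) + j mod n = digit_sum n j"
  shows "wp tables_com m (\<lambda>t m'. t \<le> 7 \<and> nats m' 15 0 = Suc j div n \<and> nats m' 16 0 = Suc j mod n \<and>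
    nats m' 2 = (nats m 2)(j := j div n) \<and> nats m' 3 = (nats m 3)(j := j mod n) \<and>
    nats m' 4 = (nats m 4)(j := digit_sum n j))"
proof -
  have "j mod n < n" using assms(2) by simp
  then have "Suc (j mod n) < n \<longleftrightarrow> Suc (j mod n) \<noteq> n" by auto
  then show ?thesis using assms by (simp add: tables_com_def fun_eq_iff div_Suc mod_Suc)
qed

definition listed :: "nat \<Rightarrow> nat \<Rightarrow> nat list \<Rightarrow> memory \<Rightarrow> bool" where
  "listed n k cs m \<longleftrightarrow> nats m 13 0 = length cs \<and> nats m 19 0 = length cs * k \<and>
     (\<forall>i<length cs. nats m 5 i = cs ! i) \<and>
     (\<forall>i<length cs. \<forall>a<k. nats m 41 (i * k + a) = cs ! i div n ^ (k - 1 - a) mod n)"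

lemma index_less: "i < l \<Longrightarrow> a < k \<Longrightarrow> i * k + a < l * (k::nat)"
proof -
  assume "i < l" "a < k"
  then have "i * k + a < Suc i * k" "Suc i * k \<le> l * k" by (simp, intro mult_le_mono1) auto
  then show ?thesis by linarith
qed

lemma emit_spec:
  assumes m: "nats m 0 1 = k" "nats m 30 0 = c" "listed n k cs m"
    and tab: "\<And>d. d \<le> c \<Longrightarrow> nats m 2 d = d div n" "\<And>d. d \<le> c \<Longrightarrow> nats m 3 d = d mod n"
  shows "wp emit_com m (\<lambda>t m'. t \<le> 4 * k + 6 \<and> listed n k (cs @ [c]) m')"
proof -
  define l where "l = length cs * k"
  define I where "I p m' \<longleftrightarrow> nats m' 17 0 = c div n ^ p \<and> (\<forall>i<l. nats m' 41 i = nats m 41 i) \<and>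
    (\<forall>a<k. k - 1 - a < p \<longrightarrow> nats m' 41 (l + a) = c div n ^ (k - 1 - a) mod n)" for p and m' :: memory
  have l: "nats m 19 0 = l" "nats m 13 0 = length cs" using m by (auto simp: listed_def l_def)
  show ?thesis
    unfolding emit_com_def wp_Seq wp_NStore
  proof (rule wp_For_use[where K = k and B = 2 and I = I], goal_cases)
    case (2 m')
    then show ?case using m by (auto dest: agreeD(1)[where A = 0])
  next
    case 3
    show ?case using m by (simp add: I_def)
  next
    case (4 p m')
    have a: "nats m' 0 1 = k" "nats m' 19 0 = l" "nats m' 2 = nats m 2" "nats m' 3 = nats m 3"
      using m l by (simp_all add: agreeD[OF 4(2)] fun_eq_iff)
    have "c div n ^ p \<le> c" by simp
    then have "nats m 2 (c div n ^ p) = c div n ^ Suc p" "nats m 3 (c div n ^ p) = c div n ^ p mod n"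
      by (simp_all add: tab div_mult2_eq power_Suc2 del: power_Suc)
    then show ?case
      using 4 a by (auto simp: I_def less_Suc_eq simp del: power_Suc)
  next
    case (5 t m')
    have a: "nats m' 0 1 = k" "nats m' 19 0 = l" "nats m' 5 = nats m 5" "nats m' 13 0 = length cs" "nats m' 30 0 = c"
      using m l by (simp_all add: agreeD[OF 5(2)] fun_eq_iff)
    have *: "nats m' 41 (i * k + a) = cs ! i div n ^ (k - 1 - a) mod n" if "i < length cs" "a < k" for i a
    proof -
      have "i * k + a < l" using index_less[OF that] by (simp add: l_def)
      then show ?thesis using 5 m that by (auto simp: I_def listed_def)
    qed
    have "k \<le> k - 1 - b + Suc b" for b by simp
    then show ?case using 5 a * m
      by (auto simp: listed_def I_def nth_append l_def less_Suc_eq)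
  qed simp_all
qed

lemma codes_spec:
  assumes m: "nats m 0 0 = n" "nats m 0 1 = k" "nats m 12 0 = n ^ k" and n: "2 \<le> n"
  shows "wp codes_com m (\<lambda>t m'. t \<le> n ^ k * (4 * k + 17) + 7 \<and>
    listed n k (filter (\<lambda>c. digit_sum n c = n - 1) [0..<n ^ k]) m')"
proof -
  define cs where "cs j = filter (\<lambda>c. digit_sum n c = n - 1) [0..<j]" for j
  define I where "I j m' \<longleftrightarrow> nats m' 15 0 = j div n \<and> nats m' 16 0 = j mod n \<and> nats m' 4 0 = 0 \<and>
    (\<forall>d<j. nats m' 2 d = d div n \<and> nats m' 3 d = d mod n \<and> nats m' 4 d = digit_sum n d) \<and> listed n k (cs j) m'"
    for j and m' :: memory
  show ?thesis
    unfolding codes_com_def wp_Seq wp_NStore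
  proof (rule wp_For_use[where K = "n ^ k" and B = "4 * k + 15" and I = I], goal_cases)
    case 1
    show ?case by (simp add: emit_com_def tables_com_def)
  next
    case (2 m')
    then show ?case using m by (auto dest: agreeD(1)[where A = 12] simp: emit_com_def tables_com_def)
  next
    case 3
    show ?case by (simp add: I_def listed_def cs_def)
  next
    case (4 j m')
    have a: "nats m' 0 0 = n" "nats m' 0 1 = k" using 4(2) m by (auto dest: agreeD(1)[where A = 0] simp: emit_com_def tables_com_def)
    \<comment> \<open>Code 0 is its own quotient; the digit sum looked up for it is the 0 stored
      before the loop.\<close>
    have S: "nats m' 4 (j div n) + j mod n = digit_sum n j"
    proof (cases "j = 0")
      case True
      then show ?thesis using 4 n by (simp add: I_def digit_sum.simps[of n 0])
    next
      case False
      then have "j div n < j" using n by simp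
      then show ?thesis using 4 digit_sum_eq[OF n, of j] by (simp add: I_def)
    qed
    have d0: "digit_sum n 0 = 0" by (simp add: digit_sum.simps[of n 0])
    show ?case
      unfolding wp_Seq
    proof (rule wp_use[OF tables_spec[OF a(1) n 4(3) _ _ S]], goal_cases)
      case (3 t m2)
      have b: "nats m2 0 0 = n" "nats m2 0 1 = k" "nats m2 30 0 = j"
        using a 4(3) agreeD(1)[OF 3(1)] by (auto simp: tables_com_def)
      have tab: "nats m2 2 d = d div n" "nats m2 3 d = d mod n" "nats m2 4 d = digit_sum n d" if "d \<le> j" for d
        using that 3(2) 4(4) by (auto simp: I_def le_less)
      have L: "listed n k (cs j) m2"
        using 4(4) agreeD(1)[OF 3(1)] by (auto simp: I_def listed_def tables_com_def)
      show ?case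
      proof (cases "digit_sum n j = n - 1")
        case True
        show ?thesis
          unfolding wp_Cond
        proof (intro conjI impI, goal_cases)
          case 1
          show ?case
          proof (rule wp_use[OF emit_spec[OF b(2,3) L tab(1,2)]], goal_cases)
            case (3 t' m3)
            have "cs (Suc j) = cs j @ [j]" using True by (simp add: cs_def)
            then show ?case
              using 3(2) \<open>t \<le> 7 \<and> _\<close> 4(4) tab d0 agreeD(1)[OF 3(1)]
              by (auto simp: I_def listed_def emit_com_def less_Suc_eq)
          qed auto
        next
          case 2
          then show ?case using True b tab by simp
        qed
      next
        case False
        then have "cs (Suc j) = cs j" by (simp add: cs_def)
        then show ?thesis using False b tab 3(2) L d0 4(4) by (auto simp: I_def listed_def less_Suc_eq)
      qed
    qed (use 4 in \<open>auto simp: I_def\<close>)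
  next
    case (5 t m')
    then show ?case by (auto simp: I_def cs_def algebra_simps)
  qed
qed

lemma index_inj: "a * k + c = b * k + d \<Longrightarrow> c < k \<Longrightarrow> d < k \<Longrightarrow> a = b \<and> c = (d :: nat)"
proof -
  assume *: "a * k + c = b * k + d" "c < k" "d < k"
  have "(a * k + c) div k = (b * k + d) div k" "(a * k + c) mod k = (b * k + d) mod k" using *(1) by simp_all
  then show ?thesis using *(2,3) by simp
qed

section \<open>Tables of binomial probabilities and of the kernel\<close>

definition bin_com :: com where
  "bin_com =
     RStore 4 (NConst 0) (rconst 1) ;;
     21 ::= NConst 0 ;;
     For 30 players
       (NStore 7 (var 30) (var 21) ;;
        For 31 players
          (Cond (NLess (NConst 0) (var 31))
            (RStore 4 (NAdd (NAdd (var 21) players) (var 31))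
              (RAdd (RMul (RSub (rconst 1) theta) (RLoad 4 (NAdd (var 21) (var 31))))
                (RMul theta (RLoad 4 (NSub (NAdd (var 21) (var 31)) (NConst 1))))))
            (RStore 4 (NAdd (NAdd (var 21) players) (var 31))
              (RMul (RSub (rconst 1) theta) (RLoad 4 (NAdd (var 21) (var 31)))))) ;;
        21 ::= NAdd (var 21) players)"

text \<open>Row 0 relies on the zeros of the initial memory to the right of its first cell. Entries
  of count vectors are below \<open>n\<close>, so \<open>n\<close> rows and columns suffice.\<close>

lemma bin_spec:
  assumes m: "nats m 0 0 = n" "reals m 6 0 = th" "\<And>i. reals m 4 i = 0" and n: "1 \<le> n"
  shows "wp bin_com m (\<lambda>t m'. t \<le> n * (4 * n + 6) + 4 \<and>
    (\<forall>i<n. nats m' 7 i = i * n) \<and> (\<forall>i<n. \<forall>q<n. reals m' 4 (i * n + q) = bin th i q))"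
proof -
  define I where "I j m' \<longleftrightarrow> nats m' 21 0 = j * n \<and> (\<forall>i<j. nats m' 7 i = i * n) \<and>
    (\<forall>i\<le>j. \<forall>q<n. reals m' 4 (i * n + q) = bin th i q)" for j and m' :: memory
  show ?thesis
    unfolding bin_com_def wp_Seq wp_NStore wp_RStore
  proof (rule wp_For_use[where K = n and B = "4 * n + 4" and I = I], goal_cases)
    case (2 m')
    then show ?case using m by (simp add: agreeD[OF 2])
  next
    case 3
    show ?case using m by (simp add: I_def)
  next
    case (4 j m')
    have a: "nats m' 0 0 = n" "reals m' 6 0 = th" using m by (simp_all add: agreeD[OF 4(2)])
    have I: "nats m' 21 0 = j * n" "\<And>i. i < j \<Longrightarrow> nats m' 7 i = i * n"
      "\<And>i q. i \<le> j \<Longrightarrow> q < n \<Longrightarrow> reals m' 4 (i * n + q) = bin th i q" using 4(4) by (auto simp: I_def)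
    show ?case
      unfolding wp_Seq wp_NStore
    proof (rule wp_For_use[where K = n and B = 2 and
          I = "\<lambda>q m''. (\<forall>i\<le>j. \<forall>q<n. reals m'' 4 (i * n + q) = bin th i q) \<and>
            (\<forall>p<q. reals m'' 4 (j * n + n + p) = bin th (Suc j) p)"], goal_cases)
      case (2 m'')
      then show ?case using a by (simp add: agreeD[OF 2])
    next
      case 3
      show ?case using I by simp
    next
      case (4 q m'')
      have b: "nats m'' 0 0 = n" "reals m'' 6 0 = th" "nats m'' 21 0 = j * n"
        using a I by (simp_all add: agreeD[OF 4(2)])
      have lt: "i * n + p < j * n + n" if "i \<le> j" "p < n" for i p
        using index_less[of i "Suc j" p n] that by simp
      have v: "reals m'' 4 (j * n + q) = bin th j q" "0 < q \<Longrightarrow> reals m'' 4 (j * n + q - 1) = bin th j (q - 1)"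
      proof -
        have *: "\<And>p. p < n \<Longrightarrow> reals m'' 4 (j * n + p) = bin th j p" using 4(4) by blast
        show "reals m'' 4 (j * n + q) = bin th j q" using * 4(1) by blast
        assume "0 < q"
        then have "j * n + q - 1 = j * n + (q - 1)" "q - 1 < n" using 4(1) by auto
        then show "reals m'' 4 (j * n + q - 1) = bin th j (q - 1)" using * by simp
      qed
      show ?case using 4(3,4) v b lt by (auto simp: less_Suc_eq) (metis lt nat_neq_iff not_add_less1)+
    next
      case (5 t m'')
      have b: "nats m'' 0 0 = n" "nats m'' 21 0 = j * n" "nats m'' 7 = (nats m' 7)(j := j * n)"
        using a I \<open>nats m' 30 0 = j\<close> by (simp_all add: agreeD[OF 5(2)] fun_eq_iff)
      show ?case using 5(1,3) b I by (auto simp: I_def less_Suc_eq le_Suc_eq add.commute)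
    qed simp_all
  next
    case (5 t m')
    then show ?case by (auto simp: I_def algebra_simps)
  qed simp
qed

definition kernel_com :: com where
  "kernel_com =
     25 ::= NConst 0 ;;
     For 30 strategies
       (NStore 28 (var 30) (var 25) ;;
        RStore 5 (NAdd (var 25) (var 30)) (rconst 1) ;;
        25 ::= NAdd (var 25) strategies) ;;
     For 30 strategies
       (For 31 strategies
         (For 32 strategies
           (RStore 5 (NAdd (NLoad 28 (var 30)) (var 32))
             (RAdd (RMul (RSub (rconst 1) theta) (RLoad 5 (NAdd (NLoad 28 (var 30)) (var 32))))
               (RMul theta (RLoad 5 (NAdd (NLoad 28 (var 31)) (var 32))))))))"

definition kernel_table :: "nat \<Rightarrow> (nat \<Rightarrow> nat \<Rightarrow> real) \<Rightarrow> memory \<Rightarrow> bool" where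
  "kernel_table k \<kappa> m \<longleftrightarrow> (\<forall>a<k. \<forall>c<k. reals m 5 (a * k + c) = \<kappa> a c)"

text \<open>Rows are updated in place: a new entry depends only on the same column of the two rows
  involved, so no entry is read after having been replaced in the same step, even when the rows
  coincide.\<close>

lemma kernel_spec:
  assumes m: "nats m 0 1 = k" "reals m 6 0 = th" "\<And>i. reals m 5 i = 0"
  shows "wp kernel_com m (\<lambda>t m'. t \<le> k * (k * (3 * k + 4) + 9) + 5 \<and>
    (\<forall>a<k. nats m' 28 a = a * k) \<and> kernel_table k (kernel th k k) m')"
proof -
  define I where "I j m' \<longleftrightarrow> nats m' 25 0 = j * k \<and> (\<forall>i<j. nats m' 28 i = i * k) \<and>
    kernel_table k (\<lambda>a c. if a < j then point a c else 0) m'" for j and m' :: memory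
  show ?thesis
    unfolding kernel_com_def wp_Seq wp_NStore
  proof (rule wp_For_use[where K = k and B = 3 and I = I], goal_cases)
    case (2 m')
    then show ?case using m by (simp add: agreeD[OF 2])
  next
    case 3
    show ?case using m by (simp add: I_def kernel_table_def)
  next
    case (4 j m')
    have a: "nats m' 0 1 = k" using m by (simp add: agreeD[OF 4(2)])
    have "a * k + c = j * k + j \<longleftrightarrow> a = j \<and> c = j" if "c < k" for a c using index_inj[of a k c j j] that 4(1) by auto
    then show ?case using 4(1,3,4) a by (auto simp: I_def kernel_table_def less_Suc_eq point_def)
  next
    case (5 t m')
    have a: "nats m' 0 1 = k" "reals m' 6 0 = th" using m by (simp_all add: agreeD[OF 5(2)])
    have I: "\<And>i. i < k \<Longrightarrow> nats m' 28 i = i * k" "kernel_table k point m'" using 5(3) by (auto simp: I_def kernel_table_def)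
    show ?case
    proof (rule wp_For_use[where K = k and B = "k * (3 * k + 4) + 2" and I = "\<lambda>j. kernel_table k (kernel th k j)"], goal_cases)
      case (2 m2)
      then show ?case using a by (simp add: agreeD[OF 2])
    next
      case 3
      show ?case using I by (simp add: kernel_table_def)
    next
      case (4 j m2)
      have b: "nats m2 0 1 = k" "reals m2 6 0 = th" "nats m2 28 = nats m' 28" using a by (simp_all add: agreeD[OF 4(2)])
      show ?case
      proof (rule wp_For_use[where K = k and B = "3 * k + 2" and
            I = "\<lambda>i. kernel_table k (kernel_row th j i (kernel th k j))"], goal_cases)
        case (2 m3)
        then show ?case using b by (simp add: agreeD[OF 2])
      next
        case 3
        show ?case using 4(4) by (simp add: kernel_table_def)
      next
        case (4 i m3)
        have c: "nats m3 0 1 = k" "reals m3 6 0 = th" "nats m3 28 = nats m' 28" "nats m3 30 0 = j"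
          using b \<open>nats m2 30 0 = j\<close> by (simp_all add: agreeD[OF 4(2)])
        let ?\<kappa> = "kernel_row th j i (kernel th k j)"
        show ?case
        proof (rule wp_For_use[where K = k and B = 1 and
              I = "\<lambda>c. kernel_table k (\<lambda>p q. if p = j \<and> q < c then kstep th j i ?\<kappa> p q else ?\<kappa> p q)"], goal_cases)
          case (2 m4)
          then show ?case using c by (simp add: agreeD[OF 2])
        next
          case 3
          show ?case using 4(4) by (simp add: kernel_table_def)
        next
          case (4 c m4)
          have d: "nats m4 0 1 = k" "reals m4 6 0 = th" "nats m4 28 = nats m' 28" "nats m4 30 0 = j" "nats m4 31 0 = i"
            using c \<open>nats m3 31 0 = i\<close> by (simp_all add: agreeD[OF 4(2)])
          have e: "a * k + b = j * k + c \<longleftrightarrow> a = j \<and> b = c" if "b < k" for a b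
            using index_inj[of a k b j c] that 4(1) by auto
          show ?case
            using 4(1,3,4) d e I(1) \<open>j < k\<close> \<open>i < k\<close>
            by (auto simp: kernel_table_def kstep_def less_Suc_eq)
        next
          case (5 t m4)
          then show ?case by (auto simp: kernel_table_def kstep_def)
        qed simp_all
      next
        case (5 t m3)
        then show ?case by (simp add: kernel_table_def algebra_simps)
      qed simp_all
    next
      case (5 t2 m2)
      then show ?case using \<open>t \<le> _\<close> I agreeD(1)[OF 5(2), of 28] by (auto simp: algebra_simps)
    qed simp_all
  qed simp
qed

section \<open>Smoothing the payoff tables\<close>

definition vstep_com :: com where
  "vstep_com =
     19 ::= NConst 0 ;;
     For 34 (var 13)
       (RStore 7 (NConst 0) (rconst 0) ;;
        17 ::= NLoad 5 (var 34) ;;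
        20 ::= NLoad 41 (NAdd (var 19) (var 32)) ;;
        21 ::= NLoad 7 (var 20) ;;
        For 35 (NAdd (var 20) (NConst 1))
          (RStore 7 (NConst 0) (RAdd (RLoad 7 (NConst 0))
             (RMul (RLoad 4 (NAdd (var 21) (var 35))) (RLoad 2 (var 17)))) ;;
           17 ::= NSub (NAdd (var 17) (NLoad 40 (var 33))) (NLoad 40 (var 32))) ;;
        RStore 3 (NLoad 5 (var 34)) (RLoad 7 (NConst 0)) ;;
        19 ::= NAdd (var 19) strategies) ;;
     For 34 (var 13) (RStore 2 (NLoad 5 (var 34)) (RLoad 3 (NLoad 5 (var 34))))"

definition block_com :: com where
  "block_com =
     For 32 (var 13) (RStore 2 (NLoad 5 (var 32)) (RLoad 0 (NAdd (var 18) (var 32)))) ;;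
     For 32 strategies (For 33 strategies vstep_com) ;;
     For 32 (var 13) (RStore 0 (NAdd (var 18) (var 32)) (RLoad 2 (NLoad 5 (var 32)))) ;;
     18 ::= NAdd (var 18) (var 13)"

definition smooth_com :: com where
  "smooth_com = 18 ::= NConst 0 ;; For 30 players (For 31 strategies block_com)"

locale machine =
  fixes n k :: nat and th :: real
  assumes n: "2 \<le> n" and k: "1 \<le> k"
begin

definition PL :: "nat list list" where "PL = partition_list k (n - 1)"
definition N :: nat where "N = length PL"

lemma PL_nth: "r < N \<Longrightarrow> PL ! r \<in> partitions k (n - 1)"
  by (simp add: N_def PL_def flip: set_partition_list)

lemma length_PL_nth: "r < N \<Longrightarrow> length (PL ! r) = k"
  using PL_nth by (auto simp: partitions_def)

lemma PL_ex: "x \<in> partitions k (n - 1) \<Longrightarrow> \<exists>r<N. PL ! r = x"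
  by (simp add: N_def PL_def in_set_conv_nth flip: set_partition_list)

lemma PL_entry: "r < N \<Longrightarrow> a < k \<Longrightarrow> PL ! r ! a < n"
  using partition_entry_le[OF PL_nth, of r "PL ! r ! a"] length_PL_nth[of r] n by simp

lemma code_inj: "r < N \<Longrightarrow> r' < N \<Longrightarrow> code n (PL ! r) = code n (PL ! r') \<longleftrightarrow> r = r'"
  using distinct_partition_list[of n "n - 1" k] n nth_eq_iff_index_eq[of "map (code n) PL" r r']
  by (simp add: N_def PL_def)

definition layout :: "memory \<Rightarrow> bool" where
  "layout m \<longleftrightarrow> nats m 0 0 = n \<and> nats m 0 1 = k \<and> (\<forall>a<k. nats m 40 a = n ^ (k - 1 - a)) \<and>
     nats m 13 0 = N \<and> (\<forall>r<N. nats m 5 r = code n (PL ! r)) \<and>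
     (\<forall>r<N. \<forall>a<k. nats m 41 (r * k + a) = PL ! r ! a)"

lemma layout_agree:
  "layout m \<Longrightarrow> agree A R m m' \<Longrightarrow> {0, 40, 13, 5, 41} \<inter> A = {} \<Longrightarrow> layout m'"
  by (auto simp: layout_def agree_def)

lemma layout_store [simp]:
  "A \<notin> {0, 40, 13, 5, 41} \<Longrightarrow> layout (nstore A i x m) \<longleftrightarrow> layout m"
  "layout (rstore A i y m) \<longleftrightarrow> layout m"
  by (auto simp: layout_def)

lemma layoutD:
  assumes "layout m"
  shows "nats m 0 0 = n" "nats m 0 (Suc 0) = k" "a < k \<Longrightarrow> nats m 40 a = n ^ (k - Suc a)"
    "nats m 13 0 = N" "r < N \<Longrightarrow> nats m 5 r = code n (PL ! r)"
    "r < N \<Longrightarrow> a < k \<Longrightarrow> nats m 41 (r * k + a) = PL ! r ! a"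
  using assms by (auto simp: layout_def)

definition bins :: "memory \<Rightarrow> bool" where
  "bins m \<longleftrightarrow> (\<forall>i<n. nats m 7 i = i * n) \<and> (\<forall>i<n. \<forall>q<n. reals m 4 (i * n + q) = bin th i q)"

lemma bins_agree: "bins m \<Longrightarrow> agree A R m m' \<Longrightarrow> 7 \<notin> A \<Longrightarrow> 4 \<notin> R \<Longrightarrow> bins m'"
  by (auto simp: bins_def agree_def)

lemma bins_store [simp]: "A \<noteq> 7 \<Longrightarrow> bins (nstore A i x m) \<longleftrightarrow> bins m"
  by (auto simp: bins_def)

definition holds :: "(nat list \<Rightarrow> real) \<Rightarrow> memory \<Rightarrow> bool" where
  "holds g m \<longleftrightarrow> (\<forall>r<N. reals m 2 (code n (PL ! r)) = g (PL ! r))"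

text \<open>The results are buffered in array 3, since other count vectors still need the old
  entries. One count vector costs O(n): there are at most \<open>n\<close> moves, each a constant
  shift of the code.\<close>

lemma vstep_spec:
  assumes m: "layout m" "bins m" "holds g m" "nats m 32 0 = a" "nats m 33 0 = b" and ab: "a < k" "b < k"
  shows "wp vstep_com m (\<lambda>t m'. t \<le> N * (4 * n + 13) + 5 \<and> holds (vstep th a b g) m')"
proof -
  define I where "I i m' \<longleftrightarrow> nats m' 19 0 = i * k \<and>
    (\<forall>r<i. reals m' 3 (code n (PL ! r)) = vstep th a b g (PL ! r))" for i and m' :: memory
  show ?thesis
    unfolding vstep_com_def wp_Seq wp_NStore
  proof (rule wp_For_use[where K = N and B = "4 * n + 8" and I = I], goal_cases)
    case (2 m')
    then show ?case using layoutD(4)[OF m(1)] by (simp add: agreeD[OF 2])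
  next
    case 3
    show ?case by (simp add: I_def)
  next
    case (4 i m')
    have L: "layout m'" using m by (intro layout_agree[OF _ 4(2)]) auto
    have a: "nats m' 7 = nats m 7" "reals m' 4 = reals m 4" "reals m' 2 = reals m 2" "nats m' 32 0 = a" "nats m' 33 0 = b"
      using m by (simp_all add: agreeD[OF 4(2)] fun_eq_iff)
    let ?x = "PL ! i"
    have x: "nats m' 41 (i * k + a) = ?x ! a" "nats m' 5 i = code n ?x" "?x ! a < n" "length ?x = k"
      using layoutD[OF L] 4(1) ab PL_entry length_PL_nth by auto
    have bn: "nats m' 7 (?x ! a) = ?x ! a * n" using m(2) a x by (simp add: bins_def)
    have 19: "nats m' 19 0 = i * k" using 4(4) by (simp add: I_def)
    show ?case
      unfolding wp_Seq wp_NStore wp_RStore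
    \<comment> \<open>The code is tracked only while \<open>j \<le> x ! a\<close>. The update after
      the last round would move a player who does not exist, and its result is not read.\<close>
    proof (rule wp_For_use[where K = "Suc (?x ! a)" and B = 2 and
          I = "\<lambda>j m2. reals m2 7 0 = (\<Sum>j'<j. bin th (?x ! a) j' * g (move a b j' ?x)) \<and>
            (j \<le> ?x ! a \<longrightarrow> nats m2 17 0 = code n (move a b j ?x))"], goal_cases)
      case (2 m2)
      then show ?case using 19 a x \<open>nats m' 34 0 = i\<close> by (simp add: agreeD[OF 2])
    next
      case 3
      have "code n (move a b 0 ?x) = code n ?x" using x by (simp add: move_def Let_def)
      then show ?case using 19 a x \<open>nats m' 34 0 = i\<close> by simp
    next
      case (4 j m2)
      have j: "j \<le> ?x ! a" using 4(1) by simp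
      have b: "nats m2 21 0 = ?x ! a * n" "nats m2 32 0 = a" "nats m2 33 0 = b" "nats m2 40 = nats m' 40"
        "reals m2 2 = reals m 2" "reals m2 4 = reals m 4"
        using 19 a x bn \<open>nats m' 34 0 = i\<close> by (simp_all add: agreeD[OF 4(2)] fun_eq_iff)
      have cc: "nats m2 17 0 = code n (move a b j ?x)" using 4(4) j by simp
      have "move a b j ?x \<in> partitions k (n - 1)"
        using PL_nth[OF \<open>i < N\<close>] ab j by (intro move_in_partitions) auto
      then have g: "reals m2 2 (code n (move a b j ?x)) = g (move a b j ?x)"
        using PL_ex m(3) b(5) by (fastforce simp: holds_def)
      have B: "reals m2 4 (?x ! a * n + j) = bin th (?x ! a) j" using m(2) b(6) x j by (simp add: bins_def)
      have W: "nats m2 40 a = n ^ (k - 1 - a)" "nats m2 40 b = n ^ (k - 1 - b)"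
        using layoutD(3)[OF L] ab b(4) by auto
      have nxt: "code n (move a b j ?x) + n ^ (k - 1 - b) - n ^ (k - 1 - a) = code n (move a b (Suc j) ?x)"
        if "Suc j \<le> ?x ! a"
        using code_move[of a ?x b j n] code_move[of a ?x b "Suc j" n] that x ab j by (simp add: ac_simps)
      show ?case using 4(4) b cc g B W nxt \<open>nats m2 35 0 = j\<close> by simp
    next
      case (5 t m2)
      have b: "nats m2 0 (Suc 0) = k" "nats m2 19 0 = i * k" "nats m2 5 i = code n ?x" "nats m2 34 0 = i" "reals m2 3 = reals m' 3"
        using 19 a x layoutD(2)[OF L] \<open>nats m' 34 0 = i\<close> by (simp_all add: agreeD[OF 5(2)] fun_eq_iff)
      have "reals m2 7 0 = vstep th a b g ?x"
        using 5(3) by (simp add: vstep_def lessThan_Suc_atMost)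
      moreover have "code n (PL ! r) \<noteq> code n ?x" if "r < i" for r using code_inj[of r i] that 4(1) by simp
      moreover have "Suc (?x ! a) * 4 \<le> n * 4" using x by simp
      ultimately show ?case using 5(1) b 4(4) by (auto simp: I_def less_Suc_eq)
    qed simp_all
  next
    case (5 t m')
    have L: "layout m'" using m by (intro layout_agree[OF _ 5(2)]) auto
    show ?case
    proof (rule wp_For_use[where K = N and B = 1 and
          I = "\<lambda>i m2. \<forall>r<i. reals m2 2 (code n (PL ! r)) = vstep th a b g (PL ! r)"], goal_cases)
      case (2 m2)
      then show ?case using layoutD(4)[OF L] by (simp add: agreeD[OF 2])
    next
      case (4 i m2)
      have "nats m2 5 i = code n (PL ! i)" "reals m2 3 = reals m' 3"
        using layoutD(5)[OF L 4(1)] by (simp_all add: agreeD[OF 4(2)])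
      moreover have "code n (PL ! r) \<noteq> code n (PL ! i)" if "r < i" for r using code_inj[of r i] that 4(1) by simp
      ultimately show ?case using 4 5(3) by (auto simp: I_def less_Suc_eq)
    next
      case (5 t2 m2)
      then show ?case using \<open>t \<le> _\<close> by (auto simp: holds_def algebra_simps)
    qed simp_all
  qed simp
qed

lemma sweep_spec:
  assumes m: "layout m" "bins m" "holds g m"
  shows "wp (For 32 strategies (For 33 strategies vstep_com)) m
    (\<lambda>t m'. t \<le> k * (k * (N * (4 * n + 13) + 7) + 4) + 2 \<and> holds (smooth th k k g) m')"
proof (rule wp_For_use[where K = k and B = "k * (N * (4 * n + 13) + 7) + 2" and I = "\<lambda>a. holds (smooth th k a g)"], goal_cases)
  case 1
  show ?case by (simp add: vstep_com_def)
next
  case (2 m')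
  then show ?case using layoutD(2)[OF m(1)] by (simp add: agreeD[OF 2] vstep_com_def)
next
  case 3
  show ?case using m by (simp add: holds_def)
next
  case (4 a m1)
  have L: "layout m1" "bins m1" using m by (auto intro!: layout_agree[OF _ 4(2)] bins_agree[OF _ 4(2)] simp: vstep_com_def)
  show ?case
  proof (rule wp_For_use[where K = k and B = "N * (4 * n + 13) + 5" and
        I = "\<lambda>b. holds (smooth_row th a b (smooth th k a g))"], goal_cases)
    case 1
    show ?case by (simp add: vstep_com_def)
  next
    case (2 m')
    then show ?case using layoutD(2)[OF L(1)] by (simp add: agreeD[OF 2] vstep_com_def)
  next
    case 3
    show ?case using 4(4) by (simp add: holds_def)
  next
    case (4 b m2)
    have L2: "layout m2" "bins m2" using L by (auto intro!: layout_agree[OF _ 4(2)] bins_agree[OF _ 4(2)] simp: vstep_com_def)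
    have a: "nats m2 32 0 = a" using \<open>nats m1 32 0 = a\<close> by (simp add: agreeD[OF 4(2)] vstep_com_def)
    show ?case
      by (rule wp_mono[OF vstep_spec[OF L2 4(4) a 4(3) \<open>a < k\<close> \<open>b < k\<close>]]) (auto simp: holds_def)
  next
    case (5 t m2)
    then show ?case by (simp add: holds_def algebra_simps)
  qed
next
  case (5 t m1)
  then show ?case by (simp add: algebra_simps)
qed

text \<open>The input array is overwritten table by table; \<open>b\<close> counts the tables that
  are already smoothed.\<close>

definition payoffs :: "nat \<Rightarrow> (nat \<Rightarrow> nat \<Rightarrow> nat list \<Rightarrow> real) \<Rightarrow> (nat \<Rightarrow> nat \<Rightarrow> nat list \<Rightarrow> real) \<Rightarrow> memory \<Rightarrow> bool" where
  "payoffs b v u m \<longleftrightarrow> (\<forall>i<n. \<forall>a<k. \<forall>r<N. reals m 0 ((i * k + a) * N + r) =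
     (if i * k + a < b then v i a (PL ! r) else u i a (PL ! r)))"

lemma block_spec:
  assumes m: "layout m" "bins m" "nats m 18 0 = (i * k + a) * N" and ia: "i < n" "a < k"
    and P: "payoffs (i * k + a) (\<lambda>i a. smooth th k k (u i a)) u m"
  shows "wp block_com m (\<lambda>t m'. t \<le> k * (k * (N * (4 * n + 13) + 7) + 4) + 6 * N + 7 \<and>
    nats m' 18 0 = Suc (i * k + a) * N \<and> payoffs (Suc (i * k + a)) (\<lambda>i a. smooth th k k (u i a)) u m')"
  unfolding block_com_def wp_Seq
proof (rule wp_For_use[where K = N and B = 1 and I = "\<lambda>j m'. \<forall>r<j. reals m' 2 (code n (PL ! r)) = u i a (PL ! r)"], goal_cases)
  case (2 m')
  then show ?case using layoutD(4)[OF m(1)] by (simp add: agreeD[OF 2])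
next
  case (4 j m')
  have b: "nats m' 5 j = code n (PL ! j)" "nats m' 18 0 = (i * k + a) * N" "reals m' 0 = reals m 0"
    using layoutD(5)[OF m(1) 4(1)] m(3) by (simp_all add: agreeD[OF 4(2)])
  have c: "code n (PL ! r) \<noteq> code n (PL ! j)" if "r < j" for r using code_inj[of r j] that 4(1) by simp
  show ?case using 4(1,3,4) b c P ia by (auto simp: payoffs_def less_Suc_eq)
next
  case (5 t1 m1)
  have L: "layout m1" "bins m1" using m by (auto intro!: layout_agree[OF _ 5(2)] bins_agree[OF _ 5(2)])
  have "holds (u i a) m1" using 5(3) by (simp add: holds_def)
  note t1 = 5(1)
  have b: "nats m1 18 0 = (i * k + a) * N" "reals m1 0 = reals m 0" using m(3) by (simp_all add: agreeD[OF 5(2)])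
  show ?case
  proof (rule wp_use[OF sweep_spec[OF L \<open>holds (u i a) m1\<close>]], goal_cases)
    case (1 t2 m2)
    have L2: "layout m2" using L by (auto intro!: layout_agree[OF _ 1(1)] simp: vstep_com_def)
    have c: "nats m2 18 0 = (i * k + a) * N" "reals m2 0 = reals m 0" using b by (simp_all add: agreeD[OF 1(1)] vstep_com_def)
    have H: "reals m2 2 (code n (PL ! r)) = smooth th k k (u i a) (PL ! r)" if "r < N" for r
      using 1(2) that by (simp add: holds_def)
    note t2 = 1(2)
    let ?b = "i * k + a"
    show ?case
    proof (rule wp_For_use[where K = N and B = 1 and
          I = "\<lambda>j m'. \<forall>i'<n. \<forall>a'<k. \<forall>r<N. reals m' 0 ((i' * k + a') * N + r) =
            (if i' * k + a' < ?b \<or> i' * k + a' = ?b \<and> r < j then smooth th k k (u i' a') (PL ! r) else u i' a' (PL ! r))"], goal_cases)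
      case (2 m')
      then show ?case using layoutD(4)[OF L2] by (simp add: agreeD[OF 2])
    next
      case 3
      show ?case using c P by (simp add: payoffs_def)
    next
      case (4 j m3)
      have d: "nats m3 18 0 = ?b * N" "nats m3 5 j = code n (PL ! j)" "reals m3 2 = reals m2 2"
        using c layoutD(5)[OF L2 4(1)] by (simp_all add: agreeD[OF 4(2)])
      have e: "(i' * k + a') * N + r = ?b * N + j \<longleftrightarrow> i' = i \<and> a' = a \<and> r = j" if "a' < k" "r < N" for i' a' r
        using index_inj[of "i' * k + a'" N r ?b j] index_inj[of i' k a' i a] that ia 4(1) by auto
      have f: "i' * k + a' = ?b \<longleftrightarrow> i' = i \<and> a' = a" if "a' < k" for i' a' using index_inj[of i' k a' i a] that ia by auto
      show ?case using 4(1,3,4) d H e f by (auto simp: less_Suc_eq)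
    next
      case (5 t3 m3)
      have "nats m3 18 0 = ?b * N" "nats m3 13 0 = N" using c layoutD(4)[OF L2] by (simp_all add: agreeD[OF 5(2)])
      moreover have "payoffs (Suc ?b) (\<lambda>i a. smooth th k k (u i a)) u m3"
        using 5(3) unfolding payoffs_def by (auto simp: less_Suc_eq)
      ultimately show ?case using 5(1) t1 t2 by (simp add: payoffs_def)
    qed simp_all
  qed
qed simp_all

lemma writes_block [simp]:
  "nwrites block_com = {32, 33, 19, 34, 17, 20, 21, 35, 18}" "rwrites block_com = {2, 7, 3, 0}"
  by (auto simp: block_com_def vstep_com_def)

lemma smooth_spec:
  assumes m: "layout m" "bins m" "payoffs 0 v u m"
  shows "wp smooth_com m (\<lambda>t m'. t \<le> n * (k * (k * (k * (N * (4 * n + 13) + 7) + 4) + 6 * N + 9) + 4) + 3 \<and>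
    payoffs (n * k) (\<lambda>i a. smooth th k k (u i a)) u m')"
  unfolding smooth_com_def wp_Seq wp_NStore
proof (rule wp_For_use[where K = n and B = "k * (k * (k * (N * (4 * n + 13) + 7) + 4) + 6 * N + 9) + 2" and
      I = "\<lambda>i m'. nats m' 18 0 = i * k * N \<and> payoffs (i * k) (\<lambda>i a. smooth th k k (u i a)) u m'"], goal_cases)
  case (2 m')
  then show ?case using layoutD(1)[OF m(1)] by (simp add: agreeD[OF 2])
next
  case 3
  show ?case using m by (simp add: payoffs_def)
next
  case (4 i m1)
  have L: "layout m1" "bins m1" using m by (auto intro!: layout_agree[OF _ 4(2)] bins_agree[OF _ 4(2)])
  show ?case
  proof (rule wp_For_use[where K = k and B = "k * (k * (N * (4 * n + 13) + 7) + 4) + 6 * N + 7" and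
        I = "\<lambda>a m'. nats m' 18 0 = (i * k + a) * N \<and> payoffs (i * k + a) (\<lambda>i a. smooth th k k (u i a)) u m'"], goal_cases)
    case (2 m')
    then show ?case using layoutD(2)[OF L(1)] by (simp add: agreeD[OF 2])
  next
    case 3
    show ?case using 4(4) by (simp add: payoffs_def)
  next
    case (4 a m2)
    have L2: "layout m2" "bins m2" using L by (auto intro!: layout_agree[OF _ 4(2)] bins_agree[OF _ 4(2)])
    show ?case
      by (rule wp_mono[OF block_spec[OF L2 _ \<open>i < n\<close> 4(1)]]) (use 4(4) in \<open>auto simp: payoffs_def\<close>)
  next
    case (5 t m2)
    then show ?case by (simp add: payoffs_def algebra_simps)
  qed simp_all
next
  case (5 t m1)
  then show ?case by (simp add: algebra_simps)
qed simp_all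

end

lemma nats_nstore_array [simp]:
  "A \<noteq> B \<Longrightarrow> nats (nstore A j x m) B = nats m B"
  "nats (nstore A j x m) A = (nats m A)(j := x)"
  by (auto simp: fun_eq_iff)

section \<open>The search for an assignment\<close>

definition best_com :: com where
  "best_com =
     17 ::= var 27 ;;
     22 ::= NConst 0 ;;
     RStore 7 (NConst 0) (RLoad 0 (var 17)) ;;
     For 32 strategies
       (Cond (RLess (RLoad 7 (NConst 0)) (RLoad 0 (var 17)))
          (RStore 7 (NConst 0) (RLoad 0 (var 17)) ;; 22 ::= var 32) Skip ;;
        17 ::= NAdd (var 17) (var 13))"

text \<open>Excesses may be negative and subtraction of naturals is truncated, so they are compared
  crosswise as sums. The initial choice in array 22 is a best response, hence admissible.\<close>

definition choose_com :: com where
  "choose_com =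
     17 ::= var 27 ;;
     For 32 strategies
       (Cond (RLess (RLoad 0 (var 17))
                (RSub (RLoad 7 (NConst 0)) (RMul (RMul (rconst 21) (ROfNat strategies)) theta)))
          (NStore 10 (NAdd (var 24) (var 32)) (NConst 0))
          (NStore 10 (NAdd (var 24) (var 32)) (NConst 1) ;;
           Cond (NLess (NAdd (NLoad 9 (var 32)) (NLoad 41 (NAdd (var 19) (var 22))))
                   (NAdd (NLoad 9 (var 22)) (NLoad 41 (NAdd (var 19) (var 32)))))
             (22 ::= var 32) Skip) ;;
        17 ::= NAdd (var 17) (var 13))"

text \<open>After \<open>k\<close> steps of length \<open>N\<close>, scalar 17 has reached the
  payoffs of the next player at the same count vector; it is kept in 27 to avoid recomputing a
  product.\<close>

definition insert_com :: com where
  "insert_com =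
     best_com ;;
     choose_com ;;
     NStore 8 (var 31) (var 22) ;;
     NStore 9 (var 22) (NAdd (NLoad 9 (var 22)) (NConst 1)) ;;
     27 ::= var 17 ;;
     24 ::= NAdd (var 24) strategies"

definition step_com :: com where
  "step_com =
     Cond (And (NLess (NConst 0) (NLoad 10 (NAdd (var 25) (var 34))))
            (NLess (NAdd (NAdd (NLoad 9 (var 34)) (NLoad 41 (NAdd (var 19) (NLoad 8 (var 33))))) (NConst 1))
              (NAdd (NLoad 9 (NLoad 8 (var 33))) (NLoad 41 (NAdd (var 19) (var 34))))))
       (NStore 9 (NLoad 8 (var 33)) (NSub (NLoad 9 (NLoad 8 (var 33))) (NConst 1)) ;;
        NStore 8 (var 33) (var 34) ;;
        NStore 9 (var 34) (NAdd (NLoad 9 (var 34)) (NConst 1)))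
       Skip"

definition passes_com :: com where
  "passes_com =
     For 32 strategies
       (25 ::= NConst 0 ;;
        For 33 (NAdd (var 31) (NConst 1))
          (For 34 strategies step_com ;;
           25 ::= NAdd (var 25) strategies))"

definition check_com :: com where
  "check_com =
     23 ::= NConst 1 ;;
     For 31 strategies
       (Cond (NLess (NAdd (NLoad 41 (NAdd (var 19) (var 31))) (NAdd strategies (NConst 2))) (NLoad 9 (var 31)))
         (23 ::= NConst 0) Skip)"

definition output_com :: com where
  "output_com =
     24 ::= NConst 0 ;;
     For 31 players
       (For 32 strategies
          (RStore 1 (NAdd (var 24) (var 32)) (RLoad 5 (NAdd (NLoad 28 (NLoad 8 (var 31))) (var 32)))) ;;
        24 ::= NAdd (var 24) strategies)"

definition candidate_com :: com where
  "candidate_com =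
     For 31 strategies (NStore 9 (var 31) (NConst 0)) ;;
     27 ::= var 30 ;;
     24 ::= NConst 0 ;;
     For 31 players (insert_com ;; passes_com) ;;
     check_com ;;
     Cond (NLess (NConst 0) (var 23)) output_com Skip ;;
     19 ::= NAdd (var 19) strategies"

definition search_com :: com where
  "search_com = 19 ::= NConst 0 ;; For 30 (var 13) candidate_com"

locale searcher = machine +
  fixes v :: "nat \<Rightarrow> nat \<Rightarrow> nat list \<Rightarrow> real"
  assumes th: "0 \<le> th"
begin

abbreviation ok :: "nat list \<Rightarrow> nat \<Rightarrow> nat \<Rightarrow> bool" where
  "ok \<equiv> admissible k v (21 * real k * th)"

definition env :: "memory \<Rightarrow> bool" where
  "env m \<longleftrightarrow> layout m \<and> (\<forall>i<n. \<forall>a<k. \<forall>r<N. reals m 0 ((i * k + a) * N + r) = v i a (PL ! r)) \<and>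
     reals m 6 0 = th \<and> kernel_table k (kernel th k k) m \<and> (\<forall>a<k. nats m 28 a = a * k)"

lemma env_agree:
  "env m \<Longrightarrow> agree A R m m' \<Longrightarrow> {0, 40, 13, 5, 41, 28} \<inter> A = {} \<Longrightarrow> {0, 5, 6} \<inter> R = {} \<Longrightarrow> env m'"
  unfolding env_def using layout_agree[of m A R m'] by (auto simp: agree_def kernel_table_def)

lemma env_store [simp]:
  "A \<notin> {0, 40, 13, 5, 41, 28} \<Longrightarrow> env (nstore A i x m) \<longleftrightarrow> env m"
  "B \<notin> {0, 5, 6} \<Longrightarrow> env (rstore B i y m) \<longleftrightarrow> env m"
  by (auto simp: env_def kernel_table_def)

lemma envD:
  assumes "env m"
  shows "nats m 0 0 = n" "nats m 0 (Suc 0) = k" "nats m 13 0 = N"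
    "r < N \<Longrightarrow> a < k \<Longrightarrow> nats m 41 (r * k + a) = PL ! r ! a"
    "i < n \<Longrightarrow> a < k \<Longrightarrow> r < N \<Longrightarrow> reals m 0 ((i * k + a) * N + r) = v i a (PL ! r)"
    "reals m 6 0 = th" "a < k \<Longrightarrow> nats m 28 a = a * k"
    "a < k \<Longrightarrow> c < k \<Longrightarrow> reals m 5 (a * k + c) = kernel th k k a c"
  using assms by (auto simp: env_def layout_def kernel_table_def)

lemma best_spec:
  assumes E: "env m" and m: "nats m 27 0 = i * k * N + r" and ir: "i < n" "r < N"
  shows "wp best_com m (\<lambda>t m'. t \<le> 6 * k + 5 \<and> nats m' 22 0 < k \<and>
    reals m' 7 0 = v i (nats m' 22 0) (PL ! r) \<and> (\<forall>c<k. v i c (PL ! r) \<le> v i (nats m' 22 0) (PL ! r)))"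
proof -
  define I where "I c m' \<longleftrightarrow> nats m' 17 0 = (i * k + c) * N + r \<and> nats m' 22 0 < k \<and>
    reals m' 7 0 = v i (nats m' 22 0) (PL ! r) \<and> (\<forall>c'<c. v i c' (PL ! r) \<le> v i (nats m' 22 0) (PL ! r))"
    for c and m' :: memory
  show ?thesis
    unfolding best_com_def wp_Seq wp_NStore wp_RStore
  proof (rule wp_For_use[where K = k and B = 4 and I = I], goal_cases)
    case (2 m')
    then show ?case using envD(2)[OF E] by (simp add: agreeD[OF 2])
  next
    case 3
    show ?case using m envD(5)[OF E ir(1) _ ir(2), of 0] k by (simp add: I_def)
  next
    case (4 c m')
    have "env m'" using E by (intro env_agree[OF _ 4(2)]) auto
    then have a: "nats m' 13 0 = N" "reals m' 0 ((i * k + c) * N + r) = v i c (PL ! r)"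
      using envD ir 4(1) by auto
    show ?case
    proof (cases "v i (nats m' 22 0) (PL ! r) < v i c (PL ! r)")
      case True
      then have "v i d (PL ! r) \<le> v i c (PL ! r)" if "d < c" for d
        using 4(4) that by (auto simp: I_def intro: order_trans less_imp_le)
      then show ?thesis using 4(1,3,4) a True by (auto simp: I_def less_Suc_eq algebra_simps)
    next
      case False
      then show ?thesis using 4(3,4) a by (auto simp: I_def less_Suc_eq algebra_simps)
    qed
  next
    case (5 t m')
    then show ?case by (simp add: I_def)
  qed simp_all
qed

lemma choose_spec:
  assumes E: "env m" and m: "nats m 27 0 = i * k * N + r" "nats m 24 0 = i * k" "nats m 19 0 = r * k"
    and ir: "i < n" "r < N" and b: "nats m 22 0 < k" "reals m 7 0 = v i (nats m 22 0) (PL ! r)"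
      "\<And>c. c < k \<Longrightarrow> v i c (PL ! r) \<le> v i (nats m 22 0) (PL ! r)"
  shows "wp choose_com m (\<lambda>t m'. t \<le> 7 * k + 3 \<and> nats m' 17 0 = (i + 1) * k * N + r \<and>
    nats m' 22 0 < k \<and> ok (PL ! r) i (nats m' 22 0) \<and>
    (\<forall>c<k. ok (PL ! r) i c \<longrightarrow> nats m 9 (nats m' 22 0) + PL ! r ! c \<le> nats m 9 c + PL ! r ! (nats m' 22 0)) \<and>
    (\<forall>c<k. nats m' 10 (i * k + c) = (if ok (PL ! r) i c then 1 else 0)) \<and>
    (\<forall>j<i * k. nats m' 10 j = nats m 10 j))"
proof -
  let ?x = "PL ! r" and ?b = "nats m 22 0"
  have ok_iff: "ok ?x i c \<longleftrightarrow> \<not> v i c ?x < v i ?b ?x - 21 * real k * th" if "c < k" for c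
    using b(1,3) by (force simp: admissible_def not_less)
  define I where "I c m' \<longleftrightarrow> nats m' 17 0 = (i * k + c) * N + r \<and> nats m' 22 0 < k \<and> ok ?x i (nats m' 22 0) \<and>
    (\<forall>d<c. ok ?x i d \<longrightarrow> nats m 9 (nats m' 22 0) + ?x ! d \<le> nats m 9 d + ?x ! (nats m' 22 0)) \<and>
    (\<forall>d<c. nats m' 10 (i * k + d) = (if ok ?x i d then 1 else 0)) \<and>
    (\<forall>j<i * k. nats m' 10 j = nats m 10 j)" for c and m' :: memory
  show ?thesis
    unfolding choose_com_def wp_Seq wp_NStore
  proof (rule wp_For_use[where K = k and B = 5 and I = I], goal_cases)
    case (2 m')
    then show ?case using envD(2)[OF E] by (simp add: agreeD[OF 2])
  next
    case 3
    have "0 \<le> 21 * real k * th" using th by simp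
    then have "ok ?x i ?b" using ok_iff[OF b(1)] by linarith
    then show ?case using m b by (simp add: I_def)
  next
    case (4 c m')
    have "env m'" using E by (intro env_agree[OF _ 4(2)]) auto
    then have a: "nats m' 13 0 = N" "nats m' 0 (Suc 0) = k" "reals m' 6 0 = th"
      "reals m' 0 ((i * k + c) * N + r) = v i c ?x" "\<And>a. a < k \<Longrightarrow> nats m' 41 (r * k + a) = ?x ! a"
      using envD ir 4(1) by auto
    have f: "nats m' 9 = nats m 9" "nats m' 19 0 = r * k" "nats m' 24 0 = i * k" "reals m' 7 0 = v i ?b ?x"
      using m b by (simp_all add: agreeD[OF 4(2)] fun_eq_iff)
    note I = 4(4)[unfolded I_def]
    show ?case
    proof (cases "ok ?x i c")
      case False
      then have "v i c ?x < v i ?b ?x - 21 * real k * th" using ok_iff[OF 4(1)] by simp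
      then show ?thesis using I a f 4(3) False by (auto simp: I_def less_Suc_eq)
    next
      case True
      then have nl: "\<not> v i c ?x < v i ?b ?x - 21 * real k * th" using ok_iff[OF 4(1)] by simp
      show ?thesis
      proof (cases "nats m 9 c + ?x ! (nats m' 22 0) < nats m 9 (nats m' 22 0) + ?x ! c")
        case less: True
        have "nats m 9 c + ?x ! d \<le> nats m 9 d + ?x ! c" if "d < c" "ok ?x i d" for d
          using I that less by (auto dest!: spec[of _ d])
        moreover have "nats m' 41 (r * k + nats m' 22 0) = ?x ! (nats m' 22 0)" using I a(5) by blast
        ultimately show ?thesis using I a(1-4) a(5)[OF 4(1)] f 4(1,3) True nl less
          by (auto simp: I_def less_Suc_eq)
      next
        case False
        moreover have "nats m' 41 (r * k + nats m' 22 0) = ?x ! (nats m' 22 0)" using I a(5) by blast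
        ultimately show ?thesis using I a(1-4) a(5)[OF 4(1)] f 4(1,3) True nl
          by (auto simp: I_def less_Suc_eq)
      qed
    qed
  next
    case (5 t m')
    then show ?case by (simp add: I_def algebra_simps)
  qed simp_all
qed

definition players_done :: "nat \<Rightarrow> nat \<Rightarrow> memory \<Rightarrow> bool" where
  "players_done r i m \<longleftrightarrow> (\<forall>j<i. nats m 8 j < k \<and> ok (PL ! r) j (nats m 8 j)) \<and>
     (\<forall>a<k. nats m 9 a = card {j \<in> {..<i}. nats m 8 j = a}) \<and>
     (\<forall>j<i. \<forall>a<k. nats m 10 (j * k + a) = (if ok (PL ! r) j a then 1 else 0))"

lemma players_done_agree:
  "players_done r i m \<Longrightarrow> agree A R m m' \<Longrightarrow> {8, 9, 10} \<inter> A = {} \<Longrightarrow> players_done r i m'"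
  by (auto simp: players_done_def agree_def)

lemma players_done_store [simp]:
  "A \<notin> {8, 9, 10} \<Longrightarrow> players_done r i (nstore A j x m) \<longleftrightarrow> players_done r i m"
  by (auto simp: players_done_def)

lemma writes_insert [simp]:
  "nwrites insert_com = {17, 22, 32, 10, 8, 9, 27, 24}" "rwrites insert_com = {7}"
  by (auto simp: insert_com_def best_com_def choose_com_def)

lemma insert_spec:
  assumes E: "env m" and m: "nats m 27 0 = i * k * N + r" "nats m 24 0 = i * k" "nats m 19 0 = r * k" "nats m 31 0 = i"
    and ir: "i < n" "r < N" and P: "players_done r i m" and S: "settled k {..<i} (ok (PL ! r)) ((!) (PL ! r)) (nats m 8)"
  shows "wp insert_com m (\<lambda>t m'. t \<le> 13 * k + 12 \<and> nats m' 27 0 = (i + 1) * k * N + r \<and>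
    nats m' 24 0 = (i + 1) * k \<and> players_done r (Suc i) m' \<and>
    progress k {..<Suc i} (ok (PL ! r)) ((!) (PL ! r)) 0 (nats m' 8))"
  unfolding insert_com_def wp_Seq
proof (rule wp_use[OF best_spec[OF E m(1) ir]], goal_cases)
  case (1 t1 m1)
  let ?x = "PL ! r"
  have E1: "env m1" using E by (intro env_agree[OF _ 1(1)]) (auto simp: best_com_def)
  have a: "nats m1 27 0 = i * k * N + r" "nats m1 24 0 = i * k" "nats m1 19 0 = r * k"
    "nats m1 8 = nats m 8" "nats m1 9 = nats m 9" "nats m1 10 = nats m 10" "nats m1 31 0 = i"
    using m by (simp_all add: agreeD[OF 1(1)] best_com_def)
  show ?case
  proof (rule wp_use[OF choose_spec[OF E1 a(1-3) ir]], goal_cases)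
    case (4 t2 m2)
    have b: "nats m2 24 0 = i * k" "nats m2 8 = nats m 8" "nats m2 9 = nats m 9" "nats m2 31 0 = i" "nats m2 0 (Suc 0) = k"
      using a envD(2)[OF E1] by (simp_all add: agreeD[OF 4(1)] choose_com_def)
    define h where "h = nats m2 22 0"
    have h: "h < k" "ok ?x i h" "\<And>c. c < k \<Longrightarrow> ok ?x i c \<Longrightarrow> nats m 9 h + ?x ! c \<le> nats m 9 c + ?x ! h"
      using 4(2) a by (auto simp: h_def)
    have "hot k (insert i {..<i}) (ok ?x) ((!) ?x) ((nats m 8)(i := h)) h"
    proof (rule hot_insert[OF _ S _ h(1)])
      show "excess {..<i} ((!) ?x) (nats m 8) h \<le> excess {..<i} ((!) ?x) (nats m 8) c"
        if "c < k" "ok ?x i c" for c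
        using h(3)[OF that] P h(1) that(1) by (simp add: excess_def players_done_def)
    qed auto
    then have pr: "progress k {..<Suc i} (ok ?x) ((!) ?x) 0 ((nats m 8)(i := h))"
      by (intro progress_start) (simp add: lessThan_Suc)
    have cnt: "card {j \<in> {..<Suc i}. ((nats m 8)(i := h)) j = a} = card {j \<in> {..<i}. nats m 8 j = a} + (if a = h then 1 else 0)" for a
    proof -
      have "{j \<in> {..<Suc i}. ((nats m 8)(i := h)) j = a} =
          (if a = h then insert i {j \<in> {..<i}. nats m 8 j = a} else {j \<in> {..<i}. nats m 8 j = a})" by (auto simp: less_Suc_eq)
      then show ?thesis by simp
    qed
    have fl: "nats m2 10 (j * k + c) = (if ok ?x j c then 1 else 0)" if "j \<le> i" "c < k" for j c
    proof (cases "j = i")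
      case False
      then have "j * k + c < i * k" using index_less[of j i c k] that by simp
      then show ?thesis using 4(2) a P that False by (simp add: players_done_def)
    qed (use 4(2) that in simp)
    let ?m = "nstore 9 h (Suc (nats m2 9 h)) (nstore 8 i h m2)"
    have "nats ?m 8 = (nats m 8)(i := h)" by (auto simp: b)
    moreover have "players_done r (Suc i) ?m"
      unfolding players_done_def
    proof (intro conjI allI impI)
      fix j assume "j < Suc i"
      then show "nats ?m 8 j < k" "ok ?x j (nats ?m 8 j)" using h P by (auto simp: players_done_def b less_Suc_eq)
    next
      fix c assume "c < k"
      then show "nats ?m 9 c = card {j \<in> {..<Suc i}. nats ?m 8 j = c}"
        unfolding \<open>nats ?m 8 = _\<close> cnt using P by (simp add: players_done_def b)
    next
      fix j c assume "j < Suc i" "c < k"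
      then show "nats ?m 10 (j * k + c) = (if ok ?x j c then 1 else 0)" using fl by simp
    qed
    ultimately show ?case
      using 1(2) 4(2) b pr by (simp add: h_def[symmetric])
  qed (use 1 in auto)
qed

lemma step_spec:
  assumes E: "env m" and m: "nats m 19 0 = r * k" "nats m 33 0 = j" "nats m 34 0 = c" "nats m 25 0 = j * k"
    and lt: "r < N" "j < i" "c < k"
    and P: "players_done r i m" and S: "scan k {..<i} (ok (PL ! r)) ((!) (PL ! r)) s j c (nats m 8)"
  shows "wp step_com m (\<lambda>t m'. t \<le> 4 \<and> players_done r i m' \<and>
    scan k {..<i} (ok (PL ! r)) ((!) (PL ! r)) s j (Suc c) (nats m' 8))"
proof -
  let ?x = "PL ! r" and ?p = "nats m 8"
  have pj: "?p j < k" and fl: "nats m 10 (j * k + c) = (if ok ?x j c then 1 else 0)"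
    and cnt: "\<And>a. a < k \<Longrightarrow> nats m 9 a = card {j \<in> {..<i}. ?p j = a}"
    using P lt by (auto simp: players_done_def)
  have X: "\<And>a. a < k \<Longrightarrow> nats m 41 (r * k + a) = ?x ! a" using envD(4)[OF E] lt by simp
  \<comment> \<open>The strict inequality after adding 1 is an excess gap of at least 2, exactly
    what \<open>settled\<close> forbids.\<close>
  have iff: "nats m 9 c + ?x ! ?p j + 1 < nats m 9 (?p j) + ?x ! c \<longleftrightarrow>
      excess {..<i} ((!) ?x) ?p c + 2 \<le> excess {..<i} ((!) ?x) ?p (?p j)"
  proof -
    have "excess {..<i} ((!) ?x) ?p a = int (nats m 9 a) - int (?x ! a)" if "a < k" for a
      using cnt[OF that] by (simp add: excess_def)
    from this[OF pj] this[OF lt(3)] show ?thesis by linarith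
  qed
  show ?thesis
  proof (cases "ok ?x j c \<and> excess {..<i} ((!) ?x) ?p c + 2 \<le> excess {..<i} ((!) ?x) ?p (?p j)")
    case False
    have "scan k {..<i} (ok ?x) ((!) ?x) s j (Suc c) ?p" using S False by (rule scan_skip)
    then show ?thesis using False iff fl m X pj lt P unfolding step_com_def by auto
  next
    case True
    then have "c \<noteq> ?p j" by auto
    let ?q = "?p(j := c)"
    have sc: "scan k {..<i} (ok ?x) ((!) ?x) s j (Suc c) ?q"
      using S True lt by (intro scan_move) auto
    have cq: "int (card {l \<in> {..<i}. ?q l = a}) =
        int (nats m 9 a) - (if a = ?p j then 1 else 0) + (if a = c then 1 else 0)" if "a < k" for a
      using count_update[of "{..<i}" j ?p c a] lt cnt[OF that] by simp
    \<comment> \<open>Player \<open>j\<close> is itself counted at \<open>?p j\<close>, so the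
      truncated decrement is exact.\<close>
    have pos: "0 < nats m 9 (?p j)" using cnt[OF pj] lt by (auto simp: card_gt_0_iff)
    let ?m = "nstore 9 c (Suc (nats m 9 c)) (nstore 8 j c (nstore 9 (?p j) (nats m 9 (?p j) - 1) m))"
    have 8: "nats ?m 8 = ?q" by auto
    have "players_done r i ?m"
      unfolding players_done_def
    proof (intro conjI allI impI)
      fix l assume "l < i"
      then show "nats ?m 8 l < k" "ok ?x l (nats ?m 8 l)" using P True lt unfolding 8 by (auto simp: players_done_def)
    next
      fix a assume "a < k"
      then have "int (card {l \<in> {..<i}. nats ?m 8 l = a}) = int (nats ?m 9 a)"
        unfolding 8 using cq[of a] \<open>c \<noteq> ?p j\<close> pos by auto
      then show "nats ?m 9 a = card {l \<in> {..<i}. nats ?m 8 l = a}" by simp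
    next
      fix l a assume "l < i" "a < k"
      then show "nats ?m 10 (l * k + a) = (if ok ?x l a then 1 else 0)" using P by (simp add: players_done_def)
    qed
    moreover have "scan k {..<i} (ok ?x) ((!) ?x) s j (Suc c) (nats ?m 8)" unfolding 8 by (rule sc)
    moreover have "nats m 9 c + ?x ! ?p j + 1 < nats m 9 (?p j) + ?x ! c" using True iff by simp
    ultimately show ?thesis
      using True fl m X pj lt \<open>c \<noteq> ?p j\<close> unfolding step_com_def by (simp del: nats_nstore_array(2))
  qed
qed

lemma writes_step [simp]: "nwrites step_com = {9, 8}" "rwrites step_com = {}"
  by (auto simp: step_com_def)

lemma writes_passes [simp]: "nwrites passes_com = {32, 25, 33, 34, 9, 8}" "rwrites passes_com = {}"
  by (auto simp: passes_com_def)

text \<open>All \<open>k\<close> passes are run without a test for stability, since a settled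
  assignment admits no further move.\<close>

lemma passes_spec:
  assumes E: "env m" and m: "nats m 19 0 = r * k" "nats m 31 0 = i" and ir: "r < N" "i < n"
    and P: "players_done r (Suc i) m" and S: "progress k {..<Suc i} (ok (PL ! r)) ((!) (PL ! r)) 0 (nats m 8)"
  shows "wp passes_com m (\<lambda>t m'. t \<le> k * (n * (6 * k + 5) + 5) + 2 \<and> players_done r (Suc i) m' \<and>
    settled k {..<Suc i} (ok (PL ! r)) ((!) (PL ! r)) (nats m' 8))"
  unfolding passes_com_def
proof (rule wp_For_use[where K = k and B = "n * (6 * k + 5) + 3" and
      I = "\<lambda>s m'. players_done r (Suc i) m' \<and> progress k {..<Suc i} (ok (PL ! r)) ((!) (PL ! r)) s (nats m' 8)"], goal_cases)
  case (2 m')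
  then show ?case using envD(2)[OF E] by (simp add: agreeD[OF 2])
next
  case 3
  show ?case using P S by simp
next
  case (4 s m1)
  have E1: "env m1" using E by (intro env_agree[OF _ 4(2)]) auto
  have a: "nats m1 19 0 = r * k" "nats m1 31 0 = i" using m by (simp_all add: agreeD[OF 4(2)])
  show ?case
    unfolding wp_Seq wp_NStore
  proof (rule wp_For_use[where K = "Suc i" and B = "6 * k + 3" and
        I = "\<lambda>j m'. nats m' 25 0 = j * k \<and> players_done r (Suc i) m' \<and>
          scan k {..<Suc i} (ok (PL ! r)) ((!) (PL ! r)) s j 0 (nats m' 8)"], goal_cases)
    case (2 m')
    then show ?case using a by (simp add: agreeD[OF 2])
  next
    case 3
    show ?case using 4(4) by (auto intro: scan_start)
  next
    case (4 j m2)
    have E2: "env m2" using E1 by (intro env_agree[OF _ 4(2)]) auto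
    have b: "nats m2 19 0 = r * k" using a by (simp add: agreeD[OF 4(2)])
    have j: "nats m2 33 0 = j" "nats m2 25 0 = j * k" using 4 by auto
    show ?case
      unfolding wp_Seq
    proof (rule wp_For_use[where K = k and B = 4 and
          I = "\<lambda>c m'. players_done r (Suc i) m' \<and> scan k {..<Suc i} (ok (PL ! r)) ((!) (PL ! r)) s j c (nats m' 8)"], goal_cases)
      case (2 m')
      then show ?case using envD(2)[OF E2] by (simp add: agreeD[OF 2])
    next
      case 3
      show ?case using 4(4) by simp
    next
      case (4 c m3)
      have E3: "env m3" using E2 by (intro env_agree[OF _ 4(2)]) auto
      have c: "nats m3 19 0 = r * k" "nats m3 33 0 = j" "nats m3 25 0 = j * k" using b j by (simp_all add: agreeD[OF 4(2)])
      show ?case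
        by (rule wp_mono[OF step_spec[OF E3 c(1,2) 4(3) c(3) ir(1) \<open>j < Suc i\<close> 4(1)]]) (use 4(4) in auto)
    next
      case (5 t m3)
      have "nats m3 25 0 = j * k" "nats m3 0 (Suc 0) = k" using j envD(2)[OF E2] by (simp_all add: agreeD[OF 5(2)])
      then show ?case using 5(1,3) by (auto intro: scan_row)
    qed simp_all
  next
    case (5 t m2)
    have "Suc i * (6 * k + 5) \<le> n * (6 * k + 5)" using ir by (intro mult_le_mono1) auto
    then have "Suc t \<le> n * (6 * k + 5) + 3" using 5(1) by (simp only: add.assoc) simp
    then show ?case using 5(3) by (auto intro: scan_end)
  qed simp_all
next
  case (5 t m1)
  then show ?case by (auto intro: progress_end simp: algebra_simps)
qed simp_all

lemma check_spec:
  assumes E: "env m" and m: "nats m 19 0 = r * k" and r: "r < N"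
  shows "wp check_com m (\<lambda>t m'. t \<le> 4 * k + 3 \<and>
    nats m' 23 0 = (if \<forall>a<k. nats m 9 a \<le> PL ! r ! a + (k + 2) then 1 else 0))"
  unfolding check_com_def wp_Seq wp_NStore
proof (rule wp_For_use[where K = k and B = 2 and
      I = "\<lambda>j m'. nats m' 23 0 = (if \<forall>a<j. nats m 9 a \<le> PL ! r ! a + (k + 2) then 1 else 0)"], goal_cases)
  case (2 m')
  then show ?case using envD(2)[OF E] by (simp add: agreeD[OF 2])
next
  case (4 j m')
  have "env m'" using E by (intro env_agree[OF _ 4(2)]) auto
  then have a: "nats m' 41 (r * k + j) = PL ! r ! j" "nats m' 0 (Suc 0) = k" using envD(2,4) r 4(1) by auto
  have "nats m' 19 0 = r * k" "nats m' 9 = nats m 9" using m by (simp_all add: agreeD[OF 4(2)] fun_eq_iff)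
  then show ?case using a 4(3,4) by (auto simp: less_Suc_eq not_less split: if_splits)
qed auto

lemma output_spec:
  assumes E: "env m" and p: "\<And>i. i < n \<Longrightarrow> nats m 8 i < k"
  shows "wp output_com m (\<lambda>t m'. t \<le> n * (3 * k + 5) + 3 \<and>
    (\<forall>i<n. \<forall>a<k. reals m' 1 (i * k + a) = kernel th k k (nats m 8 i) a))"
  unfolding output_com_def wp_Seq wp_NStore
proof (rule wp_For_use[where K = n and B = "3 * k + 3" and
      I = "\<lambda>i m'. nats m' 24 0 = i * k \<and> (\<forall>j<i. \<forall>a<k. reals m' 1 (j * k + a) = kernel th k k (nats m 8 j) a)"], goal_cases)
  case (2 m')
  then show ?case using envD(1)[OF E] by (simp add: agreeD[OF 2])
next
  case (4 i m1)
  have E1: "env m1" using E by (intro env_agree[OF _ 4(2)]) auto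
  have a: "nats m1 8 = nats m 8" by (simp add: agreeD[OF 4(2)])
  have i: "nats m1 24 0 = i * k" "nats m1 31 0 = i" using 4 by auto
  show ?case
    unfolding wp_Seq
  proof (rule wp_For_use[where K = k and B = 1 and
        I = "\<lambda>c m'. (\<forall>j<i. \<forall>a<k. reals m' 1 (j * k + a) = kernel th k k (nats m 8 j) a) \<and>
          (\<forall>a<c. reals m' 1 (i * k + a) = kernel th k k (nats m 8 i) a)"], goal_cases)
    case (2 m')
    then show ?case using envD(2)[OF E1] by (simp add: agreeD[OF 2])
  next
    case 3
    show ?case using 4(4) by simp
  next
    case (4 c m2)
    have E2: "env m2" using E1 by (intro env_agree[OF _ 4(2)]) auto
    have b: "nats m2 8 = nats m 8" "nats m2 24 0 = i * k" "nats m2 31 0 = i" using a i by (simp_all add: agreeD[OF 4(2)])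
    have "reals m2 5 (nats m 8 i * k + c) = kernel th k k (nats m 8 i) c" "nats m2 28 (nats m 8 i) = nats m 8 i * k"
      using envD(7,8)[OF E2] p[OF \<open>i < n\<close>] 4(1) by auto
    moreover have "j * k + a \<noteq> i * k + c" if "j < i" "a < k" for j a using index_inj[of j k a i c] that 4(1) by auto
    ultimately show ?case using b 4(3,4) by (auto simp: less_Suc_eq)
  next
    case (5 t m2)
    have "nats m2 24 0 = i * k" "nats m2 0 (Suc 0) = k" using i envD(2)[OF E1] by (simp_all add: agreeD[OF 5(2)])
    then show ?case using 5(1,3) by (auto simp: less_Suc_eq)
  qed simp_all
qed (auto simp: algebra_simps)

end

context searcher
begin

definition accepted :: "nat list \<Rightarrow> (nat \<Rightarrow> nat) \<Rightarrow> bool" where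
  "accepted x p \<longleftrightarrow> (\<forall>i<n. p i < k \<and> ok x i (p i)) \<and> (\<forall>a<k. excess {..<n} ((!) x) p a \<le> int (k + 2))"

text \<open>Records that the assignment found was settled and yet overfull.
  \<open>feasible_exists\<close> excludes this for at least one \<open>x\<close>, whichever settled
  assignment the search finds there.\<close>

definition rejected :: "nat list \<Rightarrow> bool" where
  "rejected x \<longleftrightarrow> (\<exists>p. (\<forall>i<n. p i < k) \<and> settled k {..<n} (ok x) ((!) x) p \<and>
     \<not> (\<forall>a<k. excess {..<n} ((!) x) p a \<le> int (k + 2)))"

definition outputs :: "(nat \<Rightarrow> nat) \<Rightarrow> memory \<Rightarrow> bool" where
  "outputs p m \<longleftrightarrow> (\<forall>i<n. \<forall>a<k. reals m 1 (i * k + a) = kernel th k k (p i) a)"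

lemma writes_candidate [simp]:
  "nwrites candidate_com = {8, 9, 10, 17, 19, 22, 23, 24, 25, 27, 31, 32, 33, 34}" "rwrites candidate_com = {1, 7}"
  by (auto simp: candidate_com_def check_com_def output_com_def)

text \<open>A rejected candidate leaves array 1 alone, so an earlier output survives, and an
  accepted one rewrites every relevant cell. The search can therefore run through all count vectors
  without stopping.\<close>

lemma candidate_spec:
  assumes E: "env m" and m: "nats m 19 0 = r * k" "nats m 30 0 = r" and r: "r < N"
  shows "wp candidate_com m (\<lambda>t m'. t \<le> n * (k * (n * (6 * k + 5) + 5) + 16 * k + 21) + 7 * k + 15 \<and>
    nats m' 19 0 = Suc r * k \<and>
    (rejected (PL ! r) \<and> reals m' 1 = reals m 1 \<or> (\<exists>p. accepted (PL ! r) p \<and> outputs p m')))"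
  unfolding candidate_com_def wp_Seq
proof (rule wp_For_use[where K = k and B = 1 and I = "\<lambda>j m'. \<forall>a<j. nats m' 9 a = 0"], goal_cases)
  case (2 m')
  then show ?case using envD(2)[OF E] by (simp add: agreeD[OF 2])
next
  case (5 t1 m1)
  let ?x = "PL ! r"
  have E1: "env m1" using E by (intro env_agree[OF _ 5(2)]) auto
  have a: "nats m1 19 0 = r * k" "nats m1 30 0 = r" "reals m1 1 = reals m 1"
    using m by (simp_all add: agreeD[OF 5(2)])
  have z: "\<And>a. a < k \<Longrightarrow> nats m1 9 a = 0" using 5(3) by simp
  note t1 = 5(1)
  show ?case
    unfolding wp_NStore
  proof (rule wp_For_use[where K = n and B = "13 * k + 12 + k * (n * (6 * k + 5) + 5) + 2" and
        I = "\<lambda>i m'. nats m' 27 0 = i * k * N + r \<and> nats m' 24 0 = i * k \<and> players_done r i m' \<and>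
          settled k {..<i} (ok ?x) ((!) ?x) (nats m' 8)"], goal_cases)
    case (2 m')
    then show ?case using envD(1)[OF E1] by (simp add: agreeD[OF 2])
  next
    case 3
    show ?case using a z by (simp add: players_done_def settled_def)
  next
    case (4 i m2)
    have E2: "env m2" using E1 by (intro env_agree[OF _ 4(2)]) auto
    have b: "nats m2 19 0 = r * k" using a by (simp add: agreeD[OF 4(2)])
    have i: "nats m2 27 0 = i * k * N + r" "nats m2 24 0 = i * k" "players_done r i m2"
      "settled k {..<i} (ok ?x) ((!) ?x) (nats m2 8)" using 4(4) by auto
    show ?case
      unfolding wp_Seq
    proof (rule wp_use[OF insert_spec[OF E2 i(1,2) b 4(3) 4(1) r i(3,4)]], goal_cases)
      case (1 t3 m3)
      have E3: "env m3" using E2 by (intro env_agree[OF _ 1(1)]) auto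
      have c: "nats m3 19 0 = r * k" "nats m3 31 0 = i" using b 4(3) by (simp_all add: agreeD[OF 1(1)])
      have d: "players_done r (Suc i) m3" "progress k {..<Suc i} (ok ?x) ((!) ?x) 0 (nats m3 8)" using 1(2) by auto
      note t3 = 1(2)
      show ?case
      proof (rule wp_use[OF passes_spec[OF E3 c r 4(1) d]], goal_cases)
        case (1 t4 m4)
        have "nats m4 27 0 = nats m3 27 0" "nats m4 24 0 = nats m3 24 0" by (simp_all add: agreeD[OF 1(1)])
        then show ?case using 1(2) t3 by simp
      qed
    qed
  next
    case (5 t2 m2)
    have E2: "env m2" using E1 by (intro env_agree[OF _ 5(2)]) auto
    have b: "nats m2 19 0 = r * k" "reals m2 1 = reals m 1" using a by (simp_all add: agreeD[OF 5(2)])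
    note t2 = 5(1)
    define p where "p = nats m2 8"
    have p: "\<And>i. i < n \<Longrightarrow> p i < k" "\<And>i. i < n \<Longrightarrow> ok ?x i (p i)" "settled k {..<n} (ok ?x) ((!) ?x) p"
      "\<And>a. a < k \<Longrightarrow> nats m2 9 a = card {j \<in> {..<n}. p j = a}"
      using 5(3) by (auto simp: players_done_def p_def)
    show ?case
    proof (rule wp_use[OF check_spec[OF E2 b(1) r]], goal_cases)
      case (1 t3 m3)
      have E3: "env m3" using E2 by (intro env_agree[OF _ 1(1)]) (auto simp: check_com_def)
      have c: "nats m3 19 0 = r * k" "nats m3 8 = p" "reals m3 1 = reals m 1" "nats m3 0 (Suc 0) = k"
        using b envD(2)[OF E2] by (simp_all add: agreeD[OF 1(1)] check_com_def p_def)
      have "nats m2 9 a \<le> ?x ! a + (k + 2) \<longleftrightarrow> excess {..<n} ((!) ?x) p a \<le> int (k + 2)" if "a < k" for a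
        using p(4)[OF that] by (simp add: excess_def) linarith
      then have chk: "0 < nats m3 23 0 \<longleftrightarrow> (\<forall>a<k. excess {..<n} ((!) ?x) p a \<le> int (k + 2))"
        using 1(2) by auto
      have time: "n * (13 * k + 12 + k * (n * (6 * k + 5) + 5) + 2 + 2) + n * (3 * k + 5) =
          n * (k * (n * (6 * k + 5) + 5) + 16 * k + 21)" by (simp add: algebra_simps)
      note t3 = 1(2)
      show ?case
      proof (cases "0 < nats m3 23 0")
        case True
        have p3: "nats m3 8 i < k" if "i < n" for i using p(1) that c by simp
        have "wp output_com m3 (\<lambda>t. \<lambda>m'. t1 + (1 + (1 + (t2 + (t3 + (1 + t + 1))))) \<le> n * (k * (n * (6 * k + 5) + 5) + 16 * k + 21) + 7 * k + 15 \<and>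
            nats m' 19 0 = r * k \<and> nats m' 0 (Suc 0) = k \<and> accepted ?x p \<and> outputs p m')"
        proof (rule wp_use[OF output_spec[OF E3 p3]], goal_cases)
          case (2 t4 m4)
          have "accepted ?x p" using chk True p(1,2) by (simp add: accepted_def)
          moreover have "nats m4 19 0 = r * k" "nats m4 0 (Suc 0) = k" using c by (simp_all add: agreeD[OF 2(1)] output_com_def)
          ultimately show ?case using 2(2) t1 t2 t3 time c by (simp add: outputs_def)
        qed
        then show ?thesis using True by (auto elim!: wp_mono simp: outputs_def)
      next
        case False
        have "rejected ?x" unfolding rejected_def using chk False p(1,3) by blast
        then show ?thesis using False c t1 t2 t3 time by simp
      qed
    qed
  qed simp_all
qed simp_all

lemma search_spec:
  assumes E: "env m"
  shows "wp search_com m (\<lambda>t m'. t \<le> N * (n * (k * (n * (6 * k + 5) + 5) + 16 * k + 21) + 7 * k + 17) + 3 \<and>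
    ((\<forall>x\<in>partitions k (n - 1). rejected x) \<or> (\<exists>x\<in>partitions k (n - 1). \<exists>p. accepted x p \<and> outputs p m')))"
  unfolding search_com_def wp_Seq wp_NStore
proof (rule wp_For_use[where K = N and B = "n * (k * (n * (6 * k + 5) + 5) + 16 * k + 21) + 7 * k + 15" and
      I = "\<lambda>r m'. nats m' 19 0 = r * k \<and> ((\<forall>r'<r. rejected (PL ! r')) \<or>
        (\<exists>x\<in>partitions k (n - 1). \<exists>p. accepted x p \<and> outputs p m'))"], goal_cases)
  case (2 m')
  then show ?case using envD(3)[OF E] by (simp add: agreeD[OF 2])
next
  case (4 r m1)
  have E1: "env m1" using E by (intro env_agree[OF _ 4(2)]) auto
  have a: "nats m1 19 0 = r * k" using 4(4) by simp
  show ?case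
  proof (rule wp_mono[OF candidate_spec[OF E1 a 4(3) 4(1)]], goal_cases)
    case (1 t m2)
    then have *: "rejected (PL ! r) \<and> reals m2 1 = reals m1 1 \<or> (\<exists>p. accepted (PL ! r) p \<and> outputs p m2)" by blast
    have "(\<forall>r'<Suc r. rejected (PL ! r')) \<or> (\<exists>x\<in>partitions k (n - 1). \<exists>p. accepted x p \<and> outputs p m2)"
      using *
    proof
      assume "rejected (PL ! r) \<and> reals m2 1 = reals m1 1"
      then show ?thesis using 4(4) by (auto simp: less_Suc_eq outputs_def)
    next
      assume "\<exists>p. accepted (PL ! r) p \<and> outputs p m2"
      then show ?thesis using PL_nth[OF 4(1)] by blast
    qed
    then show ?case using 1 by (simp add: outputs_def)
  qed
next
  case (5 t m1)
  then show ?case using PL_ex by (auto simp: algebra_simps) 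
qed simp_all

end

section \<open>The whole program\<close>

primrec rpower :: "rexp \<Rightarrow> nat \<Rightarrow> rexp" where
  "rpower e 0 = rconst 1"
| "rpower e (Suc j) = RMul e (rpower e j)"

lemma rval_rpower [simp]: "rval (rpower e j) m = rval e m ^ j"
  by (induction j) auto

definition constant_com :: com where
  "constant_com =
     24 ::= NConst 0 ;;
     For 30 players (RStore 1 (var 24) (rconst 1) ;; 24 ::= NAdd (var 24) strategies)"

text \<open>Only the probabilities of strategy 0 are written; the other cells are zeros of the
  initial memory.\<close>

lemma constant_spec:
  assumes m: "nats m 0 0 = n" "nats m 0 1 = k" "\<And>j. reals m 1 j = 0" and k: "1 \<le> k"
  shows "wp constant_com m (\<lambda>t m'. t \<le> 4 * n + 3 \<and>
    (\<forall>i<n. \<forall>a<k. reals m' 1 (i * k + a) = (if a = 0 then 1 else 0)))"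
  unfolding constant_com_def wp_Seq wp_NStore
proof (rule wp_For_use[where K = n and B = 2 and
      I = "\<lambda>j m'. nats m' 24 0 = j * k \<and> (\<forall>i. \<forall>a<k. reals m' 1 (i * k + a) = (if i < j \<and> a = 0 then 1 else 0))"], goal_cases)
  case (2 m')
  then show ?case using m by (simp add: agreeD[OF 2])
next
  case (4 j m')
  have "nats m' 0 (Suc 0) = k" using m by (simp add: agreeD[OF 4(2)])
  moreover have "i * k + a = j * k \<longleftrightarrow> i = j \<and> a = 0" if "a < k" for i a
    using index_inj[of i k a j 0] that k by auto
  moreover have "reals m' 1 (i * k) = (if i < j then 1 else 0)" for i
    using 4(4) k by (metis add_0_right less_le_trans zero_less_one)
  ultimately show ?case using 4(3,4) by (auto simp: less_Suc_eq)
qed (use m in auto)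

definition noisy_com :: com where
  "noisy_com = root_com ;; powers_com ;; codes_com ;; bin_com ;; kernel_com ;; smooth_com ;; search_com"

definition main_com :: com where
  "main_com = Cond (RLess (RMul (rconst 64) (rpower (ROfNat strategies) 11)) (ROfNat players))
     noisy_com constant_com"

lemma concat_blocks:
  assumes "\<And>i. i < n \<Longrightarrow> length (f i) = l"
  shows "length (concat (map f [0..<n])) = n * l"
    "i < n \<Longrightarrow> j < l \<Longrightarrow> concat (map f [0..<n]) ! (i * l + j) = f i ! j"
proof -
  show len: "length (concat (map f [0..<n])) = n * l"
    using assms by (induction n) auto
  show "concat (map f [0..<n]) ! (i * l + j) = f i ! j" if "i < n" "j < l"
    using assms that
  proof (induction n)
    case (Suc n)
    have ln: "length (concat (map f [0..<n])) = n * l" using Suc.prems(1) by (induction n) auto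
    show ?case
    proof (cases "i = n")
      case True
      then show ?thesis using ln Suc.prems by (simp add: nth_append)
    next
      case False
      then have "i * l + j < n * l" using index_less[of i n j l] Suc.prems by simp
      then show ?thesis using ln Suc False by (simp add: nth_append)
    qed
  qed simp
qed

lemma payoff_list_nth:
  assumes "i < n" "a < k" "r < length (partition_list k (n - 1))"
  defines "l \<equiv> length (partition_list k (n - 1))"
  shows "(i * k + a) * l + r < length (payoff_list n k u)"
    "payoff_list n k u ! ((i * k + a) * l + r) = u i a (partition_list k (n - 1) ! r)"
proof -
  let ?g = "\<lambda>i a. map (u i a) (partition_list k (n - 1))"
  let ?f = "\<lambda>i. concat (map (?g i) [0..<k])"
  have eq: "payoff_list n k u = concat (map ?f [0..<n])"
    by (simp add: payoff_list_def concat_map_singleton)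
  have f: "length (?f i) = k * l" for i using concat_blocks(1)[of k "?g i" l] by (simp add: l_def)
  have al: "a * l + r < k * l" using index_less[of a k r l] assms by simp
  have ix: "(i * k + a) * l + r = i * (k * l) + (a * l + r)" by (simp add: algebra_simps)
  show "(i * k + a) * l + r < length (payoff_list n k u)"
    unfolding eq ix concat_blocks(1)[of n ?f, OF f] using index_less[OF \<open>i < n\<close> al] .
  show "payoff_list n k u ! ((i * k + a) * l + r) = u i a (partition_list k (n - 1) ! r)"
    unfolding eq ix using concat_blocks(2)[of n ?f "k * l" i "a * l + r"] f al assms(1)
      concat_blocks(2)[of k "?g i" l a r] assms by (simp add: l_def)
qed

text \<open>The root \<open>r\<close> is found at run time and hence bound existentially. Everything
  else is expressed in terms of \<open>1 / r\<close>, so that the equilibrium argument applies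
  without reference to the program.\<close>

lemma noisy_spec:
  assumes n: "2 \<le> n" and k: "1 \<le> k"
  defines "N \<equiv> length (partition_list k (n - 1))"
  shows "wp noisy_com (input_memory n k u) (\<lambda>t m'.
    t \<le> (4 * n + 4) + (k * (3 * n + 8) + 3) + (n ^ k * (4 * k + 17) + 7) + (n * (4 * n + 6) + 4) +
      (k * (k * (3 * k + 4) + 9) + 5) +
      (n * (k * (k * (k * (N * (4 * n + 13) + 7) + 4) + 6 * N + 9) + 4) + 3) +
      (N * (n * (k * (n * (6 * k + 5) + 5) + 16 * k + 21) + 7 * k + 17) + 3) \<and>
    (\<exists>r. n \<le> r ^ 3 \<and> (r - 1) ^ 3 < n \<and>
      (let th = 1 / real r; v = (\<lambda>i a. smooth th k k (u i a)) in
        (\<forall>x\<in>partitions k (n - 1). searcher.rejected n k th v x) \<or>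
        (\<exists>x\<in>partitions k (n - 1). \<exists>p. searcher.accepted n k th v x p \<and> searcher.outputs n k th p m'))))"
proof -
  let ?m = "input_memory n k u"
  have m: "nats ?m 0 0 = n" "nats ?m 0 1 = k" "\<And>A j. A \<noteq> 0 \<Longrightarrow> reals ?m A j = 0"
    "\<And>j. j < length (payoff_list n k u) \<Longrightarrow> reals ?m 0 j = payoff_list n k u ! j"
    by (simp_all add: input_memory_def)
  show ?thesis
    unfolding noisy_com_def wp_Seq
  proof (rule wp_use[OF root_spec[OF m(1) n]], goal_cases)
    case (1 t1 m1)
    then obtain r where r: "n \<le> r ^ 3" "(r - 1) ^ 3 < n" "reals m1 6 0 = 1 / real r" by blast
    define th where "th = 1 / real r"
    define v where "v i a = smooth th k k (u i a)" for i a
    interpret searcher n k th v by unfold_locales (use n k in \<open>auto simp: th_def\<close>)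
    have PN: "N = length PL" "machine.N n k = N" by (simp_all add: PL_def N_def assms(3))
    have m1: "nats m1 0 0 = n" "nats m1 0 1 = k" "reals m1 0 = reals ?m 0" "reals m1 4 = reals ?m 4"
      "reals m1 5 = reals ?m 5" "reals m1 6 0 = th"
      using m(1,2) r(3) by (simp_all add: agreeD[OF 1(1)] root_com_def th_def)
    note t1 = 1(2)
    show ?case
    proof (rule wp_use[OF powers_spec[OF m1(1,2)]], goal_cases)
      case (1 t2 m2)
      have m2: "nats m2 0 0 = n" "nats m2 0 1 = k" "reals m2 0 = reals ?m 0" "reals m2 4 = reals ?m 4"
        "reals m2 5 = reals ?m 5" "reals m2 6 0 = th" "nats m2 12 0 = n ^ k"
        using m1 1(2) by (simp_all add: agreeD[OF 1(1)] powers_com_def)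
      note t2 = 1(2)
      show ?case
      proof (rule wp_use[OF codes_spec[OF m2(1,2,7) n]], goal_cases)
        case (1 t3 m3)
        have m3: "nats m3 0 0 = n" "nats m3 0 1 = k" "reals m3 0 = reals ?m 0" "reals m3 4 = reals ?m 4"
          "reals m3 5 = reals ?m 5" "reals m3 6 0 = th" "nats m3 40 = nats m2 40"
          using m2 by (simp_all add: agreeD[OF 1(1)] codes_com_def tables_com_def emit_com_def)
        note t3 = 1(2)
        have codes: "filter (\<lambda>c. digit_sum n c = n - 1) [0..<n ^ k] = map (code n) PL"
          using map_code_partition_list[of n "n - 1" k] n by (simp add: PL_def)
        have dig: "code n (PL ! i) div n ^ (k - 1 - a) mod n = PL ! i ! a" if "i < machine.N n k" "a < k" for i a
        proof -
          have "\<forall>y\<in>set (PL ! i). y < n"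
            using partition_entry_le[OF PL_nth[OF that(1)]] n by fastforce
          then show ?thesis using code_digit[of "PL ! i" n a] length_PL_nth[OF that(1)] that(2) by simp
        qed
        have L3: "layout m3"
          using t3 t2 m3(1,2,7) dig unfolding codes layout_def listed_def by (auto simp: machine.N_def[OF machine_axioms])
        show ?case
        proof (rule wp_use[OF bin_spec[OF m3(1,6)]], goal_cases)
          case (3 t4 m4)
          have m4: "nats m4 0 1 = k" "reals m4 0 = reals ?m 0" "reals m4 5 = reals ?m 5" "reals m4 6 0 = th"
            using m3 by (simp_all add: agreeD[OF 3(1)] bin_com_def)
          have L4: "layout m4" using L3 by (intro layout_agree[OF _ 3(1)]) (auto simp: bin_com_def)
          have B4: "bins m4" using 3(2) by (simp add: bins_def)
          note t4 = 3(2)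
          show ?case
          proof (rule wp_use[OF kernel_spec[OF m4(1,4)]], goal_cases)
            case (2 t5 m5)
            have m5: "reals m5 0 = reals ?m 0" "reals m5 6 0 = th"
              using m4 by (simp_all add: agreeD[OF 2(1)] kernel_com_def)
            have L5: "layout m5" using L4 by (intro layout_agree[OF _ 2(1)]) (auto simp: kernel_com_def)
            have B5: "bins m5" using B4 by (intro bins_agree[OF _ 2(1)]) (auto simp: kernel_com_def)
            have P5: "payoffs 0 u u m5"
              using payoff_list_nth[of _ n _ k _ u] m(4) by (simp add: payoffs_def m5 machine.N_def[OF machine_axioms] PL_def)
            note t5 = 2(2)
            show ?case
            proof (rule wp_use[OF smooth_spec[OF L5 B5 P5]], goal_cases)
              case (1 t6 m6)
              have w: "nwrites smooth_com = {18, 30, 31, 32, 33, 19, 34, 17, 20, 21, 35}" "rwrites smooth_com = {2, 7, 3, 0}"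
                by (auto simp: smooth_com_def)
              have E: "env m6"
                unfolding env_def
              proof (intro conjI allI impI)
                show "layout m6" using L5 by (intro layout_agree[OF _ 1(1)]) (auto simp: w)
                show "reals m6 6 0 = th" using m5 by (simp add: agreeD[OF 1(1)] w)
                show "kernel_table k (kernel th k k) m6" using t5 by (simp add: agreeD[OF 1(1)] w kernel_table_def)
                show "nats m6 28 a = a * k" if "a < k" for a using t5 that by (simp add: agreeD[OF 1(1)] w)
                fix i a r assume "i < n" "a < k" "r < machine.N n k"
                moreover have "i * k + a < n * k" using index_less calculation by blast
                ultimately show "reals m6 0 ((i * k + a) * machine.N n k + r) = v i a (PL ! r)"
                  using 1(2) by (simp add: payoffs_def v_def)
              qed
              note t6 = 1(2)
              show ?case
              proof (rule wp_mono[OF search_spec[OF E]], goal_cases)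
                case (1 t7 m7)
                have "let th = 1 / real r; v = (\<lambda>i a. smooth th k k (u i a)) in
                    (\<forall>x\<in>partitions k (n - 1). searcher.rejected n k th v x) \<or>
                    (\<exists>x\<in>partitions k (n - 1). \<exists>p. searcher.accepted n k th v x p \<and> searcher.outputs n k th p m7)"
                  using 1 unfolding Let_def th_def[symmetric] v_def[abs_def, symmetric] by blast
                then show ?case using r(1,2) 1 t1 t2 t3 t4 t5 t6 by (auto simp only: PN) 
              qed
            qed
          qed (use m4 m in auto)
        qed (use m3 m n in auto)
      qed
    qed
  qed
qed

section \<open>Error and running time\<close>

text \<open>\<open>X\<close> dominates the polynomial terms in \<open>n\<close> and
  \<open>k\<close>, thanks to \<open>k * k \<le> n\<close>, and \<open>A\<close> dominates the terms
  containing \<open>N\<close>. Splitting off k^2 N in \<open>A\<close> leaves n^2 k, and the bound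
  on k^2 N turns the product into 15 n k n^k.\<close>

lemma time_bound:
  fixes n k N :: nat
  assumes n: "2 \<le> n" and k: "1 \<le> k" "k ^ 2 \<le> n" and N: "k ^ 2 * N \<le> 15 * n ^ (k - 1)"
  shows "(4 * n + 4) + (k * (3 * n + 8) + 3) + (n ^ k * (4 * k + 17) + 7) + (n * (4 * n + 6) + 4) +
      (k * (k * (3 * k + 4) + 9) + 5) +
      (n * (k * (k * (k * (N * (4 * n + 13) + 7) + 4) + 6 * N + 9) + 4) + 3) +
      (N * (n * (k * (n * (6 * k + 5) + 5) + 16 * k + 21) + 7 * k + 17) + 3) \<le>
    2000 * ((n + k) * k * n ^ k)"
proof -
  let ?B = "(n + k) * k * n ^ k"
  define X where "X = n * n * k"
  define A where "A = N * (n * n * (k * k * k))"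
  have kk: "k * k \<le> n" using k(2) by (simp add: power2_eq_square)
  have nk: "n ^ k = n * n ^ (k - 1)" using k(1) by (cases k) auto
  have "n * k * n \<le> (n + k) * k * n ^ k" using n unfolding nk by (intro mult_le_mono) auto
  then have XB: "X \<le> ?B" by (simp add: X_def mult_ac)
  have "A = n * n * k * (k ^ 2 * N)" by (simp add: A_def power2_eq_square mult_ac)
  also have "\<dots> \<le> n * n * k * (15 * n ^ (k - 1))" using N by (rule mult_le_mono2)
  also have "\<dots> = 15 * (n * k * n ^ k)" by (simp add: nk mult_ac)
  also have "\<dots> \<le> 15 * ?B" by (intro mult_le_mono) auto
  finally have AB: "A \<le> 15 * ?B" .
  have nkB: "k * n ^ k \<le> ?B" "n ^ k \<le> ?B"
  proof -
    have "1 * k * n ^ k \<le> ?B" using n by (intro mult_le_mono) auto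
    moreover have "1 * 1 * n ^ k \<le> ?B" using n k(1) by (intro mult_le_mono) auto
    ultimately show "k * n ^ k \<le> ?B" "n ^ k \<le> ?B" by simp_all
  qed
  obtain a b where ab: "n = Suc a" "k = Suc b" using n k(1) by (metis Suc_le_D numeral_2_eq_2 One_nat_def)
  have X: "1 \<le> X" "k \<le> X" "n \<le> X" "n * n \<le> X" "n * k \<le> X"
    by (simp_all add: X_def ab algebra_simps)
  have X2: "k * k \<le> X" "k * k * k \<le> X" "n * k * k \<le> X" "n * k * (k * k) \<le> X"
  proof -
    have "n * k * (k * k) \<le> n * k * n" using kk by (rule mult_le_mono2)
    then show 1: "n * k * (k * k) \<le> X" by (simp add: X_def mult_ac)
    have "k * k \<le> n * k * (k * k)" "k * k * k \<le> n * k * (k * k)" "n * k * k \<le> n * k * (k * k)"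
      by (simp_all add: ab algebra_simps)
    then show "k * k \<le> X" "k * k * k \<le> X" "n * k * k \<le> X" using 1 by linarith+
  qed
  have le: "y \<le> n * n * (k * k * k) \<Longrightarrow> N * y \<le> A" for y unfolding A_def by (rule mult_le_mono2)
  have A: "N * (n * k * k * k) \<le> A" "N * (n * n * k * k) \<le> A" "N * (n * n * k) \<le> A" "N * (n * k) \<le> A"
    "N * n \<le> A" "N * k \<le> A" "N * 1 \<le> A" "N * (n * n * k * k * k) \<le> A"
    by (rule le, simp add: ab algebra_simps)+
  have "n ^ k * (4 * k + 17) = 4 * (k * n ^ k) + 17 * n ^ k" by (simp add: algebra_simps)
  then have 3: "n ^ k * (4 * k + 17) \<le> 21 * ?B" using nkB by linarith
  have 2: "k * (3 * n + 8) = 3 * (n * k) + 8 * k" by (simp add: algebra_simps)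
  have 4: "n * (4 * n + 6) = 4 * (n * n) + 6 * n" by (simp add: algebra_simps)
  have 5: "k * (k * (3 * k + 4) + 9) = 3 * (k * k * k) + 4 * (k * k) + 9 * k" by (simp add: algebra_simps)
  have 6: "n * (k * (k * (k * (N * (4 * n + 13) + 7) + 4) + 6 * N + 9) + 4) =
      4 * (N * (n * n * k * k * k)) + 13 * (N * (n * k * k * k)) + 7 * (n * k * (k * k)) + 4 * (n * k * k) +
      6 * (N * (n * k)) + 9 * (n * k) + 4 * n" by (simp add: algebra_simps)
  have 7: "N * (n * (k * (n * (6 * k + 5) + 5) + 16 * k + 21) + 7 * k + 17) =
      6 * (N * (n * n * k * k)) + 5 * (N * (n * n * k)) + 21 * (N * (n * k)) + 21 * (N * n) + 7 * (N * k) + 17 * (N * 1)"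
    by (simp add: algebra_simps)
  show ?thesis unfolding 2 4 5 6 7 using 3 X X2 A XB AB by linarith
qed

lemma wp_main:
  shows "64 * k ^ 11 < n \<Longrightarrow> wp noisy_com (input_memory n k u) Q \<Longrightarrow> wp main_com (input_memory n k u) (\<lambda>t m. Q (t - 1) m \<and> 0 < t)"
    "\<not> 64 * k ^ 11 < n \<Longrightarrow> wp constant_com (input_memory n k u) Q \<Longrightarrow> wp main_com (input_memory n k u) (\<lambda>t m. Q (t - 1) m \<and> 0 < t)"
proof -
  have "bval (RLess (RMul (rconst 64) (rpower (ROfNat strategies) 11)) (ROfNat players)) (input_memory n k u) \<longleftrightarrow>
      real (64 * k ^ 11) < real n" by (simp add: input_memory_def)
  then have *: "bval (RLess (RMul (rconst 64) (rpower (ROfNat strategies) 11)) (ROfNat players)) (input_memory n k u) \<longleftrightarrow> 64 * k ^ 11 < n"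
    by (simp only: of_nat_less_iff)
  show "wp main_com (input_memory n k u) (\<lambda>t m. Q (t - 1) m \<and> 0 < t)"
    if "64 * k ^ 11 < n" "wp noisy_com (input_memory n k u) Q"
    using that unfolding main_com_def wp_Cond * by simp
  show "wp main_com (input_memory n k u) (\<lambda>t m. Q (t - 1) m \<and> 0 < t)"
    if "\<not> 64 * k ^ 11 < n" "wp constant_com (input_memory n k u) Q"
    using that unfolding main_com_def wp_Cond * by simp
qed

definition error :: "nat \<Rightarrow> nat \<Rightarrow> real" where
  "error n k = 58 * (real n powr (- 1 / 3) * real k powr (11 / 3))"

text \<open>Below the threshold n^(1/3) is at most 4 k^(11/3), and 4 is less than 58. The exponent
  11 of the threshold is thus three times 11/3.\<close>

lemma error_ge_one:
  assumes "1 \<le> n" "1 \<le> k" "n \<le> 64 * k ^ 11"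
  shows "1 \<le> error n k"
proof -
  have "real n \<le> 64 * real k powr 11"
  proof -
    have "real n \<le> real (64 * k ^ 11)" using assms(3) by (simp only: of_nat_le_iff)
    then show ?thesis using assms(2) by (simp add: powr_numeral)
  qed
  then have "real n powr (1/3) \<le> (64 * real k powr 11) powr (1/3)" by (intro powr_mono2) auto
  also have "\<dots> = 64 powr (1/3) * (real k powr 11) powr (1/3)" by (rule powr_mult)
  also have "(real k powr 11) powr (1/3) = real k powr (11/3)" by (simp only: powr_powr) simp
  also have "(64::real) powr (1/3) = 4"
  proof -
    have "(64::real) = 4 powr 3" by (simp add: powr_numeral)
    then show ?thesis by (simp only: powr_powr) simp
  qed
  finally have "real n powr (1/3) \<le> 58 * real k powr (11/3)" by (smt (verit) powr_ge_zero)
  then have "real n powr (- 1/3) * real n powr (1/3) \<le> real n powr (- 1/3) * (58 * real k powr (11/3))"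
    by (intro mult_left_mono) auto
  moreover have "real n powr (- 1/3) * real n powr (1/3) = 1" using assms(1) by (simp flip: powr_add)
  ultimately show ?thesis by (simp add: error_def)
qed

lemma error_ge_noise:
  assumes "1 \<le> n" "1 \<le> k" "n \<le> r ^ 3"
  shows "58 * real k ^ 2 * (1 / real r) \<le> error n k"
proof -
  have r: "0 < r" using assms(1,3) by (cases r) auto
  have "real n \<le> real (r ^ 3)" using assms(3) by (simp only: of_nat_le_iff)
  then have "real n \<le> real r powr 3" using r by (simp add: powr_numeral)
  then have "real n powr (1/3) \<le> (real r powr 3) powr (1/3)" by (intro powr_mono2) auto
  also have "(real r powr 3) powr (1/3) = real r" by (simp only: powr_powr) (use r in simp)
  finally have "real n powr (1/3) \<le> real r" .
  then have 1: "1 / real r \<le> real n powr (- 1/3)" using assms(1) r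
    by (simp add: powr_minus field_simps)
  have "real k powr 2 \<le> real k powr (11/3)" using assms(2) by (intro powr_mono) auto
  then have 2: "real k ^ 2 \<le> real k powr (11/3)" using assms(2) by (simp add: powr_numeral)
  have "real k ^ 2 * (1 / real r) \<le> real k powr (11/3) * real n powr (- 1/3)"
    using 1 2 by (intro mult_mono) auto
  then have "58 * (real k ^ 2 * (1 / real r)) \<le> 58 * (real k powr (11/3) * real n powr (- 1/3))" by simp
  then show ?thesis unfolding error_def by (simp only: mult_ac)
qed

theorem theorem1p2:
  "\<exists>(prog :: com) (\<epsilon> :: nat \<Rightarrow> nat \<Rightarrow> real) (T :: nat \<Rightarrow> nat \<Rightarrow> real).
     \<epsilon> \<in> soft_O (\<lambda>n k. real n powr (- 1 / 3) * real k powr (11 / 3)) \<and>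
     T \<in> soft_O (\<lambda>n k. real (n + k) * real k * real n ^ k) \<and>
     (\<forall>(n::nat) (k::nat) (u :: nat \<Rightarrow> nat \<Rightarrow> nat list \<Rightarrow> real).
        n \<ge> 1 \<and> k \<ge> 1 \<and> anonymous_game n k u \<longrightarrow>
        (\<exists>t m s. exec prog (input_memory n k u) t m \<and> real t \<le> T n k \<and>
           outputs_profile n k m s \<and> approx_nash n k u (\<epsilon> n k) s))"
proof (rule exI[of _ main_com], rule exI[of _ error],
    rule exI[of _ "\<lambda>n k. 2001 * (real (n + k) * real k * real n ^ k)"], intro conjI allI impI)
  show "error \<in> soft_O (\<lambda>n k. real n powr (- 1 / 3) * real k powr (11 / 3))"
    unfolding soft_O_def by (intro CollectI exI[of _ 58] exI[of _ 0]) (simp add: error_def abs_mult)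
  show "(\<lambda>n k. 2001 * (real (n + k) * real k * real n ^ k)) \<in> soft_O (\<lambda>n k. real (n + k) * real k * real n ^ k)"
    unfolding soft_O_def by (intro CollectI exI[of _ 2001] exI[of _ 0]) (simp add: abs_mult)
  fix n k :: nat and u :: "nat \<Rightarrow> nat \<Rightarrow> nat list \<Rightarrow> real"
  assume *: "n \<ge> 1 \<and> k \<ge> 1 \<and> anonymous_game n k u"
  then have n: "1 \<le> n" and k: "1 \<le> k" and game: "anonymous_game n k u" by auto
  let ?B = "(n + k) * k * n ^ k"
  have B: "n + 1 \<le> ?B"
  proof -
    have "(n + 1) * 1 * 1 \<le> ?B" using n k by (intro mult_le_mono) auto
    then show ?thesis by simp
  qed
  have "wp main_com (input_memory n k u) (\<lambda>t m. t \<le> 2001 * ?B \<and>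
    (\<exists>s. outputs_profile n k m s \<and> approx_nash n k u (error n k) s))"
  proof (cases "64 * k ^ 11 < n")
    case False
    have in0: "nats (input_memory n k u) 0 0 = n" "nats (input_memory n k u) 0 1 = k" "\<And>j. reals (input_memory n k u) 1 j = 0"
      by (simp_all add: input_memory_def)
    show ?thesis
    proof (rule wp_mono[OF wp_main(2)[OF False constant_spec[OF in0 k]]], goal_cases)
      case (1 t m)
      let ?s = "\<lambda>_ :: nat. return_pmf 0 :: nat pmf"
      have prof: "mixed_profile n k ?s" using k by (simp add: mixed_profile_def)
      have "outputs_profile n k m ?s"
        using 1 prof by (simp add: outputs_profile_def indicator_def)
      moreover have "approx_nash n k u (error n k) ?s"
        using False n k by (intro approx_nash_trivial[OF game prof] error_ge_one) auto
      moreover have "t \<le> 2001 * ?B" using 1 B by linarith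
      ultimately show ?case by blast
    qed
  next
    case True
    have k11: "k ^ 2 \<le> k ^ 11" using k by (intro power_increasing) auto
    have "1 \<le> k ^ 11" using k by simp
    then have n2: "2 \<le> n" using True by linarith
    have kn: "k ^ 2 \<le> n" using k11 True by linarith
    show ?thesis
    proof (rule wp_mono[OF wp_main(1)[OF True noisy_spec[OF n2 k]]], goal_cases)
      case (1 c m)
      from conjunct2[OF conjunct1[OF 1]] obtain r where r: "n \<le> r ^ 3" "(r - 1) ^ 3 < n"
        and out: "let th = 1 / real r; v = (\<lambda>i a. smooth th k k (u i a)) in
          (\<forall>x\<in>partitions k (n - 1). searcher.rejected n k th v x) \<or>
          (\<exists>x\<in>partitions k (n - 1). \<exists>p. searcher.accepted n k th v x p \<and> searcher.outputs n k th p m)" by (elim exE conjE)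
      interpret noisy_game n k r u using k True r game by unfold_locales
      interpret S: searcher n k t v by unfold_locales (use n2 k t_props in auto)
      have v_eq: "v = (\<lambda>i a. smooth t k k (u i a))" by (simp add: v_def fun_eq_iff)
      have out': "(\<forall>x\<in>partitions k (n - 1). S.rejected x) \<or>
          (\<exists>x\<in>partitions k (n - 1). \<exists>p. S.accepted x p \<and> S.outputs p m)"
        using out unfolding Let_def t_def[symmetric] v_eq[symmetric] .
      \<comment> \<open>\<open>x0\<close> only shows that not every count vector is rejected; the
        one behind the actual output may be another.\<close>
      obtain x0 where x0: "x0 \<in> partitions k (n - 1)" "\<forall>p. (\<forall>i<n. p i < k) \<longrightarrow>
          settled k {..<n} (admissible k v (21 * real k * t) x0) ((!) x0) p \<longrightarrow>
          (\<forall>a<k. excess {..<n} ((!) x0) p a \<le> int (k + 2))"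
        using feasible_exists by blast
      then have "\<not> S.rejected x0" unfolding S.rejected_def by blast
      then have "\<not> (\<forall>x\<in>partitions k (n - 1). S.rejected x)" using x0(1) by blast
      then obtain x p where xp: "x \<in> partitions k (n - 1)" "S.accepted x p" "S.outputs p m" using out' by blast
      have "good x p" using xp(2) by (simp add: good_def S.accepted_def)
      have "58 * real k ^ 2 * t \<le> error n k" using error_ge_noise[OF n k r(1)] by (simp add: t_def)
      from good_approx_nash[OF xp(1) \<open>good x p\<close> this] obtain s where s: "mixed_profile n k s"
        "\<forall>i<n. \<forall>a<k. pmf (s i) a = kernel t k k (p i) a" "approx_nash n k u (error n k) s" by blast
      have "outputs_profile n k m s" using s(1,2) xp(3) by (simp add: outputs_profile_def S.outputs_def)
      moreover note s(3)
      \<comment> \<open>The initial test of \<open>main_com\<close> is the one step subtracted from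
        \<open>c\<close>; it turns 2000 into 2001.\<close>
      moreover have "c - 1 \<le> 2000 * ?B"
        by (rule order_trans[OF conjunct1[OF conjunct1[OF 1]] time_bound[OF n2 k kn length_partition_list_le[OF k kn]]])
      then have "c \<le> 2001 * ?B" using B by linarith
      ultimately show ?case by blast
    qed
  qed
  then obtain t m s where e: "exec main_com (input_memory n k u) t m" "t \<le> 2001 * ?B"
    "outputs_profile n k m s" "approx_nash n k u (error n k) s" unfolding wp_def by blast
  have "real t \<le> real (2001 * ?B)" using e(2) by (simp only: of_nat_le_iff)
  also have "\<dots> = 2001 * (real (n + k) * real k * real n ^ k)" by simp
  finally show "\<exists>t m s. exec main_com (input_memory n k u) t m \<and> real t \<le> 2001 * (real (n + k) * real k * real n ^ k) \<and>
     outputs_profile n k m s \<and> approx_nash n k u (error n k) s" using e(1,3,4) by blast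
qed

end
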